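(* Let $T$ be the two-dimensional torus with an essential one-vertex triangulation, let $O$ be a left order on $\pi_1(T)=\mathbb{Z}^2$, and let $F_O$ be the corresponding fLOiation of $T$. Then $F_O$ has a closed leaf if and only if $O$ is not Archimedean.
   Context: An order on $\mathbb{Z}^2$ is a translation-invariant linear order. It is Archimedean if for all positive elements $a,b$ there is $n\in\mathbb{N}$ with $b<na$. A one-vertex triangulation is essential if no edge-loop is null-homotopic. Construction of the fLOiation. Let $G=\pi_1(T)$, let $\tilde T=\mathbb{R}^2$ be the universal cover with lifted triangulation and induced PL structure, $v$ the vertex of the triangulation and $v_0$ a fixed lift; the vertices of $\tilde T$ are $gv_0$, $g\in G$. (1) Enumerate $G=\{s_0=e,s_1,\dots\}$ and define $i_0:G\to\mathbb{R}$ inductively: $i_0(s_0)=0$. If $s_n>s_p$ for all $p<n$, set $i_0(s_n)=\max_{p<n}i_0(s_p)+1$. If $s_n<s_p$ for all $p<n$, set $i_0(s_n)=\min_{p<n}i_0(s_p)-1$. Otherwise set $i_0(s_n)=\frac{i_0(s_a)+i_0(s_b)}{2}$, with $s_a<s_n<s_b$ the closest elements to $s_n$ from below and above among $s_0,\dots,s_{n-1}$. (2) Define $\rho:G\to\mathrm{Homeo}^+(\mathbb{R})$ by $\rho(g)(i_0(h))=i_0(gh)$, extended linearly over complementary intervals. (3) Define $F:\tilde T\to\mathbb{R}$ by $F(gv_0)=\rho(g)(0)$. Orient each edge so that $F$ is greater at its end point. If the end point is $v_0$, then $F$ is linear on the edge; if it is $gv_0$ with $g\ne e$, then $F(x)=\rho(g)(F(g^{-1}x))$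 on the edge. On each triangle extend $F$ so that its level sets in the triangle are straight segments joining points of the edges with equal value of $F$. (4) The level sets of $F$ form a $G$-invariant singular foliation of $\tilde T$; $F_O$ is the singular foliation of $T$ it descends to. (Using other order-preserving embeddings of $G$ into $\mathbb{R}$ in place of $i_0$ is regarded as changing the foliation only by inserting or removing strips of parallel leaves.) *)

theory Defs
  imports "HOL-Analysis.Analysis"
begin

section \<open>Orders on the group of integer pairs\<close>

definition left_order :: "((int \<times> int) \<times> (int \<times> int)) set \<Rightarrow> bool" where
  "left_order R \<longleftrightarrow>
     linear_order R \<and> (\<forall>g a b. (a, b) \<in> R \<longrightarrow> (g + a, g + b) \<in> R)"

definition less_in :: "'a rel \<Rightarrow> 'a \<Rightarrow> 'a \<Rightarrow> bool" where
  "less_in R a b \<longleftrightarrow> (a, b) \<in> R \<and> a \<noteq> b"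

definition archimedean_order :: "((int \<times> int) \<times> (int \<times> int)) set \<Rightarrow> bool" where
  "archimedean_order R \<longleftrightarrow>
     (\<forall>a b. less_in R 0 a \<and> less_in R 0 b \<longrightarrow> (\<exists>n::nat. less_in R b (\<Sum>i<n. a)))"

section \<open>The torus, its universal cover and its triangulations\<close>

definition torus :: "(complex \<times> complex) set" where
  "torus = sphere 0 1 \<times> sphere 0 1"

definition cover :: "real \<times> real \<Rightarrow> complex \<times> complex" where
  "cover x = (cis (2 * pi * fst x), cis (2 * pi * snd x))"

text \<open>The fundamental group of the torus is identified with the group of deck transformations
  of \<open>cover\<close>, that is, with the integer pairs acting on the plane by translations.\<close>

definition deck :: "int \<times> int \<Rightarrow> real \<times> real \<Rightarrow> real \<times> real" where
  "deck g x = x + (real_of_int (fst g), real_of_int (snd g))"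

definition corners :: "(real \<times> real) set" where
  "corners = {(0, 0), (1, 0), (0, 1)}"

definition std_triangle :: "(real \<times> real) set" where
  "std_triangle = convex hull corners"

text \<open>A triangulation is meant in the generalised sense (a finite cell structure whose closed
  cells are simplices with possibly identified faces), as it has to be for a torus with only one
  vertex. It is given by its vertices \<open>V\<close> and by the characteristic maps \<open>E\<close> of its edges and
  \<open>D\<close> of its triangles; only the values on the unit interval and on \<open>std_triangle\<close> matter.
  The sides of a triangle are attached to edges by affine maps, in either direction. As the torus
  is compact, restricting to finitely many cells loses no generality, and the topology is then
  automatically the quotient topology. The characteristic maps define the PL structure.\<close>

definition torus_triangulation ::
  "(complex \<times> complex) set \<Rightarrow> (real \<Rightarrow> complex \<times> complex) set \<Rightarrow>
   (real \<times> real \<Rightarrow> complex \<times> complex) set \<Rightarrow> bool" where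
  "torus_triangulation V E D \<longleftrightarrow>
     finite V \<and> finite E \<and> finite D \<and>
     (\<forall>\<gamma>\<in>E. path \<gamma> \<and> inj_on \<gamma> {0<..<1} \<and> pathstart \<gamma> \<in> V \<and> pathfinish \<gamma> \<in> V) \<and>
     (\<forall>\<sigma>\<in>D. continuous_on std_triangle \<sigma> \<and> inj_on \<sigma> (interior std_triangle) \<and>
        (\<forall>a\<in>corners. \<forall>b\<in>corners. a \<noteq> b \<longrightarrow>
           (\<exists>\<gamma>\<in>E. (\<forall>t\<in>{0..1}. \<sigma> (linepath a b t) = \<gamma> t) \<or>
                   (\<forall>t\<in>{0..1}. \<sigma> (linepath a b t) = reversepath \<gamma> t)))) \<and>
     torus = V \<union> (\<Union>\<gamma>\<in>E. \<gamma> ` {0<..<1}) \<union> (\<Union>\<sigma>\<in>D. \<sigma> ` interior std_triangle) \<and>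
     (\<forall>\<gamma>\<in>E. disjnt V (\<gamma> ` {0<..<1})) \<and>
     (\<forall>\<sigma>\<in>D. disjnt V (\<sigma> ` interior std_triangle)) \<and>
     (\<forall>\<gamma>\<in>E. \<forall>\<sigma>\<in>D. disjnt (\<gamma> ` {0<..<1}) (\<sigma> ` interior std_triangle)) \<and>
     pairwise (\<lambda>\<gamma> \<gamma>'. disjnt (\<gamma> ` {0<..<1}) (\<gamma>' ` {0<..<1})) E \<and>
     pairwise (\<lambda>\<sigma> \<sigma>'. disjnt (\<sigma> ` interior std_triangle) (\<sigma>' ` interior std_triangle)) D"

definition essential :: "(real \<Rightarrow> complex \<times> complex) set \<Rightarrow> bool" where
  "essential E \<longleftrightarrow> (\<forall>\<gamma>\<in>E. \<not> (\<exists>a. homotopic_loops torus \<gamma> (linepath a a)))"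

text \<open>Lifted edges are taken in both directions, so that they can be oriented later.\<close>

definition lifted_edges :: "(real \<Rightarrow> complex \<times> complex) set \<Rightarrow> (real \<Rightarrow> real \<times> real) set" where
  "lifted_edges E =
     {\<eta>. path \<eta> \<and> (\<exists>\<gamma>\<in>E. (\<forall>t\<in>{0..1}. cover (\<eta> t) = \<gamma> t) \<or>
                         (\<forall>t\<in>{0..1}. cover (\<eta> t) = reversepath \<gamma> t))}"

definition lifted_triangles ::
  "(real \<times> real \<Rightarrow> complex \<times> complex) set \<Rightarrow> (real \<times> real \<Rightarrow> real \<times> real) set" where
  "lifted_triangles D =
     {\<tau>. continuous_on std_triangle \<tau> \<and> (\<exists>\<sigma>\<in>D. \<forall>z\<in>std_triangle. cover (\<tau> z) = \<sigma> z)}"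

section \<open>The fLOiation of an order\<close>

definition enumeration :: "(nat \<Rightarrow> int \<times> int) \<Rightarrow> bool" where
  "enumeration s \<longleftrightarrow> bij s \<and> s 0 = 0"

definition order_embedding ::
  "(int \<times> int) rel \<Rightarrow> (nat \<Rightarrow> int \<times> int) \<Rightarrow> (int \<times> int \<Rightarrow> real) \<Rightarrow> bool" where
  "order_embedding R s i \<longleftrightarrow>
     i (s 0) = 0 \<and>
     (\<forall>n>0.
        ((\<forall>p<n. less_in R (s p) (s n)) \<longrightarrow> i (s n) = Max ((\<lambda>p. i (s p)) ` {..<n}) + 1) \<and>
        ((\<forall>p<n. less_in R (s n) (s p)) \<longrightarrow> i (s n) = Min ((\<lambda>p. i (s p)) ` {..<n}) - 1) \<and>
        (\<forall>a<n. \<forall>b<n.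
           less_in R (s a) (s n) \<and> (\<forall>p<n. less_in R (s p) (s n) \<longrightarrow> (s p, s a) \<in> R) \<and>
           less_in R (s n) (s b) \<and> (\<forall>p<n. less_in R (s n) (s p) \<longrightarrow> (s b, s p) \<in> R) \<longrightarrow>
           i (s n) = (i (s a) + i (s b)) / 2))"

text \<open>The set \<open>range i\<close> need not be closed; the extension is continuous, and linear on the
  intervals complementary to the closure.\<close>

definition dynamical_realization ::
  "(int \<times> int \<Rightarrow> real) \<Rightarrow> (int \<times> int \<Rightarrow> real \<Rightarrow> real) \<Rightarrow> bool" where
  "dynamical_realization i \<rho> \<longleftrightarrow>
     (\<forall>g. strict_mono (\<rho> g) \<and> (\<exists>f. homeomorphism UNIV UNIV (\<rho> g) f) \<and>
          (\<forall>h. \<rho> g (i h) = i (g + h)) \<and>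
          (\<forall>I\<in>components (- closure (range i)). \<exists>m c. \<forall>x\<in>I. \<rho> g x = m * x + c))"

text \<open>A level set in a triangle may be a single point (at the lowest and the highest corner), which
  is a degenerate segment.\<close>

definition height_function ::
  "(real \<Rightarrow> complex \<times> complex) set \<Rightarrow> (real \<times> real \<Rightarrow> complex \<times> complex) set \<Rightarrow>
   real \<times> real \<Rightarrow> (int \<times> int \<Rightarrow> real \<Rightarrow> real) \<Rightarrow> (real \<times> real \<Rightarrow> real) \<Rightarrow> bool" where
  "height_function E D v0 \<rho> F \<longleftrightarrow>
     (\<forall>g. F (deck g v0) = \<rho> g 0) \<and>
     (\<forall>\<eta>\<in>lifted_edges E. F (pathstart \<eta>) < F (pathfinish \<eta>) \<longrightarrow>
        (pathfinish \<eta> = v0 \<longrightarrow>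
           (\<forall>t\<in>{0..1}. F (\<eta> t) = (1 - t) * F (pathstart \<eta>) + t * F (pathfinish \<eta>))) \<and>
        (\<forall>g. g \<noteq> 0 \<and> pathfinish \<eta> = deck g v0 \<longrightarrow>
           (\<forall>t\<in>{0..1}. F (\<eta> t) = \<rho> g (F (deck (- g) (\<eta> t)))))) \<and>
     (\<forall>\<tau>\<in>lifted_triangles D. \<forall>c\<in>(F \<circ> \<tau>) ` std_triangle.
        \<exists>a\<in>frontier std_triangle. \<exists>b\<in>frontier std_triangle.
          {z \<in> std_triangle. F (\<tau> z) = c} = closed_segment a b)"

text \<open>A foliation is given by its set of leaves. The leaves upstairs are the connected components
  of the level sets of \<open>F\<close>, and the leaves in the torus are their images.\<close>

definition leaves :: "(real \<times> real \<Rightarrow> real) \<Rightarrow> (complex \<times> complex) set set" where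
  "leaves F = {cover ` C | C c. C \<in> components {x. F x = c}}"

definition fLOiation ::
  "complex \<times> complex \<Rightarrow> (real \<Rightarrow> complex \<times> complex) set \<Rightarrow>
   (real \<times> real \<Rightarrow> complex \<times> complex) set \<Rightarrow> (int \<times> int) rel \<Rightarrow>
   (complex \<times> complex) set set \<Rightarrow> bool" where
  "fLOiation v E D R \<F> \<longleftrightarrow>
     (\<exists>s i \<rho> v0 F. enumeration s \<and> order_embedding R s i \<and> dynamical_realization i \<rho> \<and>
        cover v0 = v \<and> height_function E D v0 \<rho> F \<and> \<F> = leaves F)"

definition closed_leaf :: "(complex \<times> complex) set \<Rightarrow> bool" where
  "closed_leaf L \<longleftrightarrow> (\<exists>\<gamma>. simple_path \<gamma> \<and> pathfinish \<gamma> = pathstart \<gamma> \<and> path_image \<gamma> = L)"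

end

theory Submission
  imports Defs
begin

text \<open>
  The height function satisfies \<open>F (x + g) = \<rho> g (F x)\<close>, where \<open>\<rho>\<close> is an action of the group on the
  line by increasing homeomorphisms (\<open>rho_add\<close>, \<open>F_equivariant\<close>). Hence \<open>g\<close> preserves the level set
  of height \<open>c\<close> iff \<open>\<rho> g\<close> fixes \<open>c\<close>, and the question is whether some \<open>g \<noteq> 0\<close> has a fixed point on
  the line.

  If the order is Archimedean, there is none (\<open>archimedean_no_fixed_point\<close>). The covering map is then
  injective on level sets, and a closed leaf lifts to a Jordan curve \<open>J\<close> that is a whole component of
  a level set. Through every point of an edge passes an infinite chain of translates of this edge,
  along which \<open>F\<close> is strictly monotone. In the direction away from the height of \<open>J\<close> it cannot cross
  \<open>J\<close>, and it is unbounded, so no point of an edge lies inside \<open>J\<close>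
  (\<open>no_edge_point_inside_level_curve\<close>). Every other point is joined to an edge by a level segment,
  which must meet \<open>J\<close> if the point is inside. So \<open>F\<close> is constant inside \<open>J\<close>, and \<open>J\<close> is not a
  component after all.

  If the order is not Archimedean, the multiples of some \<open>a > 0\<close> are bounded. The supremum \<open>\<l>\<close> of
  their heights is fixed by \<open>\<rho> a\<close> and is not the height of a vertex (\<open>nonarchimedean_fixed_point\<close>).
  The level set of \<open>\<l>\<close> therefore meets a lifted triangle, if at all, in a chord between inner points
  of two sides (\<open>face_level_segment\<close>). By invariance of domain each lifted edge belongs to exactly two
  triangles (\<open>at_least_two_faces\<close>, \<open>at_most_two_faces\<close>), so the chords continue each other without
  end. The orbit of \<open>\<l>\<close> is locally finite (\<open>fixed_point_orbit_locally_finite\<close>), so in the torus only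
  finitely many arcs remain, and they form a graph in which every node has degree two. This graph
  contains an isolated cycle (\<open>two_regular_arcs_contain_cycle\<close>), which is a closed leaf.
\<close>

section \<open>Cycles in finite two-regular unions of arcs\<close>

text \<open>
  Consider a chain of arcs whose inner nodes have used up both of their arcs, with as many arcs as
  possible. The last node has a further arc. Its other end is not an inner node, since those are
  used up, and it is not new either, since the chain would become longer. So it is the first node and
  the chain closes up; now all its nodes are used up, so no other arc meets it.
\<close>

lemma two_regular_arcs_contain_cycle:
  fixes A :: "'a::t2_space set set"
  assumes fin: "finite A" and ne: "A \<noteq> {}"
    and arcs: "\<And>a. a \<in> A \<Longrightarrow> \<exists>g. arc g \<and> path_image g = a \<and> a \<inter> Q = {pathstart g, pathfinish g}"
    and disj: "\<And>a b. a \<in> A \<Longrightarrow> b \<in> A \<Longrightarrow> a \<noteq> b \<Longrightarrow> a \<inter> b \<subseteq> Q"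
    and deg: "\<And>q. q \<in> Q \<Longrightarrow> card {a \<in> A. q \<in> a} = 2"
  obtains B g where "B \<subseteq> A" "simple_path g" "pathfinish g = pathstart g" "path_image g = \<Union>B"
    "\<And>a. a \<in> A - B \<Longrightarrow> a \<inter> \<Union>B = {}"
proof -
  define inc where "inc S q = {a \<in> S. q \<in> a}" for S :: "'a set set" and q
  define chain where "chain S g \<longleftrightarrow> S \<subseteq> A \<and> arc g \<and> path_image g = \<Union>S \<and>
      pathstart g \<in> Q \<and> pathfinish g \<in> Q \<and>
      (\<forall>q \<in> Q \<inter> \<Union>S - {pathstart g, pathfinish g}. inc A q \<subseteq> S) \<and>
      card (inc S (pathstart g)) = 1 \<and> card (inc S (pathfinish g)) = 1" for S g
  have finS: "finite S" if "S \<subseteq> A" for S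
    using that fin finite_subset by blast
  have deg': "card (inc A q) = 2" if "q \<in> Q" for q
    using deg[OF that] by (simp add: inc_def)
  have saturated: "inc A q \<subseteq> insert b S"
    if "S \<subseteq> A" "b \<in> A" "b \<notin> S" "q \<in> b" "q \<in> Q" "card (inc S q) = 1" for S b q
  proof -
    have f: "finite (inc A q)" using fin by (simp add: inc_def)
    have "insert b (inc S q) \<subseteq> inc A q" using that by (auto simp: inc_def)
    moreover have "card (insert b (inc S q)) = 2"
      using that finS[of S] by (simp add: inc_def)
    ultimately have "insert b (inc S q) = inc A q"
      using f deg'[OF \<open>q \<in> Q\<close>] by (metis card_subset_eq)
    then show ?thesis by (auto simp: inc_def)
  qed
  have "\<exists>S g. chain S g"
  proof -
    obtain a where a: "a \<in> A" using ne by blast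
    obtain g where g: "arc g" "path_image g = a" "a \<inter> Q = {pathstart g, pathfinish g}"
      using arcs[OF a] by blast
    have "inc {a} (pathstart g) = {a}" "inc {a} (pathfinish g) = {a}"
      using g by (auto simp: inc_def)
    then have "chain {a} g"
      unfolding chain_def using a g by auto
    then show ?thesis by blast
  qed
  then obtain S0 where S0: "S0 \<in> {S. \<exists>g. chain S g}" by blast
  have "finite {S. \<exists>g. chain S g}"
    by (rule finite_subset[of _ "Pow A"]) (auto simp: chain_def fin)
  note fin_chains = this
  obtain S where "S \<in> {S. \<exists>g. chain S g}"
    and "card S = Max (card ` {S. \<exists>g. chain S g})"
    using obtains_MAX[OF fin_chains, of card] S0 by (metis empty_iff)
  then have max: "card S' \<le> card S" if "S' \<in> {S. \<exists>g. chain S g}" for S'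
    using that fin_chains by simp
  have "\<exists>g. chain S g" using \<open>S \<in> _\<close> by simp
  then obtain g where "chain S g" by blast
  then have SA: "S \<subseteq> A" and g: "arc g" "path_image g = \<Union>S" "pathstart g \<in> Q" "pathfinish g \<in> Q"
    and sat: "\<And>q. q \<in> Q \<Longrightarrow> q \<in> \<Union>S \<Longrightarrow> q \<noteq> pathstart g \<Longrightarrow> q \<noteq> pathfinish g \<Longrightarrow> inc A q \<subseteq> S"
    and one: "card (inc S (pathstart g)) = 1" "card (inc S (pathfinish g)) = 1"
    unfolding chain_def by auto
  have "\<not> inc A (pathfinish g) \<subseteq> S"
  proof
    assume "inc A (pathfinish g) \<subseteq> S"
    then have "inc A (pathfinish g) = inc S (pathfinish g)"
      using SA by (auto simp: inc_def)
    then show False using deg'[OF g(4)] one(2) by simp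
  qed
  then obtain b where b: "b \<in> A" "b \<notin> S" "pathfinish g \<in> b" by (auto simp: inc_def)
  obtain h0 where h0: "arc h0" "path_image h0 = b" "b \<inter> Q = {pathstart h0, pathfinish h0}"
    using arcs[OF b(1)] by blast
  obtain h where h: "arc h" "path_image h = b" "b \<inter> Q = {pathstart h, pathfinish h}"
      "pathstart h = pathfinish g"
  proof (cases "pathstart h0 = pathfinish g")
    case True
    then show ?thesis using that h0 by blast
  next
    case False
    then have "pathfinish h0 = pathfinish g" using h0(3) b(3) g(4) by (metis Int_iff insertE singletonD)
    then show ?thesis using that[of "reversepath h0"] h0 by (auto simp: arc_reversepath)
  qed
  have h_ends: "pathstart h \<noteq> pathfinish h" using h(1) by (metis arc_distinct_ends)
  have meet: "b \<inter> \<Union>S \<subseteq> {pathstart h, pathfinish h}"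
    using disj b(1,2) SA h(3) by blast
  have hend: "pathfinish h \<in> b" "pathfinish h \<in> Q" using h by auto
  show thesis
  proof (cases "pathfinish h \<in> \<Union>S")
    case False
    have incS: "inc (insert b S) q = inc S q" if "q \<in> \<Union>S" "q \<noteq> pathfinish g" for q
      using that meet h(4) False by (auto simp: inc_def)
    have "chain (insert b S) (g +++ h)"
      unfolding chain_def
    proof (intro conjI ballI)
      show "insert b S \<subseteq> A" using SA b by simp
      show "arc (g +++ h)"
        using g h meet False by (intro arc_join) auto
      show "path_image (g +++ h) = \<Union>(insert b S)"
        using g h by (simp add: path_image_join Un_commute)
      show "pathstart (g +++ h) \<in> Q" "pathfinish (g +++ h) \<in> Q"
        using g hend by auto
      have st: "pathstart g \<noteq> pathfinish g" using g(1) by (metis arc_distinct_ends)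
      have stS: "pathstart g \<in> \<Union>S" using g(2) by auto
      show "card (inc (insert b S) (pathstart (g +++ h))) = 1"
        using incS[OF stS st] one by simp
      have "inc (insert b S) (pathfinish h) = {b}"
        using False hend by (auto simp: inc_def)
      then show "card (inc (insert b S) (pathfinish (g +++ h))) = 1" by simp
      fix q assume q: "q \<in> Q \<inter> \<Union>(insert b S) - {pathstart (g +++ h), pathfinish (g +++ h)}"
      show "inc A q \<subseteq> insert b S"
      proof (cases "q = pathfinish g")
        case True
        then show ?thesis using saturated[OF SA b(1,2)] b(3) g(4) one by simp
      next
        case neq: False
        then have "q \<in> \<Union>S" using q h by auto
        then show ?thesis using sat[of q] q neq by auto
      qed
    qed
    then have "card (insert b S) \<le> card S" using max by blast
    then show thesis using b finS[OF SA] by simp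
  next
    case True
    have "pathfinish h = pathstart g"
    proof (rule ccontr)
      assume "pathfinish h \<noteq> pathstart g"
      then have "inc A (pathfinish h) \<subseteq> S"
        using sat[OF hend(2) True] h_ends h(4) by auto
      then show False using b hend by (auto simp: inc_def)
    qed
    note cl = this
    have all_sat: "inc A q \<subseteq> insert b S" if "q \<in> Q" "q \<in> \<Union>(insert b S)" for q
    proof (cases "q = pathstart g \<or> q = pathfinish g")
      case True
      then have "q \<in> b" using h cl by auto
      moreover have "card (inc S q) = 1" using True one by auto
      ultimately show ?thesis using saturated[OF SA b(1,2)] that by auto
    next
      case neq: False
      then have "q \<in> \<Union>S" using that h cl by auto
      then show ?thesis using sat[of q] neq that by auto
    qed
    show thesis
    proof (rule that[of "insert b S" "g +++ h"])
      show "insert b S \<subseteq> A" using SA b by simp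
      show "simple_path (g +++ h)"
        using g h meet cl by (intro simple_path_join_loop) auto
      show "pathfinish (g +++ h) = pathstart (g +++ h)" using cl by simp
      show "path_image (g +++ h) = \<Union>(insert b S)"
        using g h by (simp add: path_image_join Un_commute)
      fix a assume a: "a \<in> A - insert b S"
      show "a \<inter> \<Union>(insert b S) = {}"
      proof (rule ccontr)
        assume "a \<inter> \<Union>(insert b S) \<noteq> {}"
        then obtain x c where x: "x \<in> a" "c \<in> insert b S" "x \<in> c" by blast
        then have "x \<in> Q" using disj[of a c] a SA b by blast
        then have "inc A x \<subseteq> insert b S" using all_sat x by blast
        then show False using a x by (auto simp: inc_def)
      qed
    qed
  qed
qed

section \<open>The standard triangle\<close>

lemma std_triangle_eq: "std_triangle = {z. 0 \<le> fst z \<and> 0 \<le> snd z \<and> fst z + snd z \<le> 1}"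
proof -
  have "z \<in> std_triangle \<longleftrightarrow> 0 \<le> fst z \<and> 0 \<le> snd z \<and> fst z + snd z \<le> 1" for z
  proof
    assume "z \<in> std_triangle"
    then show "0 \<le> fst z \<and> 0 \<le> snd z \<and> fst z + snd z \<le> 1"
      unfolding std_triangle_def corners_def convex_hull_3 by auto
  next
    assume *: "0 \<le> fst z \<and> 0 \<le> snd z \<and> fst z + snd z \<le> 1"
    have "\<exists>u v w. 0 \<le> u \<and> 0 \<le> v \<and> 0 \<le> w \<and> u + v + w = 1 \<and>
        z = u *\<^sub>R (0,0) + v *\<^sub>R (1,0) + w *\<^sub>R (0,1)"
      using * by (intro exI[of _ "1 - fst z - snd z"] exI[of _ "fst z"] exI[of _ "snd z"])
        (auto simp: prod_eq_iff)
    then show "z \<in> std_triangle"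
      unfolding std_triangle_def corners_def convex_hull_3 by blast
  qed
  then show ?thesis by blast
qed

lemma std_triangle_compact: "compact std_triangle"
  and std_triangle_convex: "convex std_triangle"
  by (simp_all add: std_triangle_def corners_def finite_imp_compact_convex_hull)

lemma std_triangle_closed: "closed std_triangle"
  by (simp add: std_triangle_compact compact_imp_closed)

lemma interior_std_triangle_eq:
  "interior std_triangle = {z. 0 < fst z \<and> 0 < snd z \<and> fst z + snd z < 1}"
proof -
  have *: "std_triangle = {z. (1,0) \<bullet> z \<ge> 0} \<inter> {z. (0,1) \<bullet> z \<ge> 0} \<inter> {z. (1,1) \<bullet> z \<le> 1}"
    by (auto simp: std_triangle_eq)
  have ne: "((1::real),(0::real)) \<noteq> 0" "((0::real),(1::real)) \<noteq> 0" "((1::real),(1::real)) \<noteq> 0"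
    by (auto simp: zero_prod_def)
  show ?thesis
    unfolding * interior_Int interior_halfspace_ge[OF ne(1)] interior_halfspace_ge[OF ne(2)]
      interior_halfspace_le[OF ne(3)] by auto
qed

lemma frontier_std_triangle_eq:
  "frontier std_triangle = {z \<in> std_triangle. fst z = 0 \<or> snd z = 0 \<or> fst z + snd z = 1}"
  unfolding frontier_def interior_std_triangle_eq
  unfolding closure_closed[OF std_triangle_closed] unfolding std_triangle_eq by auto

lemma frontier_subset_std: "frontier std_triangle \<subseteq> std_triangle"
  by (auto simp: frontier_std_triangle_eq)

lemma std_triangle_split: "std_triangle = interior std_triangle \<union> frontier std_triangle"
  by (auto simp: interior_std_triangle_eq frontier_std_triangle_eq) (auto simp: std_triangle_eq)

lemma side_subset:
  assumes "a \<in> corners" "b \<in> corners" "t \<in> {0..1}"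
  shows "linepath a b t \<in> std_triangle"
  using assms by (auto simp: std_triangle_eq corners_def linepath_def)

lemma frontier_side:
  assumes "z \<in> frontier std_triangle"
  obtains a b t where "a \<in> corners" "b \<in> corners" "a \<noteq> b" "t \<in> {0..1}" "z = linepath a b t"
proof -
  obtain x y where z: "z = (x,y)" by force
  have *: "0 \<le> x" "0 \<le> y" "x + y \<le> 1" "x = 0 \<or> y = 0 \<or> x + y = 1"
    using assms unfolding frontier_std_triangle_eq unfolding std_triangle_eq z by auto
  from *(4) show thesis
  proof (elim disjE)
    assume "x = 0"
    with * show thesis
      by (intro that[of "(0,0)" "(0,1)" y]) (auto simp: corners_def z linepath_def)
  next
    assume "y = 0"
    with * show thesis
      by (intro that[of "(0,0)" "(1,0)" x]) (auto simp: corners_def z linepath_def)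
  next
    assume "x + y = 1"
    with * show thesis
      by (intro that[of "(1,0)" "(0,1)" y]) (auto simp: corners_def z linepath_def)
  qed
qed

lemma side_in_frontier:
  assumes "a \<in> corners" "b \<in> corners" "a \<noteq> b" "t \<in> {0..1}"
  shows "linepath a b t \<in> frontier std_triangle"
  using assms unfolding frontier_std_triangle_eq unfolding std_triangle_eq
  by (auto simp: corners_def linepath_def)

section \<open>The order and its action on the line\<close>

(* group elements are handled as such, not as pairs of coordinates *)
declare split_paired_All [simp del] split_paired_Ex [simp del]

definition scale :: "int \<Rightarrow> int \<times> int \<Rightarrow> int \<times> int" where
  "scale k g = (k * fst g, k * snd g)"

lemma scale_simps [simp]: "scale 0 g = 0" "scale 1 g = g" "scale k 0 = 0"
  by (auto simp: scale_def zero_prod_def prod_eq_iff)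

lemma scale_add: "scale (k + l) g = scale k g + scale l g"
  by (auto simp: scale_def distrib_right)

lemma scale_minus: "scale (- k) g = - scale k g"
  by (auto simp: scale_def)

lemma scale_scale: "scale k (scale l g) = scale (k * l) g"
  by (auto simp: scale_def)

lemma sum_const_eq_scale: "(\<Sum>j<n. a) = scale (int n) a"
  by (induction n) (auto simp: scale_add[symmetric] scale_def prod_eq_iff algebra_simps)

locale order_realization =
  fixes R :: "(int \<times> int) rel" and s :: "nat \<Rightarrow> int \<times> int" and i :: "int \<times> int \<Rightarrow> real"
    and \<rho> :: "int \<times> int \<Rightarrow> real \<Rightarrow> real"
  assumes left_order: "left_order R"
    and enum: "enumeration s"
    and emb: "order_embedding R s i"
    and dyn: "dynamical_realization i \<rho>"
begin

abbreviation lt (infix "\<lhd>" 50) where "a \<lhd> b \<equiv> less_in R a b"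

lemma lt_trans: "a \<lhd> b \<Longrightarrow> b \<lhd> c \<Longrightarrow> a \<lhd> c"
  using left_order unfolding left_order_def less_in_def linear_order_on_def partial_order_on_def
    preorder_on_def trans_def antisym_def by blast

lemma lt_irrefl: "\<not> a \<lhd> a" by (simp add: less_in_def)

lemma lt_total: "a \<noteq> b \<Longrightarrow> a \<lhd> b \<or> b \<lhd> a"
  using left_order unfolding left_order_def less_in_def linear_order_on_def total_on_def by blast

lemma le_iff: "(a, b) \<in> R \<longleftrightarrow> a = b \<or> a \<lhd> b"
  using left_order unfolding left_order_def less_in_def linear_order_on_def partial_order_on_def
    preorder_on_def refl_on_def by blast

lemma lt_add: "a \<lhd> b \<Longrightarrow> g + a \<lhd> g + b"
  using left_order unfolding left_order_def less_in_def by (metis add_left_cancel)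

lemma s_surj: "\<exists>n. g = s n"
  using enum unfolding enumeration_def by (metis bij_pointE)

lemma s_inj: "s p = s q \<longleftrightarrow> p = q"
  using enum unfolding enumeration_def by (metis bij_def injD)

lemma s_0: "s 0 = 0"
  using enum by (simp add: enumeration_def)

lemma i_zero [simp]: "i 0 = 0"
  using emb enum unfolding order_embedding_def enumeration_def by auto

lemma i_new_top: "n > 0 \<Longrightarrow> (\<And>p. p < n \<Longrightarrow> s p \<lhd> s n) \<Longrightarrow> i (s n) = Max ((\<lambda>p. i (s p)) ` {..<n}) + 1"
  using emb unfolding order_embedding_def by blast

lemma i_new_bottom: "n > 0 \<Longrightarrow> (\<And>p. p < n \<Longrightarrow> s n \<lhd> s p) \<Longrightarrow> i (s n) = Min ((\<lambda>p. i (s p)) ` {..<n}) - 1"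
  using emb unfolding order_embedding_def by blast

lemma i_new_between:
  assumes "a < n" "b < n" "s a \<lhd> s n" "\<And>p. p < n \<Longrightarrow> s p \<lhd> s n \<Longrightarrow> (s p, s a) \<in> R"
    "s n \<lhd> s b" "\<And>p. p < n \<Longrightarrow> s n \<lhd> s p \<Longrightarrow> (s b, s p) \<in> R"
  shows "i (s n) = (i (s a) + i (s b)) / 2"
proof -
  have "n > 0" using assms(1) by simp
  then show ?thesis using emb assms unfolding order_embedding_def by blast
qed

text \<open>
  Induction along the enumeration: a new element gets a value above all earlier ones, below all of
  them, or halfway between those of its two closest earlier neighbours.
\<close>

lemma i_strict_on_initial: "\<forall>p<n. \<forall>q<n. s p \<lhd> s q \<longrightarrow> i (s p) < i (s q)"
proof (induction n)
  case 0
  then show ?case by simp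
next
  case (Suc n)
  have IH: "i (s p) < i (s q)" if "p < n" "q < n" "s p \<lhd> s q" for p q
    using Suc that by blast
  have IH': "(s p, s q) \<in> R" if "p < n" "q < n" "i (s p) \<le> i (s q)" for p q
  proof -
    have "\<not> s q \<lhd> s p" using IH[of q p] that by auto
    then show ?thesis using lt_total[of "s p" "s q"] unfolding le_iff by blast
  qed
  have new: "(s p \<lhd> s n \<longrightarrow> i (s p) < i (s n)) \<and> (s n \<lhd> s p \<longrightarrow> i (s n) < i (s p))" if p: "p < n" for p
  proof -
    have n: "n > 0" using p by simp
    define L where "L = {p. p < n \<and> s p \<lhd> s n}"
    define U where "U = {p. p < n \<and> s n \<lhd> s p}"
    have fin: "finite L" "finite U" by (auto simp: L_def U_def)
    have LU: "q \<in> L \<or> q \<in> U" if "q < n" for q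
      using lt_total[of "s q" "s n"] that s_inj by (auto simp: L_def U_def)
    have asym: "\<not> (s q \<lhd> s n \<and> s n \<lhd> s q)" for q
      using lt_trans lt_irrefl by blast
    consider "U = {}" | "L = {}" | "L \<noteq> {}" "U \<noteq> {}" by blast
    then show ?thesis
    proof cases
      case 1
      then have all: "s q \<lhd> s n" if "q < n" for q using LU that by (auto simp: L_def)
      have "i (s p) \<le> Max ((\<lambda>p. i (s p)) ` {..<n})" using p by simp
      moreover have "i (s n) = Max ((\<lambda>p. i (s p)) ` {..<n}) + 1" using i_new_top[OF n] all by blast
      ultimately have "i (s p) < i (s n)" by linarith
      then show ?thesis using all[OF p] asym by blast
    next
      case 2
      then have all: "s n \<lhd> s q" if "q < n" for q using LU that by (auto simp: U_def)
      have "i (s p) \<ge> Min ((\<lambda>p. i (s p)) ` {..<n})" using p by simp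
      moreover have "i (s n) = Min ((\<lambda>p. i (s p)) ` {..<n}) - 1" using i_new_bottom[OF n] all by blast
      ultimately have "i (s n) < i (s p)" by linarith
      then show ?thesis using all[OF p] asym by blast
    next
      case 3
      obtain a where a: "a \<in> L" "i (s a) = Max ((\<lambda>p. i (s p)) ` L)"
        by (rule obtains_MAX[OF fin(1) 3(1), of "\<lambda>p. i (s p)"]) simp
      obtain b where b: "b \<in> U" "i (s b) = Min ((\<lambda>p. i (s p)) ` U)"
        by (rule obtains_MIN[OF fin(2) 3(2), of "\<lambda>p. i (s p)"]) simp
      have amax: "i (s q) \<le> i (s a)" if "q \<in> L" for q using that a fin by simp
      have bmin: "i (s b) \<le> i (s q)" if "q \<in> U" for q using that b fin by simp
      have mid: "i (s n) = (i (s a) + i (s b)) / 2"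
      proof (rule i_new_between)
        show "a < n" "b < n" "s a \<lhd> s n" "s n \<lhd> s b" using a b by (auto simp: L_def U_def)
        show "(s q, s a) \<in> R" if "q < n" "s q \<lhd> s n" for q
          using IH'[of q a] amax[of q] that a by (auto simp: L_def)
        show "(s b, s q) \<in> R" if "q < n" "s n \<lhd> s q" for q
          using IH'[of b q] bmin[of q] that b by (auto simp: U_def)
      qed
      have ab: "i (s a) < i (s b)"
      proof -
        have "a < n" "b < n" "s a \<lhd> s n" "s n \<lhd> s b" using a b by (auto simp: L_def U_def)
        then show ?thesis using IH[of a b] lt_trans by blast
      qed
      show ?thesis
        using amax[of p] bmin[of p] p mid ab by (auto simp: L_def U_def)
    qed
  qed
  show ?case
  proof (intro allI impI)
    fix p q assume "p < Suc n" "q < Suc n" "s p \<lhd> s q"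
    moreover from this have "\<not> (p = n \<and> q = n)" using lt_irrefl by blast
    ultimately consider "p < n" "q < n" | "p < n" "q = n" | "p = n" "q < n" by linarith
    then show "i (s p) < i (s q)"
      using IH new \<open>s p \<lhd> s q\<close> by cases blast+
  qed
qed

lemma i_less_iff: "i g < i h \<longleftrightarrow> g \<lhd> h"
proof -
  have imp: "i g < i h" if lt: "g \<lhd> h" for g h
  proof -
    obtain p q where pq: "g = s p" "h = s q" using s_surj by metis
    have "p < Suc (max p q)" "q < Suc (max p q)" by auto
    then show ?thesis
      using i_strict_on_initial[of "Suc (max p q)"] lt unfolding pq by blast
  qed
  show ?thesis
    using imp[of g h] imp[of h g] lt_total[of g h] by fastforce
qed

lemma i_inj: "i g = i h \<longleftrightarrow> g = h"
proof
  assume e: "i g = i h"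
  show "g = h"
  proof (rule ccontr)
    assume "g \<noteq> h"
    then have "i g < i h \<or> i h < i g" using lt_total unfolding i_less_iff by blast
    then show False using e by linarith
  qed
qed simp

lemma i_add_less: "i (k + g) < i (k + h) \<longleftrightarrow> i g < i h"
  using lt_add[of g h k] lt_add[of "k + g" "k + h" "- k"] unfolding i_less_iff by (metis add.left_inverse add.assoc add_0)

lemma i_add_le: "i (k + g) \<le> i (k + h) \<longleftrightarrow> i g \<le> i h"
  using i_add_less[of k h g] by linarith

lemma i_minus_less: "i (- g) < i (- h) \<longleftrightarrow> i h < i g"
  using i_add_less[of "g + h" "- g" "- h"] by simp

lemma exists_pos: "\<exists>d. 0 < i d"
proof -
  have "((1::int), (0::int)) \<noteq> 0" by (auto simp: zero_prod_def)
  then have "i (1,0) \<noteq> i 0" using i_inj by blast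
  moreover have "i (- (1,0)) < i (-0) \<longleftrightarrow> i 0 < i (1,0)" by (rule i_minus_less)
  moreover have "i (- (1,0)) \<noteq> i 0" using \<open>(1,0) \<noteq> 0\<close> i_inj by (metis neg_equal_0_iff_equal)
  ultimately show ?thesis by (metis i_zero linorder_neqE minus_zero)
qed

text \<open>
  There is no greatest element, so again and again an element of the enumeration exceeds all earlier
  ones, and then the largest value grows by one.
\<close>

lemma i_unbounded_above: "\<exists>h. M < i h"
proof -
  obtain d where d: "0 < i d" using exists_pos by blast
  have "\<exists>n. real k \<le> i (s n)" for k
  proof (induction k)
    case 0
    show ?case using s_0 by (intro exI[of _ 0]) simp
  next
    case (Suc k)
    then obtain n where n: "real k \<le> i (s n)" by blast
    obtain m where m: "m \<in> {..n}" "i (s m) = Max ((\<lambda>p. i (s p)) ` {..n})"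
      by (rule obtains_MAX[of "{..n}" "\<lambda>p. i (s p)"]) auto
    have mmax: "i (s p) \<le> i (s m)" if "p \<le> n" for p using that m by simp
    have "i (s m + 0) < i (s m + d)" unfolding i_add_less using d by simp
    then have "\<exists>N. i (s m) < i (s N)" using s_surj[of "s m + d"] by auto
    then obtain N where N: "i (s m) < i (s N)" and least: "\<And>p. p < N \<Longrightarrow> \<not> i (s m) < i (s p)"
      using exists_least_iff[of "\<lambda>N. i (s m) < i (s N)"] by blast
    have Nn: "n < N" using mmax[of N] N by (meson not_less)
    have "i (s N) = Max ((\<lambda>p. i (s p)) ` {..<N}) + 1"
    proof (rule i_new_top)
      show "N > 0" using Nn by simp
      show "s p \<lhd> s N" if "p < N" for p
        using least[OF that] N by (simp add: i_less_iff[symmetric])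
    qed
    moreover have "i (s n) \<le> Max ((\<lambda>p. i (s p)) ` {..<N})" using Nn by simp
    ultimately have "real (Suc k) \<le> i (s N)" using n by simp
    then show ?case by blast
  qed
  then show ?thesis
    by (metis reals_Archimedean2 order_less_le_trans)
qed

lemma i_unbounded_below: "\<exists>h. i h < M"
proof -
  obtain d where d: "0 < i d" using exists_pos by blast
  have "\<exists>n. i (s n) \<le> - real k" for k
  proof (induction k)
    case 0
    show ?case using s_0 by (intro exI[of _ 0]) simp
  next
    case (Suc k)
    then obtain n where n: "i (s n) \<le> - real k" by blast
    obtain m where m: "m \<in> {..n}" "i (s m) = Min ((\<lambda>p. i (s p)) ` {..n})"
      by (rule obtains_MIN[of "{..n}" "\<lambda>p. i (s p)"]) auto
    have mmin: "i (s m) \<le> i (s p)" if "p \<le> n" for p using that m by simp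
    have "i (s m + - d) < i (s m + - 0)" unfolding i_add_less i_minus_less using d by simp
    then have "\<exists>N. i (s N) < i (s m)" using s_surj[of "s m + - d"] by auto
    then obtain N where N: "i (s N) < i (s m)" and least: "\<And>p. p < N \<Longrightarrow> \<not> i (s p) < i (s m)"
      using exists_least_iff[of "\<lambda>N. i (s N) < i (s m)"] by blast
    have Nn: "n < N" using mmin[of N] N by (meson not_less)
    have "i (s N) = Min ((\<lambda>p. i (s p)) ` {..<N}) - 1"
    proof (rule i_new_bottom)
      show "N > 0" using Nn by simp
      show "s N \<lhd> s p" if "p < N" for p
        using least[OF that] N by (simp add: i_less_iff[symmetric])
    qed
    moreover have "i (s n) \<ge> Min ((\<lambda>p. i (s p)) ` {..<N})" using Nn by simp
    ultimately have "i (s N) \<le> - real (Suc k)" using n by simp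
    then show ?case by blast
  qed
  then show ?thesis
    by (metis reals_Archimedean2 order_le_less_trans minus_less_iff)
qed

lemma rho_less_iff [simp]: "\<rho> g x < \<rho> g y \<longleftrightarrow> x < y"
  using dyn unfolding dynamical_realization_def by (metis strict_mono_less)

lemma rho_le_iff [simp]: "\<rho> g x \<le> \<rho> g y \<longleftrightarrow> x \<le> y"
  using rho_less_iff[of g y x] by linarith

lemma rho_eq_iff [simp]: "\<rho> g x = \<rho> g y \<longleftrightarrow> x = y"
proof (cases x y rule: linorder_cases)
  case less
  then show ?thesis using rho_less_iff[of g x y] by linarith
next
  case greater
  then show ?thesis using rho_less_iff[of g y x] by linarith
qed simp

lemma rho_continuous: "continuous_on A (\<rho> g)"
  using dyn unfolding dynamical_realization_def homeomorphism_def
  by (meson continuous_on_subset subset_UNIV)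

lemma rho_i [simp]: "\<rho> g (i h) = i (g + h)"
  using dyn unfolding dynamical_realization_def by blast

lemma rho_0 [simp]: "\<rho> g 0 = i g"
  using rho_i[of g 0] by simp

text \<open>
  Continuity extends the affine formula from the open gap to its ends.
\<close>

lemma rho_affine_on_gap:
  assumes "l < u" "{l<..<u} \<inter> range i = {}"
  shows "\<exists>m c. \<forall>y\<in>{l..u}. \<rho> g y = m * y + c"
proof -
  let ?K = "closure (range i)"
  have gap: "{l<..<u} \<subseteq> - ?K"
    using assms(2) open_Int_closure_eq_empty[of "{l<..<u}" "range i"] by auto
  have x: "(l + u) / 2 \<in> {l<..<u}" using assms(1) by (auto simp: field_simps)
  let ?I = "connected_component_set (- ?K) ((l + u) / 2)"
  have "?I \<in> components (- ?K)" using gap x by (intro componentsI) blast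
  moreover have "{l<..<u} \<subseteq> ?I"
    by (rule connected_component_maximal[OF x _ gap]) (rule convex_connected, simp)
  ultimately obtain m c where mc: "\<And>y. y \<in> {l<..<u} \<Longrightarrow> \<rho> g y = m * y + c"
    using dyn unfolding dynamical_realization_def by (meson subsetD)
  have "closed {y. \<rho> g y = m * y + c}"
    by (intro closed_Collect_eq rho_continuous continuous_intros)
  then have "closure {l<..<u} \<subseteq> {y. \<rho> g y = m * y + c}"
    using mc by (intro closure_minimal) auto
  moreover have "closure {l<..<u} = {l..u}" using assms(1) by simp
  ultimately show ?thesis by auto
qed

text \<open>
  Both sides agree on \<open>range i\<close>, hence on its closure. Any other point lies in a gap of the closure,
  bounded on both sides because \<open>range i\<close> is unbounded in both directions. Both sides are affine on
  this gap, as \<open>\<rho> h\<close> maps gaps to gaps, and they agree at its two ends.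
\<close>

lemma rho_add: "\<rho> g (\<rho> h x) = \<rho> (g + h) x"
proof -
  let ?K = "closure (range i)"
  have on_K: "\<rho> g (\<rho> h x) = \<rho> (g + h) x" if "x \<in> ?K" for x
  proof -
    have "closed {x. \<rho> g (\<rho> h x) = \<rho> (g + h) x}"
      by (intro closed_Collect_eq rho_continuous continuous_on_compose2[OF rho_continuous[of UNIV] rho_continuous]) simp
    then have "?K \<subseteq> {x. \<rho> g (\<rho> h x) = \<rho> (g + h) x}"
      by (intro closure_minimal) (auto simp: add.assoc)
    then show ?thesis using that by blast
  qed
  show ?thesis
  proof (cases "x \<in> ?K")
    case True
    then show ?thesis by (rule on_K)
  next
    case False
    define A where "A = ?K \<inter> {..x}"
    define B where "B = ?K \<inter> {x..}"
    have ne: "A \<noteq> {}" "B \<noteq> {}"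
    proof -
      obtain h h' where "i h < x" "x < i h'" using i_unbounded_below i_unbounded_above by blast
      then have "i h \<in> A" "i h' \<in> B"
        using closure_subset[of "range i"] unfolding A_def B_def by auto
      then show "A \<noteq> {}" "B \<noteq> {}" by auto
    qed
    have cl: "closed A" "closed B" by (auto simp: A_def B_def)
    have bd: "bdd_above A" "bdd_below B" by (auto simp: A_def B_def)
    define l u where "l = Sup A" and "u = Inf B"
    have lA: "l \<in> A" unfolding l_def using closed_contains_Sup[OF ne(1) bd(1) cl(1)] .
    have uB: "u \<in> B" unfolding u_def using closed_contains_Inf[OF ne(2) bd(2) cl(2)] .
    have lu: "l < x" "x < u" using lA uB False by (auto simp: A_def B_def less_le)
    have gap: "{l<..<u} \<inter> range i = {}"
    proof (rule ccontr)
      assume "\<not> ?thesis"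
      then obtain y where "y \<in> {l<..<u}" "y \<in> range i" by blast
      then have y: "l < y" "y < u" "y \<in> range i" by auto
      from y(3) have yK: "y \<in> ?K" by (rule subsetD[OF closure_subset])
      show False
      proof (cases "y \<le> x")
        case True
        then have "y \<le> l" unfolding l_def using yK bd by (intro cSup_upper) (auto simp: A_def)
        then show False using y by simp
      next
        case False
        then have "u \<le> y" unfolding u_def using yK bd by (intro cInf_lower) (auto simp: B_def)
        then show False using y by simp
      qed
    qed
    have gap': "{\<rho> h l<..<\<rho> h u} \<inter> range i = {}"
    proof (rule ccontr)
      assume "\<not> ?thesis"
      then obtain k where k: "\<rho> h l < i k" "i k < \<rho> h u" by auto
      have "i k = \<rho> h (i (k - h))" by simp
      then have "i (k - h) \<in> {l<..<u}" using k by (metis greaterThanLessThan_iff rho_less_iff)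
      then show False using gap by blast
    qed
    have lu': "l < u" "\<rho> h l < \<rho> h u" using lu by auto
    obtain m1 c1 where 1: "\<And>y. y \<in> {l..u} \<Longrightarrow> \<rho> h y = m1 * y + c1"
      using rho_affine_on_gap[OF lu'(1) gap] by blast
    obtain m2 c2 where 2: "\<And>y. y \<in> {\<rho> h l..\<rho> h u} \<Longrightarrow> \<rho> g y = m2 * y + c2"
      using rho_affine_on_gap[OF lu'(2) gap'] by blast
    obtain m3 c3 where 3: "\<And>y. y \<in> {l..u} \<Longrightarrow> \<rho> (g + h) y = m3 * y + c3"
      using rho_affine_on_gap[OF lu'(1) gap] by blast
    have comp: "\<rho> g (\<rho> h y) = (m2 * m1) * y + (m2 * c1 + c2)" if "y \<in> {l..u}" for y
    proof -
      have "\<rho> h y \<in> {\<rho> h l..\<rho> h u}" using that by simp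
      then have "\<rho> g (\<rho> h y) = m2 * \<rho> h y + c2" by (rule 2)
      then show ?thesis unfolding 1[OF that] by (simp add: algebra_simps)
    qed
    have mem: "l \<in> {l..u}" "u \<in> {l..u}" "x \<in> {l..u}" using lu by auto
    have "\<rho> g (\<rho> h l) = \<rho> (g + h) l" "\<rho> g (\<rho> h u) = \<rho> (g + h) u"
      using on_K lA uB by (auto simp: A_def B_def)
    then have e: "(m2 * m1) * l + (m2 * c1 + c2) = m3 * l + c3" "(m2 * m1) * u + (m2 * c1 + c2) = m3 * u + c3"
      unfolding comp[OF mem(1)] comp[OF mem(2)] 3[OF mem(1)] 3[OF mem(2)] .
    then have "(m2 * m1 - m3) * (u - l) = 0" by (simp add: algebra_simps)
    then have "m2 * m1 = m3" using lu' by simp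
    moreover from this e have "m2 * c1 + c2 = c3" by simp
    ultimately show ?thesis unfolding comp[OF mem(3)] 3[OF mem(3)] by simp
  qed
qed

lemma rho_id [simp]: "\<rho> 0 x = x"
  using rho_add[of 0 0 x] by simp

lemma rho_minus [simp]: "\<rho> (- g) (\<rho> g x) = x" "\<rho> g (\<rho> (- g) x) = x"
  by (simp_all add: rho_add)

lemma rho_scale_fixed: "\<rho> g x = x \<Longrightarrow> \<rho> (scale k g) x = x"
proof (induction k rule: int_induct[where k = 0])
  case base
  then show ?case by simp
next
  case (step1 k)
  then show ?case by (simp add: scale_add rho_add[symmetric])
next
  case (step2 k)
  then have "\<rho> (- g) x = x" by (metis rho_minus(1))
  then show ?case
    using step2 scale_add[of "- 1" k g] rho_add[of "- g" "scale k g" x] by (simp add: scale_minus)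
qed

lemma rho_scale_less: "x < \<rho> g x \<Longrightarrow> n > 0 \<Longrightarrow> x < \<rho> (scale (int n) g) x"
proof (induction n)
  case (Suc n)
  show ?case
  proof (cases "n = 0")
    case False
    then have "x < \<rho> (scale (int n) g) x" using Suc by simp
    then have "\<rho> g x < \<rho> g (\<rho> (scale (int n) g) x)" by simp
    then show ?thesis using Suc.prems by (simp add: rho_add scale_add)
  qed (use Suc in simp)
qed simp

lemma rho_scale_greater:
  assumes "\<rho> g x < x" "n > 0" shows "\<rho> (scale (int n) g) x < x"
proof -
  have "x < \<rho> (- g) x" using assms(1) by (metis rho_less_iff rho_minus(1))
  then have "x < \<rho> (scale (int n) (- g)) x" using rho_scale_less assms(2) by blast
  moreover have "scale (int n) (- g) = - scale (int n) g" by (auto simp: scale_def)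
  ultimately show ?thesis by (metis rho_less_iff rho_minus(2))
qed

lemma archimedean_iff:
  "archimedean_order R \<longleftrightarrow> (\<forall>a b. 0 < i a \<and> 0 < i b \<longrightarrow> (\<exists>n::nat. i b < i (scale (int n) a)))"
  unfolding archimedean_order_def sum_const_eq_scale i_less_iff[symmetric] by simp

text \<open>
  Some power of \<open>\<rho> g\<close> moves a value of \<open>i\<close> below \<open>x\<close> to one above \<open>x\<close>, which a monotone map fixing
  \<open>x\<close> cannot do.
\<close>

lemma archimedean_no_fixed_point:
  assumes "archimedean_order R" "\<rho> g x = x"
  shows "g = 0"
proof (rule ccontr)
  assume "g \<noteq> 0"
  have *: False if g: "0 < i g" "\<rho> g x = x" for g
  proof -
    obtain h where h: "max x 0 < i h" using i_unbounded_above by blast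
    then obtain n :: nat where n: "i h < i (scale (int n) g)"
      using assms(1) g unfolding archimedean_iff by (metis max_less_iff_conj)
    obtain h' where h': "i h' < min x 0" using i_unbounded_below by blast
    then have "i (- 0) < i (- h')" unfolding i_minus_less by simp
    then have "0 < i (- h')" by simp
    then obtain n' :: nat where n': "i (- h') < i (scale (int n') g)"
      using assms(1) g unfolding archimedean_iff by blast
    then have "i (- (- scale (int n') g)) > i (- h')" by (simp add: scale_minus)
    then have "i (- scale (int n') g) < i h'" using i_minus_less by (metis minus_minus)
    then have "i (scale (- int n') g) < x" using h' by (simp add: scale_minus)
    then have "\<rho> (scale (int n + int n') g) (i (scale (- int n') g)) < \<rho> (scale (int n + int n') g) x"
      by (simp only: rho_less_iff)
    also have "\<dots> = x" using g by (rule_tac rho_scale_fixed)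
    also have "\<rho> (scale (int n + int n') g) (i (scale (- int n') g)) = i (scale (int n) g)"
      by (simp add: scale_add[symmetric])
    finally show False using n h by simp
  qed
  have "i g \<noteq> 0" using \<open>g \<noteq> 0\<close> i_inj[of g 0] by simp
  then consider "0 < i g" | "0 < i (- g)" using i_minus_less[of 0 g] i_minus_less[of g 0]
    by (metis i_zero linorder_neqE_linordered_idom minus_zero)
  then show False
  proof cases
    case 2
    have "\<rho> (- g) x = x" using assms(2) by (metis rho_minus(1))
    then show False using * 2 by blast
  qed (use * assms in blast)
qed


lemma scale_less:
  assumes "0 < i a" "k < l" shows "i (scale k a) < i (scale l a)"
proof -
  have "0 < \<rho> (scale (int (nat (l - k))) a) 0"
    using assms by (intro rho_scale_less) auto
  then have "i (scale k a + 0) < i (scale k a + scale (l - k) a)"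
    using assms unfolding i_add_less by simp
  then show ?thesis by (simp add: scale_add[symmetric])
qed

text \<open>
  Let \<open>b\<close> bound the multiples of \<open>a\<close>, and let \<open>\<l>\<close> be the supremum of their values under \<open>i\<close>. Since
  \<open>\<rho> a\<close> only shifts this sequence by one place, it fixes \<open>\<l>\<close>; but it moves every value of \<open>i\<close>.
  The last two conclusions say that \<open>\<l>\<close> is the supremum.
\<close>

lemma nonarchimedean_fixed_point:
  assumes "\<not> archimedean_order R"
  obtains a b \<l> where "0 < i a" "\<rho> a \<l> = \<l>" "\<l> \<notin> range i" "\<l> < i b" "\<And>k. i (scale k a) < \<l>"
    "\<And>c. (\<And>n::nat. i (scale (int n) a) \<le> c) \<Longrightarrow> \<l> \<le> c"
proof -
  obtain a b where a: "0 < i a" and b: "0 < i b" and ab: "\<And>n::nat. i (scale (int n) a) \<le> i b"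
    using assms unfolding archimedean_iff by (metis not_less)
  define S where "S = range (\<lambda>n::nat. i (scale (int n) a))"
  define \<l> where "\<l> = Sup S"
  have bdd: "bdd_above S" using ab by (auto simp: S_def bdd_above_def)
  have le_l: "i (scale (int n) a) \<le> \<l>" for n
    unfolding \<l>_def by (rule cSup_upper[OF _ bdd]) (simp add: S_def)
  have less_l: "i (scale k a) < \<l>" for k
  proof -
    have "i (scale k a) < i (scale (int (Suc (nat k))) a)" by (rule scale_less[OF a]) simp
    then show ?thesis using le_l[of "Suc (nat k)"] by linarith
  qed
  have l_le: "\<l> \<le> c" if "\<And>n. i (scale (int n) a) \<le> c" for c
    unfolding \<l>_def using that by (intro cSup_least) (auto simp: S_def)
  have shift: "\<rho> a (i (scale k a)) = i (scale (k + 1) a)" for k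
    by (simp add: scale_add add.commute)
  have "\<not> \<l> < \<rho> a \<l>"
  proof
    assume "\<l> < \<rho> a \<l>"
    then have "\<rho> (- a) \<l> < \<rho> (- a) (\<rho> a \<l>)" by (simp only: rho_less_iff)
    then have "\<not> \<l> \<le> \<rho> (- a) \<l>" by simp
    then obtain n where "\<rho> (- a) \<l> < i (scale (int n) a)" using l_le by (meson not_less)
    then have "\<rho> a (\<rho> (- a) \<l>) < \<rho> a (i (scale (int n) a))" by (simp only: rho_less_iff)
    then show False using less_l[of "int n + 1"] unfolding shift by simp
  qed
  moreover have "\<l> \<le> \<rho> a \<l>"
  proof (rule l_le)
    fix n
    have "i (scale (int n) a) = \<rho> a (i (scale (int n - 1) a))" unfolding shift by simp
    also have "\<dots> < \<rho> a \<l>" unfolding rho_less_iff by (rule less_l)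
    finally show "i (scale (int n) a) \<le> \<rho> a \<l>" by simp
  qed
  ultimately have fixed: "\<rho> a \<l> = \<l>" by simp
  have not_range: "\<l> \<notin> range i"
  proof
    assume "\<l> \<in> range i"
    then obtain h where h: "\<l> = i h" by blast
    have "i (h + 0) < i (h + a)" unfolding i_add_less using a by simp
    then show False using fixed unfolding h rho_i by (simp add: add.commute)
  qed
  have "\<l> \<le> i b" using ab by (rule l_le)
  then have lb: "\<l> < i b" using not_range by (metis less_le rangeI)
  show thesis
    by (rule that[of a \<l> b]) (fact a fixed not_range lb less_l l_le)+
qed

text \<open>
  By Cramer's rule, the multiple \<open>N g\<close> of any \<open>g\<close>, for a fixed \<open>N > 0\<close>, is \<open>k g\<close> times \<open>b\<close> plus a
  multiple of \<open>a\<close>, where \<open>k g\<close> is up to sign the determinant of \<open>a\<close> and \<open>g\<close>. As \<open>\<rho> a\<close> fixes \<open>\<l>\<close>, the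
  point \<open>\<rho> g \<l>\<close> is determined by \<open>k g\<close> and depends monotonically on it. Since the multiples of \<open>b\<close> move
  \<open>\<l>\<close> arbitrarily far in both directions, only finitely many values of \<open>k g\<close> lead into a bounded
  interval.
\<close>

lemma fixed_point_orbit_locally_finite:
  assumes a: "0 < i a" and fixed: "\<rho> a \<l> = \<l>" and lb: "\<l> < i b"
    and less_l: "\<And>k. i (scale k a) < \<l>"
    and l_le: "\<And>c. (\<And>n::nat. i (scale (int n) a) \<le> c) \<Longrightarrow> \<l> \<le> c"
  shows "finite (range (\<lambda>g. \<rho> g \<l>) \<inter> {m..M})"
proof -
  have fixed': "\<rho> (scale k a) \<l> = \<l>" for k by (rule rho_scale_fixed[OF fixed])
  have l_pos: "0 < \<l>" using less_l[of 0] by simp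
  have move: "\<l> < \<rho> b \<l>"
  proof -
    have "\<rho> b 0 < \<rho> b \<l>" using l_pos by (simp only: rho_less_iff)
    then show ?thesis using lb by simp
  qed
  define dt where "dt g h = fst g * snd h - snd g * fst h" for g h :: "int \<times> int"
  have cramer: "scale (dt a b) g = scale (dt g b) a + scale (dt a g) b" for g
    by (simp add: dt_def scale_def prod_eq_iff algebra_simps)
  \<comment> \<open>otherwise a multiple of \<open>b\<close> is one of \<open>a\<close> and fixes \<open>\<l>\<close>\<close>
  have "dt a b \<noteq> 0"
  proof
    assume 0: "dt a b = 0"
    have "a \<noteq> 0" using a by auto
    define g where "g = (- snd a, fst a)"
    have "dt a g = fst a * fst a + snd a * snd a" by (simp add: g_def dt_def)
    moreover have "\<dots> > 0" using \<open>a \<noteq> 0\<close>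
      by (metis prod.collapse zero_prod_def sum_squares_gt_zero_iff)
    ultimately have pos: "dt a g > 0" by simp
    have "scale (dt a g) b = scale (- dt g b) a"
      using cramer[of g] unfolding 0 by (simp add: scale_minus) (metis add.commute eq_neg_iff_add_eq_0)
    then have "\<rho> (scale (dt a g) b) \<l> = \<l>" using fixed' by simp
    moreover have "\<l> < \<rho> (scale (int (nat (dt a g))) b) \<l>"
      using pos by (intro rho_scale_less move) simp
    ultimately show False using pos by simp
  qed
  define N where "N = nat \<bar>dt a b\<bar>"
  have N: "N > 0" "int N = \<bar>dt a b\<bar>" using \<open>dt a b \<noteq> 0\<close> by (auto simp: N_def)
  \<comment> \<open>the sign is chosen so that \<open>k b = N > 0\<close>\<close>
  define k where "k g = sgn (dt a b) * dt a g" for g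
  have k_b: "k b = int N" unfolding k_def N by (simp add: abs_sgn mult.commute)
  have k_add: "k (g + h) = k g + k h" for g h by (simp add: k_def dt_def algebra_simps)
  have k_minus: "k (- g) = - k g" for g by (simp add: k_def dt_def algebra_simps)
  have k_scale: "k (scale j g) = j * k g" for j g by (simp add: k_def dt_def scale_def algebra_simps)
  have decomp: "\<exists>x. scale (int N) g = scale (k g) b + scale x a" for g
  proof -
    have "scale (int N) g = scale (sgn (dt a b)) (scale (dt a b) g)"
      unfolding N scale_scale by (simp add: abs_sgn mult.commute)
    also have "\<dots> = scale (k g) b + scale (sgn (dt a b) * dt g b) a"
      unfolding cramer by (simp add: k_def scale_def prod_eq_iff algebra_simps)
    finally show ?thesis by blast
  qed
  have rho_N: "\<rho> (scale (int N) g) \<l> = \<rho> (scale (k g) b) \<l>" for g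
    using decomp[of g] by (auto simp: rho_add[symmetric] fixed')
  have up: "\<l> \<le> \<rho> (scale (int n) b) \<l>" for n
    using rho_scale_less[OF move, of n] by (cases "n = 0") auto
  have down: "\<rho> (scale (- int n) b) \<l> \<le> \<l>" for n
    using up[of n] by (metis rho_le_iff rho_minus(1) scale_minus)
  have k_pos: "0 < k u" if "\<l> < \<rho> u \<l>" for u
  proof (rule ccontr)
    assume "\<not> 0 < k u"
    then have "\<rho> (scale (k u) b) \<l> \<le> \<l>" using down[of "nat (- k u)"] by simp
    then show False using rho_scale_less[OF that N(1)] rho_N[of u] by simp
  qed
  have k_neg: "k u < 0" if "\<rho> u \<l> < \<l>" for u
  proof (rule ccontr)
    assume "\<not> k u < 0"
    then have "\<l> \<le> \<rho> (scale (k u) b) \<l>" using up[of "nat (k u)"] by simp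
    then show False using rho_scale_greater[OF that N(1)] rho_N[of u] by simp
  qed
  have k_mono: "k g < k h" if "\<rho> g \<l> < \<rho> h \<l>" for g h
  proof -
    have "\<rho> (- g) (\<rho> g \<l>) < \<rho> (- g) (\<rho> h \<l>)" using that by (simp only: rho_less_iff)
    then have "\<l> < \<rho> (- g + h) \<l>" by (simp only: rho_add left_minus rho_id)
    then have "0 < k (- g + h)" by (rule k_pos)
    then show ?thesis by (simp only: k_add k_minus)
  qed
  have k_inj: "\<rho> g \<l> = \<rho> h \<l>" if "k g = k h" for g h
    using k_mono[of g h] k_mono[of h g] that by linarith
  have above: "\<exists>j. M < \<rho> (scale j b) \<l>" for M
  proof -
    obtain h where h: "max M 0 < i h" using i_unbounded_above by blast
    obtain x where x: "scale (int N) h = scale (k h) b + scale x a" using decomp by blast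
    have "i (scale 1 h) \<le> i (scale (int N) h)"
      using scale_less[of h 1 "int N"] h N(1) by (cases "N = 1") auto
    also have "\<dots> = \<rho> (scale (k h) b) (i (scale x a))" by (simp add: x)
    also have "\<dots> < \<rho> (scale (k h) b) \<l>" unfolding rho_less_iff by (rule less_l)
    finally show ?thesis using h by (intro exI[of _ "k h"]) simp
  qed
  have below: "\<exists>j. \<rho> (scale j b) \<l> < M" for M
  proof -
    obtain h where h: "i h < min M 0" using i_unbounded_below by blast
    obtain x where x: "scale (int N) h = scale (k h) b + scale x a" using decomp by blast
    have "i (- 0) < i (- h)" unfolding i_minus_less using h by simp
    then have "i (scale 1 (- h)) \<le> i (scale (int N) (- h))"
      using scale_less[of "- h" 1 "int N"] N(1) by (cases "N = 1") auto
    moreover have "scale (int N) (- h) = - scale (int N) h" by (simp add: scale_def)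
    ultimately have "i (scale (int N) h) \<le> i h"
      using i_minus_less[of "scale (int N) h" h] by simp
    moreover have "i (scale (int N) h) = \<rho> (scale (k h) b) (i (scale x a))" by (simp add: x)
    moreover have "\<rho> (- b) \<l> \<le> i (scale x a)"
    proof -
      have "\<l> \<le> i (scale x a + b)"
      proof (rule l_le)
        fix n
        have "i (scale x a + scale (int n - x) a) \<le> i (scale x a + b)"
          unfolding i_add_le using less_l[of "int n - x"] lb by simp
        then show "i (scale (int n) a) \<le> i (scale x a + b)" by (simp add: scale_add[symmetric])
      qed
      then have "\<rho> (- b) \<l> \<le> \<rho> (- b) (i (scale x a + b))" by (simp only: rho_le_iff)
      then show ?thesis by simp
    qed
    then have "\<rho> (scale (k h) b) (\<rho> (- b) \<l>) \<le> \<rho> (scale (k h) b) (i (scale x a))"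
      by (simp only: rho_le_iff)
    moreover have "scale (k h) b + - b = scale (k h - 1) b" by (simp add: scale_def prod_eq_iff algebra_simps)
    ultimately have "\<rho> (scale (k h - 1) b) \<l> \<le> i h" by (simp only: rho_add)
    then show ?thesis using h by (intro exI[of _ "k h - 1"]) simp
  qed
  obtain j1 j2 where j: "\<rho> (scale j1 b) \<l> < m" "M < \<rho> (scale j2 b) \<l>"
    using above below by blast
  define f where "f n = \<rho> (SOME g. k g = n) \<l>" for n
  have f: "f (k g) = \<rho> g \<l>" for g
    unfolding f_def by (rule k_inj) (rule someI[of _ g], simp)
  have "range (\<lambda>g. \<rho> g \<l>) \<inter> {m..M} \<subseteq> f ` {k (scale j1 b)..k (scale j2 b)}"
  proof
    fix y assume "y \<in> range (\<lambda>g. \<rho> g \<l>) \<inter> {m..M}"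
    then obtain g where g: "y = \<rho> g \<l>" "m \<le> \<rho> g \<l>" "\<rho> g \<l> \<le> M" by auto
    then have "k (scale j1 b) < k g" "k g < k (scale j2 b)" using j by (auto intro!: k_mono)
    then show "y \<in> f ` {k (scale j1 b)..k (scale j2 b)}"
      unfolding g(1) f[symmetric] by (intro imageI) simp
  qed
  then show ?thesis using finite_subset by blast
qed

end

section \<open>The covering of the torus by the plane\<close>

lemma deck_simps [simp]: "deck 0 x = x" "deck g (deck h x) = deck (g + h) x"
  by (auto simp: deck_def prod_eq_iff)

lemma deck_inj_left: "deck g x = deck h x \<longleftrightarrow> g = h"
  by (auto simp: deck_def prod_eq_iff)

lemma continuous_on_deck [continuous_intros]:
  "continuous_on S f \<Longrightarrow> continuous_on S (\<lambda>x. deck g (f x))"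
  unfolding deck_def by (intro continuous_intros)

lemma continuous_on_cover [continuous_intros]:
  "continuous_on S f \<Longrightarrow> continuous_on S (\<lambda>x. cover (f x))"
  unfolding cover_def cis_conv_exp by (intro continuous_intros)

lemma cover_in_torus: "cover x \<in> torus"
  by (auto simp: cover_def torus_def)

lemma cis_eq_cis_imp_int:
  assumes "cis (2 * pi * a) = cis (2 * pi * b)"
  shows "\<exists>n::int. b = a + n"
proof -
  have "sin (2 * pi * b) = sin (2 * pi * a) \<and> cos (2 * pi * b) = cos (2 * pi * a)"
    using assms by (metis cis.sel)
  then obtain n :: int where "2 * pi * b = 2 * pi * a + 2 * pi * n"
    using sin_cos_eq_iff by metis
  then have "2 * pi * b = 2 * pi * (a + n)" by (simp add: algebra_simps)
  then show ?thesis by (intro exI[of _ n]) simp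
qed

lemma cis_int_shift: "cis (2 * pi * (a + real_of_int n)) = cis (2 * pi * a)"
proof -
  have "cis (2 * pi * (a + real_of_int n)) = cis (2 * pi * a) * cis (2 * pi * real_of_int n)"
    by (simp add: cis_mult algebra_simps)
  also have "cis (2 * pi * real_of_int n) = 1" by (rule cis_multiple_2pi) simp
  finally show ?thesis by simp
qed

lemma cover_deck [simp]: "cover (deck g x) = cover x"
  by (simp add: cover_def deck_def cis_int_shift)

lemma cover_eq_iff: "cover x = cover y \<longleftrightarrow> (\<exists>g. y = deck g x)"
proof
  assume "cover x = cover y"
  then have "cis (2 * pi * fst x) = cis (2 * pi * fst y)" "cis (2 * pi * snd x) = cis (2 * pi * snd y)"
    by (auto simp: cover_def)
  then obtain m n :: int where "fst y = fst x + m" "snd y = snd x + n"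
    using cis_eq_cis_imp_int by metis
  then have "y = deck (m, n) x" by (simp add: deck_def prod_eq_iff)
  then show "\<exists>g. y = deck g x" by blast
qed auto

text \<open>
  A connected metric space with two different points is uncountable.
\<close>

lemma connected_countable_range_constant:
  fixes f :: "'a::topological_space \<Rightarrow> 'b::metric_space"
  assumes "connected S" "continuous_on S f" "f ` S \<subseteq> C" "countable C" "x \<in> S" "y \<in> S"
  shows "f x = f y"
proof (rule ccontr)
  assume "f x \<noteq> f y"
  moreover have "connected (f ` S)" using assms by (intro connected_continuous_image)
  ultimately have "uncountable (f ` S)"
    using connected_uncountable[of "f ` S" "f x" "f y"] assms by blast
  then show False using assms countable_subset by blast
qed

text \<open>
  Both coordinates have continuous logarithms on the convex set. As they have modulus one, the
  imaginary parts of the logarithms, divided by \<open>2 * pi\<close>, form a lift.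
\<close>

lemma cover_lift_exists:
  fixes f :: "'a::real_normed_vector \<Rightarrow> complex \<times> complex"
  assumes "continuous_on S f" "convex S" "f ` S \<subseteq> torus"
  obtains h where "continuous_on S h" "\<And>x. x \<in> S \<Longrightarrow> cover (h x) = f x"
proof -
  have c: "contractible S" using assms(2) by (rule convex_imp_contractible)
  have nz: "norm (fst (f x)) = 1" "norm (snd (f x)) = 1" if "x \<in> S" for x
    using assms(3) that by (auto simp: torus_def)
  have "continuous_on S (\<lambda>x. fst (f x))" "continuous_on S (\<lambda>x. snd (f x))"
    by (intro continuous_intros assms)+
  moreover have "fst (f x) \<noteq> 0" "snd (f x) \<noteq> 0" if "x \<in> S" for x
    using nz[OF that] by auto
  note log = calculation this
  obtain p where p: "continuous_on S p" "\<And>x. x \<in> S \<Longrightarrow> fst (f x) = exp (p x)"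
    by (rule continuous_logarithm_on_contractible[OF log(1) c log(3)]) auto
  obtain q where q: "continuous_on S q" "\<And>x. x \<in> S \<Longrightarrow> snd (f x) = exp (q x)"
    by (rule continuous_logarithm_on_contractible[OF log(2) c log(4)]) auto
  have e: "cis (Im z) = exp z" if "norm (exp z) = 1" for z
  proof -
    have "Re z = 0" using that by simp
    then show ?thesis by (simp add: exp_eq_polar)
  qed
  show thesis
  proof (rule that[of "\<lambda>x. (Im (p x) / (2 * pi), Im (q x) / (2 * pi))"])
    show "continuous_on S (\<lambda>x. (Im (p x) / (2 * pi), Im (q x) / (2 * pi)))"
      by (intro continuous_intros p q) auto
    fix x assume x: "x \<in> S"
    have "cis (Im (p x)) = fst (f x)" "cis (Im (q x)) = snd (f x)"
      using e[of "p x"] e[of "q x"] nz[OF x] p(2)[OF x] q(2)[OF x] by auto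
    then show "cover (Im (p x) / (2 * pi), Im (q x) / (2 * pi)) = f x"
      by (simp add: cover_def)
  qed
qed

text \<open>
  The difference of the two lifts takes values in the countable set of integer pairs.
\<close>

lemma cover_lift_unique:
  assumes "connected S" "continuous_on S h" "continuous_on S k"
    "\<And>x. x \<in> S \<Longrightarrow> cover (h x) = cover (k x)"
  obtains g where "\<And>x. x \<in> S \<Longrightarrow> k x = deck g (h x)"
proof (cases "S = {}")
  case True
  then show ?thesis using that by auto
next
  case False
  then obtain y where y: "y \<in> S" by blast
  define C where "C = range (\<lambda>g::int\<times>int. (real_of_int (fst g), real_of_int (snd g)))"
  have im: "\<exists>g. k x = deck g (h x)" if "x \<in> S" for x
    using assms(4)[OF that] cover_eq_iff by blast
  have "(\<lambda>x. k x - h x) ` S \<subseteq> C"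
  proof (rule image_subsetI)
    fix x assume "x \<in> S"
    then obtain g where "k x = deck g (h x)" using im by blast
    then have "k x - h x = (real_of_int (fst g), real_of_int (snd g))" by (simp add: deck_def)
    then show "k x - h x \<in> C" unfolding C_def by blast
  qed
  moreover have "countable C" unfolding C_def by auto
  ultimately have const: "k x - h x = k y - h y" if "x \<in> S" for x
    using connected_countable_range_constant[OF assms(1), of "\<lambda>x. k x - h x" C x y] that y assms
    by (auto intro: continuous_intros)
  obtain g where g: "k y = deck g (h y)" using im y by blast
  have "k x = deck g (h x)" if "x \<in> S" for x
    using const[OF that] g by (simp add: deck_def algebra_simps)
  then show ?thesis using that by blast
qed

lemma finite_translates_meeting:
  assumes "bounded X" "bounded Y"
  shows "finite {g. deck g ` X \<inter> Y \<noteq> {}}"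
proof -
  obtain B where B: "\<And>x. x \<in> X \<Longrightarrow> norm x \<le> B" using assms(1) bounded_iff by blast
  obtain C where C: "\<And>x. x \<in> Y \<Longrightarrow> norm x \<le> C" using assms(2) bounded_iff by blast
  let ?n = "\<lceil>B + C\<rceil>"
  have "{g. deck g ` X \<inter> Y \<noteq> {}} \<subseteq> {-?n..?n} \<times> {-?n..?n}"
  proof
    fix g assume "g \<in> {g. deck g ` X \<inter> Y \<noteq> {}}"
    then obtain x where x: "x \<in> X" "deck g x \<in> Y" by auto
    have "norm (deck g x - x) \<le> B + C"
      using norm_triangle_ineq4[of "deck g x" x] B[OF x(1)] C[OF x(2)] by linarith
    moreover have "\<bar>fst z\<bar> \<le> norm z" "\<bar>snd z\<bar> \<le> norm z" for z :: "real \<times> real"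
      using norm_fst_le[of "fst z" "snd z"] norm_snd_le[of "snd z" "fst z"] by auto
    ultimately have "\<bar>fst (deck g x - x)\<bar> \<le> B + C" "\<bar>snd (deck g x - x)\<bar> \<le> B + C"
      by (meson order_trans)+
    then have "\<bar>real_of_int (fst g)\<bar> \<le> B + C" "\<bar>real_of_int (snd g)\<bar> \<le> B + C"
      by (auto simp: deck_def)
    then have "\<bar>fst g\<bar> \<le> ?n" "\<bar>snd g\<bar> \<le> ?n" by linarith+
    then show "g \<in> {-?n..?n} \<times> {-?n..?n}" by (auto simp: mem_Times_iff)
  qed
  then show ?thesis by (rule finite_subset) simp
qed

lemma finite_translated_family_meeting:
  assumes "finite I" "\<And>c. c \<in> I \<Longrightarrow> bounded (X c)" "bounded Y"
  shows "finite {\<alpha> \<in> I \<times> UNIV. deck (snd \<alpha>) ` X (fst \<alpha>) \<inter> Y \<noteq> {}}"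
proof (rule finite_subset)
  show "{\<alpha> \<in> I \<times> UNIV. deck (snd \<alpha>) ` X (fst \<alpha>) \<inter> Y \<noteq> {}} \<subseteq>
      (SIGMA c:I. {g. deck g ` X c \<inter> Y \<noteq> {}})"
  proof
    fix \<alpha> assume "\<alpha> \<in> {\<alpha> \<in> I \<times> UNIV. deck (snd \<alpha>) ` X (fst \<alpha>) \<inter> Y \<noteq> {}}"
    then have "(fst \<alpha>, snd \<alpha>) \<in> (SIGMA c:I. {g. deck g ` X c \<inter> Y \<noteq> {}})"
      by (simp only: mem_Sigma_iff mem_Collect_eq mem_Times_iff simp_thms)
    then show "\<alpha> \<in> (SIGMA c:I. {g. deck g ` X c \<inter> Y \<noteq> {}})" by simp
  qed
  show "finite (SIGMA c:I. {g. deck g ` X c \<inter> Y \<noteq> {}})"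
    using assms by (intro finite_SigmaI finite_translates_meeting)
qed

text \<open>
  The affine symmetries of the triangle carry its bottom side to any side, in either direction.
\<close>

lemma corner_symmetry:
  assumes "a \<in> corners" "b \<in> corners" "a \<noteq> b"
  obtains A B :: "real \<times> real \<Rightarrow> real \<times> real" where
    "continuous_on UNIV A" "\<And>z. B (A z) = z" "\<And>z. A (B z) = z"
    "A ` std_triangle = std_triangle" "A ` interior std_triangle = interior std_triangle"
    "\<And>x. A (x, 0) = linepath a b x"
proof -
  have *: "\<exists>A B. continuous_on UNIV A \<and> (\<forall>z. B (A z) = z) \<and> (\<forall>z. A (B z) = z) \<and>
    (\<forall>z. A z \<in> std_triangle \<longleftrightarrow> z \<in> std_triangle) \<and>
    (\<forall>z. A z \<in> interior std_triangle \<longleftrightarrow> z \<in> interior std_triangle) \<and> (\<forall>x. A (x, 0) = linepath a b x)"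
    (is "\<exists>A B. ?P A B")
  proof -
    consider "a = (0,0)" "b = (1,0)" | "a = (1,0)" "b = (0,0)" | "a = (0,0)" "b = (0,1)"
      | "a = (0,1)" "b = (0,0)" | "a = (1,0)" "b = (0,1)" | "a = (0,1)" "b = (1,0)"
      using assms by (auto simp: corners_def)
    then show ?thesis
    proof cases
      case 1
      then show ?thesis
        unfolding interior_std_triangle_eq unfolding std_triangle_eq
        by (intro exI[of _ "\<lambda>z. z"] exI[of _ "\<lambda>z. z"]) (auto simp: linepath_def)
    next
      case 2
      then show ?thesis
        unfolding interior_std_triangle_eq unfolding std_triangle_eq
        by (intro exI[of _ "\<lambda>z. (1 - fst z - snd z, snd z)"] exI[of _ "\<lambda>z. (1 - fst z - snd z, snd z)"])
          (auto simp: linepath_def intro!: continuous_intros)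
    next
      case 3
      then show ?thesis
        unfolding interior_std_triangle_eq unfolding std_triangle_eq
        by (intro exI[of _ "\<lambda>z. (snd z, fst z)"] exI[of _ "\<lambda>z. (snd z, fst z)"])
          (auto simp: linepath_def intro!: continuous_intros)
    next
      case 4
      then show ?thesis
        unfolding interior_std_triangle_eq unfolding std_triangle_eq
        by (intro exI[of _ "\<lambda>z. (snd z, 1 - fst z - snd z)"] exI[of _ "\<lambda>z. (1 - fst z - snd z, fst z)"])
          (auto simp: linepath_def intro!: continuous_intros)
    next
      case 5
      then show ?thesis
        unfolding interior_std_triangle_eq unfolding std_triangle_eq
        by (intro exI[of _ "\<lambda>z. (1 - fst z - snd z, fst z)"] exI[of _ "\<lambda>z. (snd z, 1 - fst z - snd z)"])
          (auto simp: linepath_def intro!: continuous_intros)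
    next
      case 6
      then show ?thesis
        unfolding interior_std_triangle_eq unfolding std_triangle_eq
        by (intro exI[of _ "\<lambda>z. (fst z, 1 - fst z - snd z)"] exI[of _ "\<lambda>z. (fst z, 1 - fst z - snd z)"])
          (auto simp: linepath_def intro!: continuous_intros)
    qed
  qed
  then obtain A B where AB: "?P A B" by blast
  have im: "A ` S = S" if "\<And>z. A z \<in> S \<longleftrightarrow> z \<in> S" for S
  proof
    show "A ` S \<subseteq> S" using that by blast
    show "S \<subseteq> A ` S"
    proof
      fix z assume "z \<in> S"
      then have "A (B z) \<in> S" using AB by simp
      then have "B z \<in> S" using that by blast
      then show "z \<in> A ` S" using AB by (metis imageI)
    qed
  qed
  show thesis
    by (rule that[of A B]) (use AB im in auto)
qed

section \<open>Lifted vertices, edges and triangles\<close>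

locale essential_torus_triangulation =
  fixes v :: "complex \<times> complex" and E :: "(real \<Rightarrow> complex \<times> complex) set"
    and D :: "(real \<times> real \<Rightarrow> complex \<times> complex) set" and v0 :: "real \<times> real"
  assumes triangulation: "torus_triangulation {v} E D"
    and essential: "essential E"
    and cover_v0: "cover v0 = v"
begin

lemma finite_cells: "finite E" "finite D"
  and edge_maps: "\<forall>\<gamma>\<in>E. path \<gamma> \<and> inj_on \<gamma> {0<..<1} \<and> pathstart \<gamma> \<in> {v} \<and> pathfinish \<gamma> \<in> {v}"
  and triangle_maps: "\<forall>\<sigma>\<in>D. continuous_on std_triangle \<sigma> \<and> inj_on \<sigma> (interior std_triangle) \<and>
        (\<forall>a\<in>corners. \<forall>b\<in>corners. a \<noteq> b \<longrightarrow>
           (\<exists>\<gamma>\<in>E. (\<forall>t\<in>{0..1}. \<sigma> (linepath a b t) = \<gamma> t) \<or>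
                   (\<forall>t\<in>{0..1}. \<sigma> (linepath a b t) = reversepath \<gamma> t)))"
  and torus_cells: "torus = {v} \<union> (\<Union>\<gamma>\<in>E. \<gamma> ` {0<..<1}) \<union> (\<Union>\<sigma>\<in>D. \<sigma> ` interior std_triangle)"
  and cells_disjnt: "\<forall>\<gamma>\<in>E. disjnt {v} (\<gamma> ` {0<..<1})" "\<forall>\<sigma>\<in>D. disjnt {v} (\<sigma> ` interior std_triangle)"
     "\<forall>\<gamma>\<in>E. \<forall>\<sigma>\<in>D. disjnt (\<gamma> ` {0<..<1}) (\<sigma> ` interior std_triangle)"
     "pairwise (\<lambda>\<gamma> \<gamma>'. disjnt (\<gamma> ` {0<..<1}) (\<gamma>' ` {0<..<1})) E"
     "pairwise (\<lambda>\<sigma> \<sigma>'. disjnt (\<sigma> ` interior std_triangle) (\<sigma>' ` interior std_triangle)) D"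
  by (insert triangulation[unfolded torus_triangulation_def], elim conjE, assumption)+

lemma edge_path: "\<gamma> \<in> E \<Longrightarrow> path \<gamma>" "\<gamma> \<in> E \<Longrightarrow> inj_on \<gamma> {0<..<1}"
  "\<gamma> \<in> E \<Longrightarrow> \<gamma> 0 = v" "\<gamma> \<in> E \<Longrightarrow> \<gamma> 1 = v"
  using edge_maps unfolding pathstart_def pathfinish_def by blast+

lemma triangle_map: "\<sigma> \<in> D \<Longrightarrow> continuous_on std_triangle \<sigma>"
  "\<sigma> \<in> D \<Longrightarrow> inj_on \<sigma> (interior std_triangle)"
  using triangle_maps by blast+

lemma triangle_side:
  assumes "\<sigma> \<in> D" "a \<in> corners" "b \<in> corners" "a \<noteq> b"
  obtains \<gamma> where "\<gamma> \<in> E"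
    "(\<forall>t\<in>{0..1}. \<sigma> (linepath a b t) = \<gamma> t) \<or> (\<forall>t\<in>{0..1}. \<sigma> (linepath a b t) = reversepath \<gamma> t)"
proof -
  have "\<exists>\<gamma>\<in>E. (\<forall>t\<in>{0..1}. \<sigma> (linepath a b t) = \<gamma> t) \<or> (\<forall>t\<in>{0..1}. \<sigma> (linepath a b t) = reversepath \<gamma> t)"
    using triangle_maps[rule_format, OF assms(1)] assms(2-4) by simp
  then show ?thesis using that by blast
qed

lemma cells_disjoint:
  "\<gamma> \<in> E \<Longrightarrow> t \<in> {0<..<1} \<Longrightarrow> \<gamma> t \<noteq> v"
  "\<sigma> \<in> D \<Longrightarrow> z \<in> interior std_triangle \<Longrightarrow> \<sigma> z \<noteq> v"
  "\<gamma> \<in> E \<Longrightarrow> \<sigma> \<in> D \<Longrightarrow> t \<in> {0<..<1} \<Longrightarrow> z \<in> interior std_triangle \<Longrightarrow> \<gamma> t \<noteq> \<sigma> z"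
  "\<gamma> \<in> E \<Longrightarrow> \<gamma>' \<in> E \<Longrightarrow> t \<in> {0<..<1} \<Longrightarrow> t' \<in> {0<..<1} \<Longrightarrow> \<gamma> t = \<gamma>' t' \<Longrightarrow> \<gamma> = \<gamma>'"
  "\<sigma> \<in> D \<Longrightarrow> \<sigma>' \<in> D \<Longrightarrow> z \<in> interior std_triangle \<Longrightarrow> z' \<in> interior std_triangle \<Longrightarrow>
    \<sigma> z = \<sigma>' z' \<Longrightarrow> \<sigma> = \<sigma>'"
proof -
  have dj: "x \<noteq> y" if "disjnt (A::(complex \<times> complex) set) B" "x \<in> A" "y \<in> B" for A B x y
    using that by (auto simp: disjnt_def)
  show "\<gamma> t \<noteq> v" if "\<gamma> \<in> E" "t \<in> {0<..<1}" for \<gamma> t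
    using cells_disjnt(1)[rule_format, OF that(1)] imageI[OF that(2), of \<gamma>] unfolding disjnt_insert1 by metis
  show "\<sigma> z \<noteq> v" if "\<sigma> \<in> D" "z \<in> interior std_triangle" for \<sigma> z
    using cells_disjnt(2)[rule_format, OF that(1)] imageI[OF that(2), of \<sigma>] unfolding disjnt_insert1 by metis
  show "\<gamma> t \<noteq> \<sigma> z" if "\<gamma> \<in> E" "\<sigma> \<in> D" "t \<in> {0<..<1}" "z \<in> interior std_triangle" for \<gamma> \<sigma> t z
    using dj[OF cells_disjnt(3)[rule_format, OF that(1,2)]] imageI[OF that(3), of \<gamma>]
      imageI[OF that(4), of \<sigma>] by blast
  show "\<gamma> = \<gamma>'" if "\<gamma> \<in> E" "\<gamma>' \<in> E" "t \<in> {0<..<1}" "t' \<in> {0<..<1}" "\<gamma> t = \<gamma>' t'" for \<gamma> \<gamma>' t t'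
  proof (rule ccontr)
    assume "\<gamma> \<noteq> \<gamma>'"
    then have "disjnt (\<gamma> ` {0<..<1}) (\<gamma>' ` {0<..<1})" by (rule pairwiseD[OF cells_disjnt(4) that(1,2)])
    then show False using dj[OF _ imageI[OF that(3), of \<gamma>] imageI[OF that(4), of \<gamma>']] that(5) by blast
  qed
  show "\<sigma> = \<sigma>'" if "\<sigma> \<in> D" "\<sigma>' \<in> D" "z \<in> interior std_triangle" "z' \<in> interior std_triangle"
    "\<sigma> z = \<sigma>' z'" for \<sigma> \<sigma>' z z'
  proof (rule ccontr)
    assume "\<sigma> \<noteq> \<sigma>'"
    then have "disjnt (\<sigma> ` interior std_triangle) (\<sigma>' ` interior std_triangle)" by (rule pairwiseD[OF cells_disjnt(5) that(1,2)])
    then show False using dj[OF _ imageI[OF that(3), of \<sigma>] imageI[OF that(4), of \<sigma>']] that(5) by blast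
  qed
qed

lemma edge_in_torus:
  assumes "\<gamma> \<in> E" "t \<in> {0..1}" shows "\<gamma> t \<in> torus"
proof (cases "t \<in> {0<..<1}")
  case True
  then show ?thesis unfolding torus_cells using assms by blast
next
  case False
  then have "t = 0 \<or> t = 1" using assms by auto
  then show ?thesis unfolding torus_cells using assms edge_path by auto
qed

lemma triangle_in_torus:
  assumes "\<sigma> \<in> D" "z \<in> std_triangle" shows "\<sigma> z \<in> torus"
proof (cases "z \<in> interior std_triangle")
  case True
  then show ?thesis unfolding torus_cells using assms by blast
next
  case False
  then have "z \<in> frontier std_triangle" using assms std_triangle_split by blast
  then obtain a b t where abt: "a \<in> corners" "b \<in> corners" "a \<noteq> b" "t \<in> {0..1}" "z = linepath a b t"
    by (rule frontier_side)
  obtain \<gamma> where "\<gamma> \<in> E" "(\<forall>t\<in>{0..1}. \<sigma> (linepath a b t) = \<gamma> t) \<or> (\<forall>t\<in>{0..1}. \<sigma> (linepath a b t) = reversepath \<gamma> t)"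
    using triangle_side[OF assms(1) abt(1-3)] by blast
  then have "\<sigma> z = \<gamma> t \<or> \<sigma> z = \<gamma> (1 - t)" using abt by (auto simp: reversepath_def)
  then show ?thesis using edge_in_torus[OF \<open>\<gamma> \<in> E\<close>] abt by auto
qed

definition edge_lift :: "(real \<Rightarrow> complex \<times> complex) \<Rightarrow> real \<Rightarrow> real \<times> real" where
  "edge_lift \<gamma> = (SOME h. continuous_on {0..1} h \<and> (\<forall>t\<in>{0..1}. cover (h t) = \<gamma> t))"

definition triangle_lift :: "(real \<times> real \<Rightarrow> complex \<times> complex) \<Rightarrow> real \<times> real \<Rightarrow> real \<times> real" where
  "triangle_lift \<sigma> = (SOME h. continuous_on std_triangle h \<and> (\<forall>z\<in>std_triangle. cover (h z) = \<sigma> z))"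

lemma edge_lift:
  assumes "\<gamma> \<in> E"
  shows "continuous_on {0..1} (edge_lift \<gamma>)" "\<And>t. t \<in> {0..1} \<Longrightarrow> cover (edge_lift \<gamma> t) = \<gamma> t"
proof -
  have "continuous_on {0..1} \<gamma>" using edge_path(1)[OF assms] by (simp add: path_def)
  moreover have "\<gamma> ` {0..1} \<subseteq> torus" using edge_in_torus[OF assms] by blast
  ultimately obtain h where "continuous_on {0..1} h" "\<And>t. t \<in> {0..1} \<Longrightarrow> cover (h t) = \<gamma> t"
    using cover_lift_exists[of "{0..1}" \<gamma>] by auto
  then have "\<exists>h. continuous_on {0..1} h \<and> (\<forall>t\<in>{0..1}. cover (h t) = \<gamma> t)" by blast
  then have "continuous_on {0..1} (edge_lift \<gamma>) \<and> (\<forall>t\<in>{0..1}. cover (edge_lift \<gamma> t) = \<gamma> t)"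
    unfolding edge_lift_def by (rule someI_ex)
  then show "continuous_on {0..1} (edge_lift \<gamma>)" "\<And>t. t \<in> {0..1} \<Longrightarrow> cover (edge_lift \<gamma> t) = \<gamma> t"
    by blast+
qed

lemma triangle_lift:
  assumes "\<sigma> \<in> D"
  shows "continuous_on std_triangle (triangle_lift \<sigma>)"
    "\<And>z. z \<in> std_triangle \<Longrightarrow> cover (triangle_lift \<sigma> z) = \<sigma> z"
proof -
  have "\<sigma> ` std_triangle \<subseteq> torus" using triangle_in_torus[OF assms] by blast
  then obtain h where "continuous_on std_triangle h" "\<And>z. z \<in> std_triangle \<Longrightarrow> cover (h z) = \<sigma> z"
    using cover_lift_exists[OF triangle_map(1)[OF assms] std_triangle_convex] by auto
  then have "\<exists>h. continuous_on std_triangle h \<and> (\<forall>z\<in>std_triangle. cover (h z) = \<sigma> z)" by blast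
  then have "continuous_on std_triangle (triangle_lift \<sigma>) \<and> (\<forall>z\<in>std_triangle. cover (triangle_lift \<sigma> z) = \<sigma> z)"
    unfolding triangle_lift_def by (rule someI_ex)
  then show "continuous_on std_triangle (triangle_lift \<sigma>)"
    "\<And>z. z \<in> std_triangle \<Longrightarrow> cover (triangle_lift \<sigma> z) = \<sigma> z"
    by blast+
qed

text \<open>
  A lifted cell is addressed by a cell of the torus and a group element. This makes different
  addresses denote different cells, and a deck transformation only changes the second component.
\<close>

definition edge_at where "edge_at \<epsilon> t = deck (snd \<epsilon>) (edge_lift (fst \<epsilon>) t)"
definition face_at where "face_at \<phi> z = deck (snd \<phi>) (triangle_lift (fst \<phi>) z)"
definition edges :: "((real \<Rightarrow> complex \<times> complex) \<times> (int \<times> int)) set" where "edges = E \<times> UNIV"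
definition faces :: "((real \<times> real \<Rightarrow> complex \<times> complex) \<times> (int \<times> int)) set" where "faces = D \<times> UNIV"

lemma edges_shift [simp]: "(fst \<epsilon>, g) \<in> edges \<longleftrightarrow> \<epsilon> \<in> edges"
  and faces_shift [simp]: "(fst \<phi>, g) \<in> faces \<longleftrightarrow> \<phi> \<in> faces"
  by (simp_all add: edges_def faces_def mem_Times_iff)

lemma deck_edge_at [simp]: "deck g (edge_at \<epsilon> t) = edge_at (fst \<epsilon>, g + snd \<epsilon>) t"
  and deck_face_at [simp]: "deck g (face_at \<phi> z) = face_at (fst \<phi>, g + snd \<phi>) z"
  by (auto simp: edge_at_def face_at_def)

lemma continuous_edge_at: "\<epsilon> \<in> edges \<Longrightarrow> continuous_on {0..1} (edge_at \<epsilon>)"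
  unfolding edge_at_def edges_def by (intro continuous_intros edge_lift) auto

lemma continuous_face_at: "\<phi> \<in> faces \<Longrightarrow> continuous_on std_triangle (face_at \<phi>)"
  unfolding face_at_def faces_def by (intro continuous_intros triangle_lift) auto

lemma cover_edge_at: "\<epsilon> \<in> edges \<Longrightarrow> t \<in> {0..1} \<Longrightarrow> cover (edge_at \<epsilon> t) = fst \<epsilon> t"
  unfolding edge_at_def edges_def by (auto simp: edge_lift)

lemma cover_face_at: "\<phi> \<in> faces \<Longrightarrow> z \<in> std_triangle \<Longrightarrow> cover (face_at \<phi> z) = fst \<phi> z"
  unfolding face_at_def faces_def by (auto simp: triangle_lift)

lemma interior_std_triangleD: "z \<in> interior std_triangle \<Longrightarrow> z \<in> std_triangle"
  using interior_subset by blast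

lemma fst_edges: "\<epsilon> \<in> edges \<Longrightarrow> fst \<epsilon> \<in> E" and fst_faces: "\<phi> \<in> faces \<Longrightarrow> fst \<phi> \<in> D"
  by (auto simp: edges_def faces_def)

lemma edge_not_vertex:
  assumes "\<epsilon> \<in> edges" "t \<in> {0<..<1}" shows "edge_at \<epsilon> t \<noteq> deck g v0"
proof
  assume "edge_at \<epsilon> t = deck g v0"
  then have "fst \<epsilon> t = v" using cover_edge_at[OF assms(1), of t] assms(2) cover_v0 by auto
  then show False using cells_disjoint(1) assms fst_edges by blast
qed

lemma face_not_edge:
  assumes "\<phi> \<in> faces" "z \<in> interior std_triangle" "\<epsilon> \<in> edges" "t \<in> {0..1}"
  shows "face_at \<phi> z \<noteq> edge_at \<epsilon> t"
proof
  assume e: "face_at \<phi> z = edge_at \<epsilon> t"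
  then have "fst \<phi> z = fst \<epsilon> t"
    using cover_face_at[OF assms(1), of z] cover_edge_at[OF assms(3,4)] assms interior_std_triangleD by metis
  moreover have "t = 0 \<or> t = 1 \<or> t \<in> {0<..<1}" using assms by auto
  ultimately show False
    using cells_disjoint(2,3) assms fst_faces fst_edges edge_path(3,4) by metis
qed

lemma edge_at_open_eq:
  assumes "\<epsilon> \<in> edges" "\<epsilon>' \<in> edges" "t \<in> {0<..<1}" "t' \<in> {0<..<1}" "edge_at \<epsilon> t = edge_at \<epsilon>' t'"
  shows "\<epsilon> = \<epsilon>' \<and> t = t'"
proof -
  have t: "t \<in> {0..1}" "t' \<in> {0..1}" using assms by auto
  have c: "fst \<epsilon> t = fst \<epsilon>' t'"
    using assms(5) cover_edge_at[OF assms(1) t(1)] cover_edge_at[OF assms(2) t(2)] by simp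
  have "fst \<epsilon> = fst \<epsilon>'" by (rule cells_disjoint(4)[OF fst_edges[OF assms(1)] fst_edges[OF assms(2)] assms(3,4) c])
  moreover from this have "t = t'"
    using c edge_path(2)[OF fst_edges[OF assms(1)]] assms by (auto dest: inj_onD)
  ultimately show ?thesis
    using assms(5) by (auto simp: edge_at_def deck_inj_left prod_eq_iff[of \<epsilon>])
qed

lemma face_at_interior_eq:
  assumes "\<phi> \<in> faces" "\<phi>' \<in> faces" "z \<in> interior std_triangle" "z' \<in> interior std_triangle"
    "face_at \<phi> z = face_at \<phi>' z'"
  shows "\<phi> = \<phi>' \<and> z = z'"
proof -
  have c: "fst \<phi> z = fst \<phi>' z'"
    using assms(5) cover_face_at[OF assms(1) interior_std_triangleD[OF assms(3)]]
      cover_face_at[OF assms(2) interior_std_triangleD[OF assms(4)]] by simp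
  have "fst \<phi> = fst \<phi>'" by (rule cells_disjoint(5)[OF fst_faces[OF assms(1)] fst_faces[OF assms(2)] assms(3,4) c])
  moreover from this have "z = z'"
    using c triangle_map(2)[OF fst_faces[OF assms(1)]] assms by (auto dest: inj_onD)
  ultimately show ?thesis
    using assms(5) by (auto simp: face_at_def deck_inj_left prod_eq_iff[of \<phi>])
qed

lemma vertex_iff: "cover x = v \<longleftrightarrow> (\<exists>g. x = deck g v0)"
  using cover_v0 cover_eq_iff by metis

text \<open>
  This is where essentiality enters: an edge whose lift closes up is null-homotopic.
\<close>

lemma edge_ends:
  assumes "\<epsilon> \<in> edges"
  obtains g h where "edge_at \<epsilon> 0 = deck g v0" "edge_at \<epsilon> 1 = deck h v0" "g \<noteq> h"
proof -
  have "cover (edge_at \<epsilon> 0) = v" "cover (edge_at \<epsilon> 1) = v"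
    using cover_edge_at[OF assms] edge_path fst_edges[OF assms] by auto
  then obtain g h where gh: "edge_at \<epsilon> 0 = deck g v0" "edge_at \<epsilon> 1 = deck h v0"
    unfolding vertex_iff by blast
  have "g \<noteq> h"
  proof
    \<comment> \<open>a closed lift could be contracted linearly in the plane\<close>
    assume "g = h"
    let ?c = "linepath (edge_at \<epsilon> 0) (edge_at \<epsilon> 0)"
    have "homotopic_loops UNIV (edge_at \<epsilon>) ?c"
      using continuous_edge_at[OF assms] gh \<open>g = h\<close>
      by (intro homotopic_loops_linear) (auto simp: path_def pathstart_def pathfinish_def)
    then have "homotopic_loops torus (cover \<circ> edge_at \<epsilon>) (cover \<circ> ?c)"
      by (rule homotopic_loops_continuous_image)
        (auto simp: cover_in_torus intro: continuous_on_cover[of _ "\<lambda>x. x"] continuous_on_id)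
    moreover have "cover \<circ> ?c = linepath (cover (edge_at \<epsilon> 0)) (cover (edge_at \<epsilon> 0))"
      by (auto simp: linepath_def fun_eq_iff algebra_simps scaleR_left_distrib[symmetric])
    moreover have "homotopic_loops torus (fst \<epsilon>) (cover \<circ> edge_at \<epsilon>)"
    proof (rule homotopic_loops_eq)
      show "path (fst \<epsilon>)" using edge_path fst_edges[OF assms] by blast
      show "path_image (fst \<epsilon>) \<subseteq> torus"
        using edge_in_torus fst_edges[OF assms] by (auto simp: path_image_def)
      show "pathfinish (fst \<epsilon>) = pathstart (fst \<epsilon>)"
        using edge_path(3,4)[OF fst_edges[OF assms]] by (simp add: pathstart_def pathfinish_def)
      show "\<And>t. t \<in> {0..1} \<Longrightarrow> fst \<epsilon> t = (cover \<circ> edge_at \<epsilon>) t"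
        using cover_edge_at[OF assms] by simp
    qed
    ultimately have "\<exists>a. homotopic_loops torus (fst \<epsilon>) (linepath a a)"
      using homotopic_loops_trans by metis
    then show False using essential fst_edges[OF assms] unfolding essential_def by blast
  qed
  then show thesis using that gh by blast
qed

lemma inj_edge_at:
  assumes "\<epsilon> \<in> edges" shows "inj_on (edge_at \<epsilon>) {0..1}"
proof (rule inj_onI)
  fix s t assume st: "s \<in> {0..1}" "t \<in> {0..1}" "edge_at \<epsilon> s = edge_at \<epsilon> t"
  obtain g h where gh: "edge_at \<epsilon> 0 = deck g v0" "edge_at \<epsilon> 1 = deck h v0" "g \<noteq> h"
    using edge_ends[OF assms] .
  have "s = 0 \<or> s = 1 \<or> s \<in> {0<..<1}" "t = 0 \<or> t = 1 \<or> t \<in> {0<..<1}" using st by auto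
  then show "s = t"
    using st(3) gh edge_not_vertex[OF assms] edge_at_open_eq[OF assms assms] deck_inj_left
    by metis
qed

lemma face_side:
  assumes "\<phi> \<in> faces" "a \<in> corners" "b \<in> corners" "a \<noteq> b"
  obtains \<epsilon> where "\<epsilon> \<in> edges"
    "(\<forall>t\<in>{0..1}. face_at \<phi> (linepath a b t) = edge_at \<epsilon> t) \<or>
     (\<forall>t\<in>{0..1}. face_at \<phi> (linepath a b t) = edge_at \<epsilon> (1 - t))"
proof -
  obtain \<gamma> where \<gamma>: "\<gamma> \<in> E" "(\<forall>t\<in>{0..1}. fst \<phi> (linepath a b t) = \<gamma> t) \<or>
      (\<forall>t\<in>{0..1}. fst \<phi> (linepath a b t) = reversepath \<gamma> t)"
    using triangle_side[OF fst_faces[OF assms(1)] assms(2-4)] .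
  have m: "linepath a b t \<in> std_triangle" if "t \<in> {0..1}" for t
    using side_subset assms that by blast
  have cs: "continuous_on {0..1} (\<lambda>t. face_at \<phi> (linepath a b t))"
    by (rule continuous_on_compose2[OF continuous_face_at[OF assms(1)]]) (use m in \<open>auto intro: continuous_on_linepath\<close>)
  have cl: "continuous_on {0..1} (edge_lift \<gamma>)" by (rule edge_lift[OF \<gamma>(1)])
  have cl': "continuous_on {0..1} (\<lambda>t::real. edge_lift \<gamma> (1 - t))"
    by (rule continuous_on_compose2[OF cl]) (auto intro!: continuous_intros)
  show thesis
    using \<gamma>(2)
  proof
    assume *: "\<forall>t\<in>{0..1}. fst \<phi> (linepath a b t) = \<gamma> t"
    have "cover (edge_lift \<gamma> t) = cover (face_at \<phi> (linepath a b t))" if "t \<in> {0..1}" for t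
      using * that edge_lift(2)[OF \<gamma>(1)] cover_face_at[OF assms(1) m] by simp
    then obtain g where "\<And>t. t \<in> {0..1} \<Longrightarrow> face_at \<phi> (linepath a b t) = deck g (edge_lift \<gamma> t)"
      using cover_lift_unique[OF _ cl cs] by auto
    then show thesis
      by (intro that[of "(\<gamma>, g)"]) (auto simp: edges_def \<gamma> edge_at_def)
  next
    assume *: "\<forall>t\<in>{0..1}. fst \<phi> (linepath a b t) = reversepath \<gamma> t"
    have "cover (edge_lift \<gamma> (1 - t)) = cover (face_at \<phi> (linepath a b t))" if "t \<in> {0..1}" for t
      using * that edge_lift(2)[OF \<gamma>(1), of "1 - t"] cover_face_at[OF assms(1) m] by (simp add: reversepath_def)
    then obtain g where "\<And>t. t \<in> {0..1} \<Longrightarrow> face_at \<phi> (linepath a b t) = deck g (edge_lift \<gamma> (1 - t))"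
      using cover_lift_unique[OF _ cl' cs] by auto
    then show thesis
      by (intro that[of "(\<gamma>, g)"]) (auto simp: edges_def \<gamma> edge_at_def)
  qed
qed

lemma face_corner_vertex:
  assumes "\<phi> \<in> faces" "a \<in> corners" obtains g where "face_at \<phi> a = deck g v0"
proof -
  have "\<exists>b\<in>corners. a \<noteq> b"
    by (cases "a = (0, 0)") (auto simp: corners_def)
  then obtain b where b: "b \<in> corners" "a \<noteq> b" by blast
  obtain \<epsilon> where \<epsilon>: "\<epsilon> \<in> edges" "(\<forall>t\<in>{0..1}. face_at \<phi> (linepath a b t) = edge_at \<epsilon> t) \<or>
     (\<forall>t\<in>{0..1}. face_at \<phi> (linepath a b t) = edge_at \<epsilon> (1 - t))"
    using face_side[OF assms b] .
  then have "face_at \<phi> (linepath a b 0) = edge_at \<epsilon> 0 \<or> face_at \<phi> (linepath a b 0) = edge_at \<epsilon> 1"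
  proof (elim disjE)
    assume "\<forall>t\<in>{0..1}. face_at \<phi> (linepath a b t) = edge_at \<epsilon> t"
    then show ?thesis by simp
  next
    assume *: "\<forall>t\<in>{0..1}. face_at \<phi> (linepath a b t) = edge_at \<epsilon> (1 - t)"
    show ?thesis using bspec[OF *, of 0] by simp
  qed
  then have e: "face_at \<phi> a = edge_at \<epsilon> 0 \<or> face_at \<phi> a = edge_at \<epsilon> 1"
    by (simp add: linepath_def)
  obtain g h where "edge_at \<epsilon> 0 = deck g v0" "edge_at \<epsilon> 1 = deck h v0"
    using edge_ends[OF \<epsilon>(1)] .
  then show thesis using that e by metis
qed

lemma face_corners_distinct:
  assumes "\<phi> \<in> faces" "a \<in> corners" "b \<in> corners" "face_at \<phi> a = face_at \<phi> b" shows "a = b"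
proof (rule ccontr)
  assume "a \<noteq> b"
  obtain \<epsilon> where \<epsilon>: "\<epsilon> \<in> edges" "(\<forall>t\<in>{0..1}. face_at \<phi> (linepath a b t) = edge_at \<epsilon> t) \<or>
     (\<forall>t\<in>{0..1}. face_at \<phi> (linepath a b t) = edge_at \<epsilon> (1 - t))"
    using face_side[OF assms(1-3) \<open>a \<noteq> b\<close>] .
  from \<epsilon>(2) have "edge_at \<epsilon> 0 = edge_at \<epsilon> 1"
  proof
    assume *: "\<forall>t\<in>{0..1}. face_at \<phi> (linepath a b t) = edge_at \<epsilon> t"
    show ?thesis using bspec[OF *, of 0] bspec[OF *, of 1] assms(4) by (simp add: linepath_def)
  next
    assume *: "\<forall>t\<in>{0..1}. face_at \<phi> (linepath a b t) = edge_at \<epsilon> (1 - t)"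
    show ?thesis using bspec[OF *, of 0] bspec[OF *, of 1] assms(4) by (simp add: linepath_def)
  qed
  then show False using inj_edge_at[OF \<epsilon>(1)] by (auto dest: inj_onD)
qed

section \<open>The two triangles at an edge\<close>

lemma frontier_point_cases:
  assumes "\<phi> \<in> faces" "z \<in> frontier std_triangle"
  obtains "z \<in> corners"
  | a b \<epsilon> t where "a \<in> corners" "b \<in> corners" "a \<noteq> b" "\<epsilon> \<in> edges" "t \<in> {0<..<1}" "z = linepath a b t"
      "\<And>t. t \<in> {0..1} \<Longrightarrow> face_at \<phi> (linepath a b t) = edge_at \<epsilon> t"
proof -
  obtain a b t where z: "a \<in> corners" "b \<in> corners" "a \<noteq> b" "t \<in> {0..1}" "z = linepath a b t"
    using frontier_side[OF assms(2)] .
  show thesis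
  proof (cases "t \<in> {0<..<1}")
    case False
    then have "t = 0 \<or> t = 1" using z(4) by auto
    then have "z \<in> corners" using z by (auto simp: linepath_def)
    then show ?thesis using that by blast
  next
    case True
    obtain \<epsilon> where \<epsilon>: "\<epsilon> \<in> edges" "(\<forall>t\<in>{0..1}. face_at \<phi> (linepath a b t) = edge_at \<epsilon> t) \<or>
       (\<forall>t\<in>{0..1}. face_at \<phi> (linepath a b t) = edge_at \<epsilon> (1 - t))"
      using face_side[OF assms(1) z(1-3)] .
    from \<epsilon>(2) show ?thesis
    proof
      assume "\<forall>t\<in>{0..1}. face_at \<phi> (linepath a b t) = edge_at \<epsilon> t"
      then show ?thesis using that(2)[OF z(1-3) \<epsilon>(1) True z(5)] by blast
    next
      assume *: "\<forall>t\<in>{0..1}. face_at \<phi> (linepath a b t) = edge_at \<epsilon> (1 - t)"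
      have sw: "linepath b a s = linepath a b (1 - s)" for s
        by (simp add: linepath_def add.commute)
      have "face_at \<phi> (linepath b a s) = edge_at \<epsilon> s" if "s \<in> {0..1}" for s
        using bspec[OF *, of "1 - s"] that unfolding sw by simp
      moreover have "z = linepath b a (1 - t)" unfolding sw using z by simp
      moreover have "1 - t \<in> {0<..<1}" using True by simp
      ultimately show ?thesis using that(2)[OF z(2,1) _ \<epsilon>(1)] z(3) by metis
    qed
  qed
qed

lemma frontier_on_edge:
  assumes "\<phi> \<in> faces" "z \<in> frontier std_triangle"
  obtains \<epsilon> t where "\<epsilon> \<in> edges" "t \<in> {0..1}" "face_at \<phi> z = edge_at \<epsilon> t"
proof -
  obtain a b t where z: "a \<in> corners" "b \<in> corners" "a \<noteq> b" "t \<in> {0..1}" "z = linepath a b t"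
    using frontier_side[OF assms(2)] .
  obtain \<epsilon> where \<epsilon>: "\<epsilon> \<in> edges" "(\<forall>t\<in>{0..1}. face_at \<phi> (linepath a b t) = edge_at \<epsilon> t) \<or>
     (\<forall>t\<in>{0..1}. face_at \<phi> (linepath a b t) = edge_at \<epsilon> (1 - t))"
    using face_side[OF assms(1) z(1-3)] .
  then have "face_at \<phi> z = edge_at \<epsilon> t \<or> face_at \<phi> z = edge_at \<epsilon> (1 - t)" using z by blast
  moreover have "1 - t \<in> {0..1}" using z by simp
  ultimately show ?thesis using that z \<epsilon>(1) by blast
qed

text \<open>
  A triangle in the torus may have its corners and sides identified with each other, but its lift
  may not: the corners are different vertices by essentiality, so the sides are different lifted
  edges.
\<close>

lemma inj_face_at:
  assumes "\<phi> \<in> faces" shows "inj_on (face_at \<phi>) std_triangle"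
proof (rule inj_onI)
  fix z z' assume z: "z \<in> std_triangle" "z' \<in> std_triangle" and e: "face_at \<phi> z = face_at \<phi> z'"
  have int_fr: False if "x \<in> interior std_triangle" "y \<in> frontier std_triangle" "face_at \<phi> x = face_at \<phi> y" for x y
    using frontier_on_edge[OF assms that(2)] face_not_edge[OF assms that(1)] that(3) by metis
  have corner: "x = y" if x: "x \<in> corners" "y \<in> frontier std_triangle" "face_at \<phi> x = face_at \<phi> y" for x y
  proof (rule frontier_point_cases[OF assms x(2)])
    assume "y \<in> corners"
    then show ?thesis using face_corners_distinct assms x by blast
  next
    fix a b \<epsilon> t assume y: "\<epsilon> \<in> edges" "t \<in> {0<..<1}" "y = linepath a b t"
      "\<And>t. t \<in> {0..1} \<Longrightarrow> face_at \<phi> (linepath a b t) = edge_at \<epsilon> t"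
    obtain g where "face_at \<phi> x = deck g v0" using face_corner_vertex[OF assms x(1)] .
    moreover have "face_at \<phi> y = edge_at \<epsilon> t" unfolding y(3) using y(2) by (intro y(4)) simp
    ultimately show ?thesis using edge_not_vertex[OF y(1,2)] x(3) by metis
  qed
  have "z \<in> interior std_triangle \<or> z \<in> frontier std_triangle" "z' \<in> interior std_triangle \<or> z' \<in> frontier std_triangle"
    using z std_triangle_split by auto
  then consider "z \<in> interior std_triangle" "z' \<in> interior std_triangle"
    | "z \<in> frontier std_triangle" "z' \<in> frontier std_triangle"
    using int_fr e by metis
  then show "z = z'"
  proof cases
    case 1
    then show ?thesis using face_at_interior_eq[OF assms assms] e by blast
  next
    case 2
    show ?thesis
    proof (rule frontier_point_cases[OF assms 2(1)])
      assume "z \<in> corners" then show ?thesis using corner 2 e by blast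
    next
      fix a b \<epsilon> t assume 1: "a \<in> corners" "b \<in> corners" "\<epsilon> \<in> edges" "t \<in> {0<..<1}" "z = linepath a b t"
        "\<And>t. t \<in> {0..1} \<Longrightarrow> face_at \<phi> (linepath a b t) = edge_at \<epsilon> t"
      show ?thesis
      proof (rule frontier_point_cases[OF assms 2(2)])
        assume "z' \<in> corners" then show ?thesis using corner[of z' z] 2 e by auto
      next
        fix a' b' \<epsilon>' t' assume 2: "a' \<in> corners" "b' \<in> corners" "\<epsilon>' \<in> edges" "t' \<in> {0<..<1}" "z' = linepath a' b' t'"
          "\<And>t. t \<in> {0..1} \<Longrightarrow> face_at \<phi> (linepath a' b' t) = edge_at \<epsilon>' t"
        have "face_at \<phi> z = edge_at \<epsilon> t" "face_at \<phi> z' = edge_at \<epsilon>' t'"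
          unfolding 1(5) 2(5) using 1(4) 2(4) by (auto intro!: 1(6) 2(6))
        then have "edge_at \<epsilon> t = edge_at \<epsilon>' t'" using e by simp
        then have eq: "\<epsilon> = \<epsilon>'" "t = t'" using edge_at_open_eq[OF 1(3) 2(3) 1(4) 2(4)] by auto
        have "face_at \<phi> a = face_at \<phi> a'" "face_at \<phi> b = face_at \<phi> b'"
          using 1(6)[of 0] 2(6)[of 0] 1(6)[of 1] 2(6)[of 1] eq by (auto simp: linepath_def)
        then have "a = a'" "b = b'" using face_corners_distinct[OF assms] 1 2 by auto
        then show ?thesis using 1 2 eq by simp
      qed
    qed
  qed
qed

text \<open>
  A parametrisation of the triangle whose bottom side is the given edge with its own parameter. Such
  charts of two triangles at the same edge fit together.
\<close>

lemma face_chart: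
  assumes "\<phi> \<in> faces" "\<epsilon> \<in> edges" "t \<in> {0<..<1}" "edge_at \<epsilon> t \<in> face_at \<phi> ` std_triangle"
  obtains P where "continuous_on std_triangle P" "inj_on P std_triangle"
    "P ` std_triangle = face_at \<phi> ` std_triangle"
    "P ` interior std_triangle = face_at \<phi> ` interior std_triangle"
    "\<And>x. x \<in> {0..1} \<Longrightarrow> P (x, 0) = edge_at \<epsilon> x"
proof -
  obtain z where z: "z \<in> std_triangle" "face_at \<phi> z = edge_at \<epsilon> t" using assms(4) by auto
  have t: "t \<in> {0..1}" using assms(3) by auto
  have "z \<in> frontier std_triangle"
    using z face_not_edge[OF assms(1) _ assms(2) t] std_triangle_split by (metis Un_iff)
  then show thesis
  proof (rule frontier_point_cases[OF assms(1)])
    assume "z \<in> corners"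
    then obtain g where "face_at \<phi> z = deck g v0" using face_corner_vertex[OF assms(1)] by blast
    then show thesis using z edge_not_vertex[OF assms(2,3)] by metis
  next
    fix a b \<epsilon>' s assume 1: "a \<in> corners" "b \<in> corners" "a \<noteq> b" "\<epsilon>' \<in> edges" "s \<in> {0<..<1}" "z = linepath a b s"
        "\<And>t. t \<in> {0..1} \<Longrightarrow> face_at \<phi> (linepath a b t) = edge_at \<epsilon>' t"
    have "s \<in> {0..1}" using 1(5) by auto
    then have "edge_at \<epsilon>' s = edge_at \<epsilon> t" using 1(7) z(2) 1(6) by metis
    then have eq: "\<epsilon>' = \<epsilon>" using edge_at_open_eq[OF 1(4) assms(2) 1(5) assms(3)] by blast
    obtain A B :: "real \<times> real \<Rightarrow> real \<times> real" where A: "continuous_on UNIV A" "\<And>z. B (A z) = z" "\<And>z. A (B z) = z"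
      "A ` std_triangle = std_triangle" "A ` interior std_triangle = interior std_triangle"
      "\<And>x. A (x, 0) = linepath a b x"
      by (rule corner_symmetry[OF 1(1-3)]) blast
    show thesis
    proof (rule that[of "face_at \<phi> \<circ> A"])
      show "continuous_on std_triangle (face_at \<phi> \<circ> A)"
        using continuous_on_subset[OF A(1)] A(4) continuous_face_at[OF assms(1)]
        by (intro continuous_on_compose) auto
      have "inj_on A std_triangle" by (rule inj_on_inverseI[of _ B]) (simp add: A)
      then show "inj_on (face_at \<phi> \<circ> A) std_triangle"
        using inj_face_at[OF assms(1)] A(4) by (intro comp_inj_on) auto
      show "(face_at \<phi> \<circ> A) ` std_triangle = face_at \<phi> ` std_triangle"
        "(face_at \<phi> \<circ> A) ` interior std_triangle = face_at \<phi> ` interior std_triangle"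
        unfolding image_comp[symmetric] A(4,5) by simp_all
      show "(face_at \<phi> \<circ> A) (x, 0) = edge_at \<epsilon> x" if "x \<in> {0..1}" for x
        using 1(7)[OF that] eq by (simp add: A(6))
    qed
  qed
qed

lemma finite_faces_meeting:
  assumes "bounded Y" shows "finite {\<phi> \<in> faces. face_at \<phi> ` std_triangle \<inter> Y \<noteq> {}}"
  using finite_translated_family_meeting[OF finite_cells(2) _ assms, of "\<lambda>\<sigma>. triangle_lift \<sigma> ` std_triangle"]
    compact_imp_bounded[OF compact_continuous_image[OF triangle_lift(1) std_triangle_compact]]
  by (simp add: faces_def face_at_def image_image)

lemma finite_edges_meeting:
  assumes "bounded Y" shows "finite {\<epsilon> \<in> edges. edge_at \<epsilon> ` {0..1} \<inter> Y \<noteq> {}}"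
  using finite_translated_family_meeting[OF finite_cells(1) _ assms, of "\<lambda>\<gamma>. edge_lift \<gamma> ` {0..1}"]
    compact_imp_bounded[OF compact_continuous_image[OF edge_lift(1) compact_Icc]]
  by (simp add: edges_def edge_at_def image_image)

lemma plane_cell_cases:
  obtains g where "x = deck g v0"
  | \<epsilon> t where "\<epsilon> \<in> edges" "t \<in> {0<..<1}" "x = edge_at \<epsilon> t"
  | \<phi> z where "\<phi> \<in> faces" "z \<in> interior std_triangle" "x = face_at \<phi> z"
proof -
  have "cover x \<in> torus" by (rule cover_in_torus)
  then consider "cover x = v" | \<gamma> t where "\<gamma> \<in> E" "t \<in> {0<..<1}" "cover x = \<gamma> t"
    | \<sigma> z where "\<sigma> \<in> D" "z \<in> interior std_triangle" "cover x = \<sigma> z"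
    unfolding torus_cells by blast
  then show thesis
  proof cases
    case 1
    then show ?thesis using that(1) vertex_iff by blast
  next
    case 2
    then have "cover (edge_lift \<gamma> t) = cover x" using edge_lift(2)[of \<gamma> t] by simp
    then obtain g where "x = deck g (edge_lift \<gamma> t)" using cover_eq_iff by blast
    then show ?thesis using that(2)[of "(\<gamma>, g)" t] 2 by (simp add: edges_def edge_at_def)
  next
    case 3
    then have "cover (triangle_lift \<sigma> z) = cover x" using triangle_lift(2)[of \<sigma> z] interior_std_triangleD by simp
    then obtain g where "x = deck g (triangle_lift \<sigma> z)" using cover_eq_iff by blast
    then show ?thesis using that(3)[of "(\<sigma>, g)" z] 3 by (simp add: faces_def face_at_def)
  qed
qed

text \<open>
  By local finiteness the cells that do not contain the point keep a positive distance from it.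
\<close>

lemma edge_point_nbhd:
  assumes "\<epsilon> \<in> edges" "t \<in> {0<..<1}"
  obtains W where "open W" "edge_at \<epsilon> t \<in> W"
    "\<And>x. x \<in> W \<Longrightarrow> x \<in> edge_at \<epsilon> ` {0<..<1} \<or>
      (\<exists>\<phi> \<in> faces. edge_at \<epsilon> t \<in> face_at \<phi> ` std_triangle \<and> x \<in> face_at \<phi> ` std_triangle)"
proof -
  define p where "p = edge_at \<epsilon> t"
  define FF where "FF = {\<phi> \<in> faces. face_at \<phi> ` std_triangle \<inter> ball p 1 \<noteq> {}} \<inter> {\<phi>. p \<notin> face_at \<phi> ` std_triangle}"
  define EE where "EE = {\<epsilon> \<in> edges. edge_at \<epsilon> ` {0..1} \<inter> ball p 1 \<noteq> {}} - {\<epsilon>}"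
  define VV where "VV = {g. deck g ` {v0} \<inter> ball p 1 \<noteq> {}}"
  have fin: "finite FF" "finite EE" "finite VV"
    unfolding FF_def EE_def VV_def
    by (intro finite_Int disjI1 finite_faces_meeting bounded_ball,
        intro finite_Diff finite_edges_meeting bounded_ball,
        intro finite_translates_meeting bounded_ball finite_imp_bounded finite.intros)
  define C where "C = (\<Union>\<phi>\<in>FF. face_at \<phi> ` std_triangle) \<union> (\<Union>\<epsilon>\<in>EE. edge_at \<epsilon> ` {0..1}) \<union> (\<lambda>g. deck g v0) ` VV"
  have "closed C"
    unfolding C_def
  proof (intro closed_Un closed_UN fin ballI)
    show "closed (face_at \<phi> ` std_triangle)" if "\<phi> \<in> FF" for \<phi>
      using that by (intro compact_imp_closed compact_continuous_image continuous_face_at std_triangle_compact)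
        (simp add: FF_def)
    show "closed (edge_at \<epsilon> ` {0..1})" if "\<epsilon> \<in> EE" for \<epsilon>
      using that by (intro compact_imp_closed compact_continuous_image continuous_edge_at compact_Icc)
        (simp add: EE_def)
    show "closed ((\<lambda>g. deck g v0) ` VV)" using fin by (intro finite_imp_closed) simp
  qed
  moreover have "p \<notin> C"
  proof
    assume "p \<in> C"
    then consider "p \<in> (\<Union>\<epsilon>\<in>EE. edge_at \<epsilon> ` {0..1})" | "p \<in> (\<lambda>g. deck g v0) ` VV"
      unfolding C_def FF_def by blast
    then show False
    proof cases
      case 1
      then obtain \<epsilon>' s where s: "\<epsilon>' \<in> edges" "\<epsilon>' \<noteq> \<epsilon>" "s \<in> {0..1}" "edge_at \<epsilon>' s = p"
        unfolding EE_def by blast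
      obtain g h where gh: "edge_at \<epsilon>' 0 = deck g v0" "edge_at \<epsilon>' 1 = deck h v0" using edge_ends[OF s(1)] .
      have "s = 0 \<or> s = 1 \<or> s \<in> {0<..<1}" using s(3) by auto
      then show False
        using s gh edge_not_vertex[OF assms] edge_at_open_eq[OF s(1) assms(1) _ assms(2)] unfolding p_def by metis
    next
      case 2
      then show False using edge_not_vertex[OF assms] unfolding p_def by blast
    qed
  qed
  ultimately have W: "open (ball p 1 - C)" "p \<in> ball p 1 - C" by auto
  show thesis
  proof (rule that[of "ball p 1 - C"])
    show "open (ball p 1 - C)" "edge_at \<epsilon> t \<in> ball p 1 - C" using W by (auto simp: p_def)
    fix x assume x: "x \<in> ball p 1 - C"
    show "x \<in> edge_at \<epsilon> ` {0<..<1} \<or>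
      (\<exists>\<phi> \<in> faces. edge_at \<epsilon> t \<in> face_at \<phi> ` std_triangle \<and> x \<in> face_at \<phi> ` std_triangle)"
    proof (rule plane_cell_cases[of x])
      fix g assume "x = deck g v0"
      then have "x \<in> (\<lambda>g. deck g v0) ` VV" using x unfolding VV_def by blast
      then show ?thesis using x unfolding C_def by blast
    next
      fix \<epsilon>' s assume s: "\<epsilon>' \<in> edges" "s \<in> {0<..<1}" "x = edge_at \<epsilon>' s"
      have m: "x \<in> edge_at \<epsilon>' ` {0..1}" using s by auto
      then have "\<epsilon>' \<in> EE \<or> \<epsilon>' = \<epsilon>" using x s unfolding EE_def by blast
      then have "\<epsilon>' = \<epsilon>" using x m unfolding C_def by blast
      then show ?thesis using s by blast
    next
      fix \<phi> z assume z: "\<phi> \<in> faces" "z \<in> interior std_triangle" "x = face_at \<phi> z"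
      have m: "x \<in> face_at \<phi> ` std_triangle" using z interior_std_triangleD by blast
      then have "p \<in> face_at \<phi> ` std_triangle"
        using x z unfolding C_def FF_def by blast
      then show ?thesis using z m unfolding p_def by blast
    qed
  qed
qed

text \<open>
  If only one triangle contained the point, then a neighbourhood of the point would consist of points
  of this triangle, and the inverse of a chart would map it injectively into \<open>std_triangle\<close>, with the
  point going to the bottom side. By invariance of domain the image is open, so the bottom side would
  contain an interior point of \<open>std_triangle\<close>. If there were no triangle at all, the neighbourhood
  would lie on the edge, and the parameter of the edge would give the same contradiction.
\<close>

lemma at_least_two_faces:
  assumes "\<epsilon> \<in> edges" "t \<in> {0<..<1}"
  obtains \<phi>\<^sub>1 \<phi>\<^sub>2 where "\<phi>\<^sub>1 \<in> faces" "\<phi>\<^sub>2 \<in> faces" "\<phi>\<^sub>1 \<noteq> \<phi>\<^sub>2"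
    "edge_at \<epsilon> t \<in> face_at \<phi>\<^sub>1 ` std_triangle" "edge_at \<epsilon> t \<in> face_at \<phi>\<^sub>2 ` std_triangle"
proof -
  define N where "N = {\<phi> \<in> faces. edge_at \<epsilon> t \<in> face_at \<phi> ` std_triangle}"
  have t: "t \<in> {0..1}" using assms by auto
  obtain W where W: "open W" "edge_at \<epsilon> t \<in> W"
    and Wsub: "\<And>x. x \<in> W \<Longrightarrow> x \<in> edge_at \<epsilon> ` {0<..<1} \<or> (\<exists>\<phi> \<in> N. x \<in> face_at \<phi> ` std_triangle)"
    using edge_point_nbhd[OF assms] unfolding N_def by (metis (no_types, lifting) mem_Collect_eq)
  have key: False if Q: "continuous_on W Q" "inj_on Q W" "Q ` W \<subseteq> std_triangle" "Q (edge_at \<epsilon> t) = (t, 0)" for Q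
  proof -
    have "open (Q ` W)" by (rule invariance_of_domain[OF Q(1) W(1) Q(2)])
    then have "Q ` W \<subseteq> interior std_triangle" using Q(3) by (intro interior_maximal)
    then have "(t, 0) \<in> interior std_triangle" using W(2) Q(4) by (metis image_eqI subsetD)
    then show False by (simp add: interior_std_triangle_eq)
  qed
  have "N \<noteq> {}"
  proof
    assume "N = {}"
    then have sub: "W \<subseteq> edge_at \<epsilon> ` {0..1}" using Wsub by fastforce
    define q where "q = the_inv_into {0..1} (edge_at \<epsilon>)"
    have inv: "q (edge_at \<epsilon> s) = s" if "s \<in> {0..1}" for s
      unfolding q_def using inj_edge_at[OF assms(1)] that by (rule the_inv_into_f_f)
    have cq: "continuous_on (edge_at \<epsilon> ` {0..1}) q"
      by (rule continuous_on_inv[OF continuous_edge_at[OF assms(1)] compact_Icc]) (simp add: inv)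
    show False
    proof (rule key[of "\<lambda>x. (q x, 0)"])
      show "continuous_on W (\<lambda>x. (q x, 0::real))"
        by (intro continuous_intros continuous_on_subset[OF cq sub])
      show "inj_on (\<lambda>x. (q x, 0::real)) W"
      proof (rule inj_onI)
        fix x y assume "x \<in> W" "y \<in> W" "(q x, 0::real) = (q y, 0)"
        moreover from this obtain s r where "x = edge_at \<epsilon> s" "y = edge_at \<epsilon> r" "s \<in> {0..1}" "r \<in> {0..1}"
          using sub by blast
        ultimately show "x = y" using inv by simp
      qed
      show "(\<lambda>x. (q x, 0::real)) ` W \<subseteq> std_triangle"
      proof
        fix w assume "w \<in> (\<lambda>x. (q x, 0::real)) ` W"
        then obtain s where "w = (q (edge_at \<epsilon> s), 0)" "s \<in> {0..1}" using sub by blast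
        then show "w \<in> std_triangle" using inv by (simp add: std_triangle_eq)
      qed
      show "(q (edge_at \<epsilon> t), 0) = (t, 0)" using inv[OF t] by simp
    qed
  qed
  then obtain \<phi> where \<phi>: "\<phi> \<in> faces" "edge_at \<epsilon> t \<in> face_at \<phi> ` std_triangle" "\<phi> \<in> N" unfolding N_def by blast
  have "\<not> N \<subseteq> {\<phi>}"
  proof
    assume N: "N \<subseteq> {\<phi>}"
    obtain P where P: "continuous_on std_triangle P" "inj_on P std_triangle"
      "P ` std_triangle = face_at \<phi> ` std_triangle"
      "\<And>x. x \<in> {0..1} \<Longrightarrow> P (x, 0) = edge_at \<epsilon> x"
      by (rule face_chart[OF \<phi>(1) assms \<phi>(2)]) blast
    have base: "(x, 0) \<in> std_triangle" if "x \<in> {0..1}" for x :: real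
      using that by (simp add: std_triangle_eq)
    have "edge_at \<epsilon> x \<in> P ` std_triangle" if "x \<in> {0<..<1}" for x
      using P(4)[of x] base[of x] that by (metis greaterThanLessThan_subseteq_atLeastAtMost_iff image_eqI order_refl subsetD)
    then have sub: "W \<subseteq> P ` std_triangle" using Wsub N P(3) by blast
    define q where "q = the_inv_into std_triangle P"
    have inv: "q (P z) = z" if "z \<in> std_triangle" for z
      unfolding q_def using P(2) that by (rule the_inv_into_f_f)
    have cq: "continuous_on (P ` std_triangle) q"
      by (rule continuous_on_inv[OF P(1) std_triangle_compact]) (simp add: inv)
    show False
    proof (rule key[of q])
      show "continuous_on W q" by (rule continuous_on_subset[OF cq sub])
      show "inj_on q W"
      proof (rule inj_onI)
        fix x y assume "x \<in> W" "y \<in> W" "q x = q y"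
        moreover from this obtain z w where "x = P z" "y = P w" "z \<in> std_triangle" "w \<in> std_triangle"
          using sub by blast
        ultimately show "x = y" using inv by simp
      qed
      show "q ` W \<subseteq> std_triangle" using sub inv by fastforce
      show "q (edge_at \<epsilon> t) = (t, 0)" using inv[OF base[OF t]] P(4)[OF t] by simp
    qed
  qed
  then obtain \<phi>' where "\<phi>' \<in> N" "\<phi>' \<noteq> \<phi>" by blast
  then show thesis using that[of \<phi> \<phi>'] \<phi> unfolding N_def by blast
qed

text \<open>
  Charts of two triangles, glued along their bottom sides, map an open double triangle injectively to
  the plane. By invariance of domain the image is a neighbourhood of the point. A third triangle at
  the point would have interior points in it, but interior points of a triangle lie in no other cell.
\<close>

lemma at_most_two_faces:
  assumes \<epsilon>: "\<epsilon> \<in> edges" "t \<in> {0<..<1}"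
    and faces: "\<phi>\<^sub>1 \<in> faces" "\<phi>\<^sub>2 \<in> faces" "\<phi>\<^sub>3 \<in> faces" and ne: "\<phi>\<^sub>1 \<noteq> \<phi>\<^sub>2"
    and on: "edge_at \<epsilon> t \<in> face_at \<phi>\<^sub>1 ` std_triangle" "edge_at \<epsilon> t \<in> face_at \<phi>\<^sub>2 ` std_triangle"
      "edge_at \<epsilon> t \<in> face_at \<phi>\<^sub>3 ` std_triangle"
  shows "\<phi>\<^sub>3 = \<phi>\<^sub>1 \<or> \<phi>\<^sub>3 = \<phi>\<^sub>2"
proof -
  obtain P1 where P1: "continuous_on std_triangle P1" "inj_on P1 std_triangle"
    "P1 ` std_triangle = face_at \<phi>\<^sub>1 ` std_triangle" "P1 ` interior std_triangle = face_at \<phi>\<^sub>1 ` interior std_triangle"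
    "\<And>x. x \<in> {0..1} \<Longrightarrow> P1 (x, 0) = edge_at \<epsilon> x"
    by (rule face_chart[OF faces(1) \<epsilon> on(1)]) blast
  obtain P2 where P2: "continuous_on std_triangle P2" "inj_on P2 std_triangle"
    "P2 ` std_triangle = face_at \<phi>\<^sub>2 ` std_triangle" "P2 ` interior std_triangle = face_at \<phi>\<^sub>2 ` interior std_triangle"
    "\<And>x. x \<in> {0..1} \<Longrightarrow> P2 (x, 0) = edge_at \<epsilon> x"
    by (rule face_chart[OF faces(2) \<epsilon> on(2)]) blast
  obtain P3 where P3: "continuous_on std_triangle P3" "inj_on P3 std_triangle"
    "P3 ` std_triangle = face_at \<phi>\<^sub>3 ` std_triangle" "P3 ` interior std_triangle = face_at \<phi>\<^sub>3 ` interior std_triangle"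
    "\<And>x. x \<in> {0..1} \<Longrightarrow> P3 (x, 0) = edge_at \<epsilon> x"
    by (rule face_chart[OF faces(3) \<epsilon> on(3)]) blast
  define \<Omega> :: "(real \<times> real) set" where "\<Omega> = {w. 0 < fst w \<and> fst w + \<bar>snd w\<bar> < 1}"
  \<comment> \<open>the lower half is reflected before the second chart is applied\<close>
  define H where "H w = (if snd w \<le> 0 then P2 (fst w, - snd w) else P1 w)" for w
  have open_\<Omega>: "open \<Omega>"
    unfolding \<Omega>_def by (intro open_Collect_conj open_Collect_less continuous_intros)
  have cont_H: "continuous_on \<Omega> H"
    unfolding H_def
  proof (rule continuous_on_cases_le)
    show "continuous_on {w \<in> \<Omega>. snd w \<le> 0} (\<lambda>w. P2 (fst w, - snd w))"
      by (rule continuous_on_compose2[OF P2(1)])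
        (auto simp: \<Omega>_def std_triangle_eq intro!: continuous_intros)
    show "continuous_on {w \<in> \<Omega>. 0 \<le> snd w} P1"
      by (rule continuous_on_subset[OF P1(1)]) (auto simp: \<Omega>_def std_triangle_eq)
    show "P2 (fst w, - snd w) = P1 w" if "w \<in> \<Omega>" "snd w = 0" for w
      using that P1(5)[of "fst w"] P2(5)[of "fst w"] by (cases w) (auto simp: \<Omega>_def)
  qed (intro continuous_intros)
  have up: "H w \<in> face_at \<phi>\<^sub>1 ` interior std_triangle \<and> w \<in> interior std_triangle \<and> H w = P1 w"
    if "w \<in> \<Omega>" "0 < snd w" for w
  proof -
    have w: "w \<in> interior std_triangle" using that by (auto simp: \<Omega>_def interior_std_triangle_eq)
    then show ?thesis using P1(4) that by (auto simp: H_def)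
  qed
  have down: "H w \<in> face_at \<phi>\<^sub>2 ` interior std_triangle \<and> (fst w, - snd w) \<in> interior std_triangle \<and> H w = P2 (fst w, - snd w)"
    if "w \<in> \<Omega>" "snd w < 0" for w
  proof -
    have w: "(fst w, - snd w) \<in> interior std_triangle" using that by (auto simp: \<Omega>_def interior_std_triangle_eq)
    then show ?thesis using P2(4) that by (auto simp: H_def)
  qed
  have mid: "H w = edge_at \<epsilon> (fst w) \<and> fst w \<in> {0..1}" if "w \<in> \<Omega>" "snd w = 0" for w
    using that P2(5)[of "fst w"] by (auto simp: \<Omega>_def H_def)
  have edge_int: False if "y \<in> face_at \<phi> ` interior std_triangle" "y = edge_at \<epsilon> s" "s \<in> {0..1}" "\<phi> \<in> faces" for y \<phi> s
    using face_not_edge[OF that(4) _ \<epsilon>(1) that(3)] that(1,2) by blast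
  have int_int: "\<phi> = \<phi>'" if "y \<in> face_at \<phi> ` interior std_triangle" "y \<in> face_at \<phi>' ` interior std_triangle"
    "\<phi> \<in> faces" "\<phi>' \<in> faces" for y \<phi> \<phi>'
    using face_at_interior_eq[OF that(3,4)] that(1,2) by blast
  have "inj_on H \<Omega>"
  proof (rule inj_onI)
    fix w w' assume w: "w \<in> \<Omega>" "w' \<in> \<Omega>" "H w = H w'"
    consider "snd w > 0" "snd w' > 0" | "snd w < 0" "snd w' < 0" | "snd w = 0" "snd w' = 0"
      using up[OF w(1)] up[OF w(2)] down[OF w(1)] down[OF w(2)] mid[OF w(1)] mid[OF w(2)]
        int_int[of "H w" \<phi>\<^sub>1 \<phi>\<^sub>2] ne faces edge_int[of "H w" _ "fst w"] edge_int[of "H w" _ "fst w'"] w(3)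
      by (metis linorder_neqE_linordered_idom)
    then show "w = w'"
    proof cases
      case 1
      then show ?thesis using up[OF w(1)] up[OF w(2)] w(3) inj_onD[OF P1(2)] interior_std_triangleD by metis
    next
      case 2
      then have "(fst w, - snd w) = (fst w', - snd w')"
        using down[OF w(1)] down[OF w(2)] w(3) inj_onD[OF P2(2)] interior_std_triangleD by metis
      then show ?thesis by (simp add: prod_eq_iff)
    next
      case 3
      then have "fst w = fst w'"
        using mid[OF w(1)] mid[OF w(2)] w(3) inj_onD[OF inj_edge_at[OF \<epsilon>(1)]] by metis
      then show ?thesis using 3 by (simp add: prod_eq_iff)
    qed
  qed
  then have open_H: "open (H ` \<Omega>)" by (rule invariance_of_domain[OF cont_H open_\<Omega>])
  have "(t, 0) \<in> \<Omega>" using \<epsilon>(2) by (auto simp: \<Omega>_def)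
  moreover have "H (t, 0) = edge_at \<epsilon> t" using mid[OF calculation] by simp
  ultimately have in_H: "P3 (t, 0) \<in> H ` \<Omega>" using P3(5)[of t] \<epsilon>(2) by force
  have base: "(t, 0) \<in> std_triangle" using \<epsilon>(2) by (auto simp: std_triangle_eq)
  obtain d where d: "d > 0" "\<And>z. z \<in> std_triangle \<Longrightarrow> dist z (t, 0) < d \<Longrightarrow> P3 z \<in> H ` \<Omega>"
  proof -
    obtain e where e: "e > 0" "ball (P3 (t, 0)) e \<subseteq> H ` \<Omega>" using open_H in_H open_contains_ball by blast
    obtain d where "d > 0" "\<And>z. z \<in> std_triangle \<Longrightarrow> dist z (t, 0) < d \<Longrightarrow> dist (P3 z) (P3 (t, 0)) < e"
      using P3(1) base e(1) unfolding continuous_on_iff by metis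
    then show thesis using that[of d] e(2) by (auto simp: dist_commute subset_iff)
  qed
  \<comment> \<open>a point of the third triangle, just above the common edge point in its own chart\<close>
  define r where "r = min (d / 2) ((1 - t) / 2)"
  have r: "r > 0" "r < d" "t + r < 1" using d(1) \<epsilon>(2) by (auto simp: r_def min_def field_simps)
  have ri: "(t, r) \<in> interior std_triangle" using r \<epsilon>(2) by (auto simp: interior_std_triangle_eq)
  have "dist (t, r) (t, 0) < d" using r by (simp add: dist_Pair_Pair)
  then obtain w where w: "w \<in> \<Omega>" "P3 (t, r) = H w" using d(2) ri interior_std_triangleD by blast
  have y: "H w \<in> face_at \<phi>\<^sub>3 ` interior std_triangle" using P3(4) ri w(2) by (metis imageI)
  consider "snd w > 0" | "snd w < 0" | "snd w = 0" by linarith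
  then show ?thesis
  proof cases
    case 1
    then show ?thesis using up[OF w(1)] int_int[OF y _ faces(3,1)] by blast
  next
    case 2
    then show ?thesis using down[OF w(1)] int_int[OF y _ faces(3,2)] by blast
  next
    case 3
    then show ?thesis using mid[OF w(1)] edge_int[OF y _ _ faces(3)] by blast
  qed
qed

text \<open>
  Every vertex is an end of some edge, and every edge belongs to a triangle.
\<close>

lemma faces_cover_plane: obtains \<phi> where "\<phi> \<in> faces" "x \<in> face_at \<phi> ` std_triangle"
proof (rule plane_cell_cases[of x])
  fix \<epsilon> t assume "\<epsilon> \<in> edges" "t \<in> {0<..<1}" "x = edge_at \<epsilon> t"
  then show thesis using at_least_two_faces that by metis
next
  fix \<phi> z assume "\<phi> \<in> faces" "z \<in> interior std_triangle" "x = face_at \<phi> z"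
  then show thesis using that interior_std_triangleD by blast
next
  fix g assume g: "x = deck g v0"
  have "E \<noteq> {}"
  proof
    assume "E = {}"
    then have "D = {}"
    proof -
      have c: "(0,0) \<in> corners" "(1,0) \<in> corners" "(0::real,0::real) \<noteq> (1,0)"
        by (simp_all add: corners_def)
      show ?thesis using triangle_side[OF _ c] \<open>E = {}\<close> by blast
    qed
    then have "torus = {v}" using torus_cells \<open>E = {}\<close> by simp
    then have "cover (0,0) = cover (1/2,0)" using cover_in_torus by (metis singletonD)
    then obtain h where "(1/2, 0) = deck h (0,0)" unfolding cover_eq_iff by blast
    then have "1/2 = real_of_int (fst h)" by (simp add: deck_def prod_eq_iff)
    then have "1 = real_of_int (2 * fst h)" by simp
    then have "1 = 2 * fst h" by (metis of_int_1 of_int_eq_iff)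
    then show False by presburger
  qed
  then obtain \<gamma> where "\<gamma> \<in> E" by blast
  then have "(\<gamma>, 0) \<in> edges" by (simp add: edges_def)
  then obtain h where h: "edge_at (\<gamma>, 0) 0 = deck h v0" using edge_ends by metis
  define \<epsilon> where "\<epsilon> = (\<gamma>, g - h)"
  have \<epsilon>: "\<epsilon> \<in> edges" using \<open>\<gamma> \<in> E\<close> by (simp add: edges_def \<epsilon>_def)
  have "edge_at \<epsilon> 0 = deck (g - h) (edge_at (\<gamma>, 0) 0)" by (simp add: \<epsilon>_def)
  then have x: "x = edge_at \<epsilon> 0" using g h by simp
  have half: "1/2 \<in> {0<..<1::real}" by simp
  obtain \<phi> where \<phi>: "\<phi> \<in> faces" "edge_at \<epsilon> (1/2) \<in> face_at \<phi> ` std_triangle"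
    by (rule at_least_two_faces[OF \<epsilon> half]) blast
  obtain P where "P ` std_triangle = face_at \<phi> ` std_triangle" "\<And>x. x \<in> {0..1} \<Longrightarrow> P (x, 0) = edge_at \<epsilon> x"
    by (rule face_chart[OF \<phi>(1) \<epsilon> half \<phi>(2)]) blast
  moreover have "(0, 0) \<in> std_triangle" by (simp add: std_triangle_eq)
  ultimately have "x \<in> face_at \<phi> ` std_triangle" unfolding x by (metis atLeastAtMost_iff image_eqI order_refl zero_le_one)
  then show thesis using that \<phi> by blast
qed

end

section \<open>Functions on a triangle with straight level sets\<close>

text \<open>
  A continuous map from a compact space onto a Hausdorff space is a quotient map.
\<close>

lemma continuous_on_compact_quotient:
  fixes \<pi> :: "'a::t2_space \<Rightarrow> 'b::t2_space" and f :: "'b \<Rightarrow> real"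
  assumes "compact K" "continuous_on K \<pi>" "continuous_on K (\<lambda>x. f (\<pi> x))"
  shows "continuous_on (\<pi> ` K) f"
proof -
  have cl: "closed (\<pi> ` K)" by (intro compact_imp_closed compact_continuous_image assms)
  have "closed (f -` B \<inter> \<pi> ` K)" if "closed B" for B
  proof -
    have "closed ((\<lambda>x. f (\<pi> x)) -` B \<inter> K)"
      using assms(3) compact_imp_closed[OF assms(1)] that by (metis continuous_on_closed_vimage)
    then have "compact (K \<inter> (K \<inter> (\<lambda>x. f (\<pi> x)) -` B))"
      using assms(1) by (intro compact_Int_closed) (auto simp: Int_commute)
    then have "compact (\<pi> ` (K \<inter> (K \<inter> (\<lambda>x. f (\<pi> x)) -` B)))"
      by (intro compact_continuous_image continuous_on_subset[OF assms(2)]) auto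
    moreover have "\<pi> ` (K \<inter> (K \<inter> (\<lambda>x. f (\<pi> x)) -` B)) = f -` B \<inter> \<pi> ` K" by auto
    ultimately show ?thesis using compact_imp_closed by metis
  qed
  then show ?thesis using continuous_on_closed_vimage[OF cl] by blast
qed

text \<open>
  The triples of two points of \<open>K\<close> at equal height and a parameter in the unit interval form a compact
  space, which \<open>\<pi>\<close> maps onto \<open>S\<close> by taking points of the chord between the two. On this space the
  function becomes the height of the first point, which is continuous.
\<close>

lemma continuous_if_level_sets_are_chords:
  fixes f :: "real \<times> real \<Rightarrow> real"
  assumes K: "compact K" "K \<subseteq> S" "convex S" and cont: "continuous_on K f"
    and chord: "\<And>z. z \<in> S \<Longrightarrow> \<exists>a\<in>K. \<exists>b\<in>K. {w \<in> S. f w = f z} = closed_segment a b"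
  shows "continuous_on S f"
proof -
  define X where "X = (K \<times> K \<times> {0..1::real}) \<inter> (\<lambda>x. f (fst x) - f (fst (snd x))) -` {0}"
  define \<pi> where "\<pi> x = linepath (fst x) (fst (snd x)) (snd (snd x))" for x :: "(real \<times> real) \<times> (real \<times> real) \<times> real"
  let ?B = "K \<times> K \<times> {0..1::real}"
  have cB: "compact ?B" by (intro compact_Times K compact_Icc)
  have c1: "continuous_on ?B (\<lambda>x. f (fst x))" "continuous_on ?B (\<lambda>x. f (fst (snd x)))"
    by (rule continuous_on_compose2[OF cont]; auto intro!: continuous_intros)+
  have "closed X"
    unfolding X_def using cB by (intro continuous_closed_preimage continuous_on_diff c1 compact_imp_closed) auto
  moreover have "X \<subseteq> ?B" by (auto simp: X_def)
  ultimately have cX: "compact X" using cB by (metis compact_Int_closed inf.absorb2)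
  have const: "f (\<pi> x) = f (fst x)" "\<pi> x \<in> S" if "x \<in> X" for x
  proof -
    have x: "fst x \<in> K" "fst (snd x) \<in> K" "snd (snd x) \<in> {0..1}" "f (fst x) = f (fst (snd x))"
      using that by (auto simp: X_def)
    then obtain a b where ab: "{w \<in> S. f w = f (fst x)} = closed_segment a b" using chord K(2) by blast
    have "fst x \<in> closed_segment a b" "fst (snd x) \<in> closed_segment a b"
      using x K(2) unfolding ab[symmetric] by auto
    then have "closed_segment (fst x) (fst (snd x)) \<subseteq> closed_segment a b"
      by (simp add: subset_closed_segment)
    moreover have "\<pi> x \<in> closed_segment (fst x) (fst (snd x))"
      unfolding \<pi>_def using x(3) by (metis linepath_in_path path_image_linepath)
    ultimately show "f (\<pi> x) = f (fst x)" "\<pi> x \<in> S" using ab by blast+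
  qed
  have "continuous_on X (\<lambda>x. f (\<pi> x))"
    by (rule continuous_on_eq[OF continuous_on_subset[OF c1(1) \<open>X \<subseteq> ?B\<close>]]) (simp add: const)
  moreover have "continuous_on X \<pi>"
    unfolding \<pi>_def linepath_def by (intro continuous_intros)
  ultimately have "continuous_on (\<pi> ` X) f" by (intro continuous_on_compact_quotient cX)
  moreover have "\<pi> ` X = S"
  proof
    show "\<pi> ` X \<subseteq> S" using const by blast
    show "S \<subseteq> \<pi> ` X"
    proof
      fix z assume z: "z \<in> S"
      then obtain a b where ab: "a \<in> K" "b \<in> K" "{w \<in> S. f w = f z} = closed_segment a b" using chord by blast
      have "a \<in> {w \<in> S. f w = f z}" "b \<in> {w \<in> S. f w = f z}"
        unfolding ab(3) by simp_all
      then have fa: "f a = f b" by simp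
      have "z \<in> {w \<in> S. f w = f z}" using z by simp
      then have "z \<in> linepath a b ` {0..1}"
        unfolding ab(3) by (simp add: linepath_image_01)
      then obtain t where t: "t \<in> {0..1}" "z = linepath a b t" by blast
      have "(a, b, t) \<in> X" using ab(1,2) t fa by (simp add: X_def)
      moreover have "z = \<pi> (a, b, t)" by (simp add: \<pi>_def t)
      ultimately show "z \<in> \<pi> ` X" by blast
    qed
  qed
  ultimately show ?thesis by simp
qed

text \<open>
  Rising or falling: \<open>F\<close> may do either along an edge with its given parameter, and a side of a
  triangle may be attached to an edge in either direction.
\<close>

definition unit_monotone :: "(real \<Rightarrow> real) \<Rightarrow> bool" where
  "unit_monotone f \<longleftrightarrow> continuous_on {0..1} f \<and>
     (strict_mono_on {0..1} f \<or> strict_mono_on {0..1} (\<lambda>t. - f t))"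

lemma unit_monotone_cong:
  assumes "unit_monotone f" "\<And>t. t \<in> {0..1} \<Longrightarrow> f t = g t" shows "unit_monotone g"
proof -
  have "continuous_on {0..1} g"
    by (rule continuous_on_eq[of _ f]) (use assms in \<open>simp_all add: unit_monotone_def\<close>)
  then show ?thesis using assms unfolding unit_monotone_def strict_mono_on_def by fastforce
qed

lemma unit_monotone_reverse:
  assumes "unit_monotone f" shows "unit_monotone (\<lambda>t. f (1 - t))"
proof -
  have "continuous_on {0..1} (\<lambda>t. f (1 - t))"
    by (rule continuous_on_compose2[of "{0..1}" f]) (use assms in \<open>auto simp: unit_monotone_def intro!: continuous_intros\<close>)
  moreover have "strict_mono_on {0..1} (\<lambda>t. - f (1 - t))" if "strict_mono_on {0..1} f"
    using that unfolding strict_mono_on_def by auto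
  moreover have "strict_mono_on {0..1} (\<lambda>t. f (1 - t))" if "strict_mono_on {0..1} (\<lambda>t. - f t)"
    using that unfolding strict_mono_on_def by auto
  ultimately show ?thesis using assms unfolding unit_monotone_def by blast
qed

lemma unit_monotone_eq:
  assumes "unit_monotone f" "s \<in> {0..1}" "t \<in> {0..1}" "f s = f t" shows "s = t"
  using assms unfolding unit_monotone_def strict_mono_on_def
  by (metis less_irrefl linorder_neqE_linordered_idom neg_less_iff_less)

lemma unit_monotone_avoids:
  assumes "unit_monotone f" "(f 0 - l) * (f 1 - l) > 0" "t \<in> {0..1}" shows "f t \<noteq> l"
proof -
  have "(f 0 \<le> f t \<and> f t \<le> f 1) \<or> (f 1 \<le> f t \<and> f t \<le> f 0)"
  proof (cases "t = 0 \<or> t = 1")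
    case True
    then show ?thesis using assms(1) unfolding unit_monotone_def strict_mono_on_def
      by (metis atLeastAtMost_iff less_imp_le neg_less_iff_less order_refl zero_le_one zero_less_one)
  next
    case False
    then have "0 < t" "t < 1" using assms(3) by auto
    then show ?thesis using assms(1,3) unfolding unit_monotone_def strict_mono_on_def
      by (metis atLeastAtMost_iff less_imp_le neg_less_iff_less order_refl zero_le_one)
  qed
  then show ?thesis using assms(2) by (auto simp: zero_less_mult_iff)
qed

lemma unit_monotone_crosses:
  assumes "unit_monotone f" "(f 0 - l) * (f 1 - l) < 0"
  obtains t where "t \<in> {0<..<1}" "f t = l" "\<And>s. s \<in> {0..1} \<Longrightarrow> f s = l \<Longrightarrow> s = t"
proof -
  have c: "continuous_on {0..1} f" using assms by (simp add: unit_monotone_def)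
  have "\<exists>t. 0 \<le> t \<and> t \<le> 1 \<and> f t = l"
  proof (cases "f 0 \<le> l \<and> l \<le> f 1")
    case True
    then show ?thesis using IVT'[of f 0 l 1] c by auto
  next
    case False
    then have "f 1 \<le> l \<and> l \<le> f 0" using assms(2) by (auto simp: mult_less_0_iff)
    then show ?thesis using IVT2'[of f 1 l 0] c by auto
  qed
  then obtain t where t: "t \<in> {0..1}" "f t = l" by auto
  moreover have "t \<noteq> 0" "t \<noteq> 1" using t assms(2) by auto
  ultimately show ?thesis using unit_monotone_eq[OF assms(1)] by (intro that[of t]) auto
qed

text \<open>
  The height \<open>l\<close> separates one corner from the two others. So it occurs exactly once on each of the two
  sides at this corner, at an inner point, and not on the third side.
\<close>

lemma level_chord_of_triangle:
  fixes f :: "real \<times> real \<Rightarrow> real"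
  assumes sides: "\<And>a b. a \<in> corners \<Longrightarrow> b \<in> corners \<Longrightarrow> a \<noteq> b \<Longrightarrow> unit_monotone (\<lambda>t. f (linepath a b t))"
    and chord: "a \<in> frontier std_triangle" "b \<in> frontier std_triangle"
      "{z \<in> std_triangle. f z = l} = closed_segment a b"
    and corner: "\<And>a. a \<in> corners \<Longrightarrow> f a \<noteq> l"
  obtains p p' where "p \<noteq> p'" "{z \<in> std_triangle. f z = l} = closed_segment p p'"
    "closed_segment p p' \<inter> frontier std_triangle = {p, p'}"
proof -
  have la: "f a = l" using chord by auto
  obtain u w t where u: "u \<in> corners" "w \<in> corners" "u \<noteq> w" "t \<in> {0..1}" "a = linepath u w t"
    using frontier_side[OF chord(1)] .
  have "\<not> (f u - l) * (f w - l) > 0"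
    using unit_monotone_avoids[OF sides[OF u(1-3)], of l t] u la by (auto simp: linepath_def)
  then have opp: "(f u - l) * (f w - l) < 0"
    using corner[OF u(1)] corner[OF u(2)] by (auto simp: not_less zero_less_mult_iff mult_le_0_iff mult_less_0_iff)
  have "\<exists>x\<in>corners. x \<noteq> u \<and> x \<noteq> w \<and> corners = {u, w, x}"
    using u(1-3) by (auto simp: corners_def)
  then obtain x where x: "x \<in> corners" "x \<noteq> u" "x \<noteq> w" "corners = {u, w, x}" by blast
  have "(f x - l) * (f u - l) < 0 \<and> (f x - l) * (f w - l) > 0 \<or> (f x - l) * (f w - l) < 0 \<and> (f x - l) * (f u - l) > 0"
    using opp corner[OF x(1)] by (auto simp: zero_less_mult_iff mult_less_0_iff)
  then obtain A B C where ABC: "corners = {A, B, C}" "A \<noteq> B" "A \<noteq> C" "B \<noteq> C"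
    "(f A - l) * (f B - l) < 0" "(f A - l) * (f C - l) < 0" "(f B - l) * (f C - l) > 0"
  proof
    assume "(f x - l) * (f u - l) < 0 \<and> (f x - l) * (f w - l) > 0"
    then show thesis using that[of u w x] x u(3) opp by (auto simp: mult.commute)
  next
    assume "(f x - l) * (f w - l) < 0 \<and> (f x - l) * (f u - l) > 0"
    then show thesis using that[of w u x] x u(3) opp by (auto simp: mult.commute)
  qed
  have mem: "A \<in> corners" "B \<in> corners" "C \<in> corners" using ABC(1) by auto
  note m = sides[OF mem(1,2) ABC(2)] sides[OF mem(1,3) ABC(3)] sides[OF mem(2,3) ABC(4)]
  obtain t1 where t1: "t1 \<in> {0<..<1}" "f (linepath A B t1) = l" "\<And>s. s \<in> {0..1} \<Longrightarrow> f (linepath A B s) = l \<Longrightarrow> s = t1"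
    using unit_monotone_crosses[OF m(1), of l] ABC(5) by (auto simp: linepath_def)
  obtain t2 where t2: "t2 \<in> {0<..<1}" "f (linepath A C t2) = l" "\<And>s. s \<in> {0..1} \<Longrightarrow> f (linepath A C s) = l \<Longrightarrow> s = t2"
    using unit_monotone_crosses[OF m(2), of l] ABC(6) by (auto simp: linepath_def)
  have no: "f (linepath B C s) \<noteq> l" if "s \<in> {0..1}" for s
    using unit_monotone_avoids[OF m(3), of l s] ABC(7) that by (auto simp: linepath_def)
  define p p' where "p = linepath A B t1" and "p' = linepath A C t2"
  have fr: "p \<in> frontier std_triangle" "p' \<in> frontier std_triangle"
    unfolding p_def p'_def using t1(1) t2(1) mem ABC by (auto intro!: side_in_frontier)
  have ne: "p \<noteq> p'"
    using mem ABC(2-4) t1(1) t2(1) unfolding p_def p'_def corners_def linepath_def by auto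
  have only: "z = p \<or> z = p'" if z: "z \<in> frontier std_triangle" "f z = l" for z
  proof -
    obtain c d s where s: "c \<in> corners" "d \<in> corners" "c \<noteq> d" "s \<in> {0..1}" "z = linepath c d s"
      using frontier_side[OF z(1)] .
    have sw: "linepath c d s = linepath d c (1 - s)" "1 - s \<in> {0..1}"
      using s by (auto simp: linepath_def add.commute)
    consider "c = A" "d = B" | "c = B" "d = A" | "c = A" "d = C" | "c = C" "d = A" | "c = B" "d = C" | "c = C" "d = B"
      using s(1-3) unfolding ABC(1) by blast
    then show ?thesis
    proof cases
      case 1 then show ?thesis using t1(3)[of s] s z by (auto simp: p_def)
    next
      case 2 then show ?thesis using t1(3)[of "1 - s"] s z sw by (auto simp: p_def)
    next
      case 3 then show ?thesis using t2(3)[of s] s z by (auto simp: p'_def)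
    next
      case 4 then show ?thesis using t2(3)[of "1 - s"] s z sw by (auto simp: p'_def)
    next
      case 5 then show ?thesis using no[of s] s z by auto
    next
      case 6 then show ?thesis using no[of "1 - s"] s z sw by auto
    qed
  qed
  have lev: "f p = l" "f p' = l" using t1 t2 by (auto simp: p_def p'_def)
  have lb: "f b = l" using chord by auto
  have "p \<in> closed_segment a b" "p' \<in> closed_segment a b"
    unfolding chord(3)[symmetric] using lev fr frontier_subset_std by auto
  then have "a \<noteq> b" using ne by auto
  then have "a = p \<and> b = p' \<or> a = p' \<and> b = p" using only[OF chord(1) la] only[OF chord(2) lb] by auto
  then have seg: "{z \<in> std_triangle. f z = l} = closed_segment p p'"
    using chord(3) closed_segment_commute by metis
  show thesis
  proof (rule that[OF ne seg])
    show "closed_segment p p' \<inter> frontier std_triangle = {p, p'}"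
      using only seg fr by auto
  qed
qed

section \<open>The height function\<close>

locale fLOiation_height =
  order_realization R s i \<rho> + essential_torus_triangulation v E D v0
  for R s i \<rho> v E D v0 +
  fixes F :: "real \<times> real \<Rightarrow> real"
  assumes height: "height_function E D v0 \<rho> F"
begin

lemma F_vertex [simp]: "F (deck g v0) = i g"
  using height unfolding height_function_def by simp

lemma F_v0: "F v0 = 0"
  using F_vertex[of 0] by simp

lemma lifted_edges_deck: "\<eta> \<in> lifted_edges E \<Longrightarrow> (\<lambda>t. deck g (\<eta> t)) \<in> lifted_edges E"
  unfolding lifted_edges_def path_def by (auto intro: continuous_on_deck)

lemma edge_at_lifted: "\<epsilon> \<in> edges \<Longrightarrow> edge_at \<epsilon> \<in> lifted_edges E"
  unfolding lifted_edges_def path_def using continuous_edge_at cover_edge_at fst_edges by blast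

lemma reverse_edge_at_lifted:
  assumes "\<epsilon> \<in> edges" shows "reversepath (edge_at \<epsilon>) \<in> lifted_edges E"
proof -
  have "path (reversepath (edge_at \<epsilon>))" using continuous_edge_at[OF assms] by (simp add: path_def[of "edge_at \<epsilon>"])
  moreover have "\<forall>t\<in>{0..1}. cover (reversepath (edge_at \<epsilon>) t) = reversepath (fst \<epsilon>) t"
    using cover_edge_at[OF assms] by (simp add: reversepath_def)
  ultimately show ?thesis unfolding lifted_edges_def using fst_edges[OF assms] by blast
qed

lemma face_at_lifted: "\<phi> \<in> faces \<Longrightarrow> face_at \<phi> \<in> lifted_triangles D"
  unfolding lifted_triangles_def using continuous_face_at cover_face_at fst_faces by blast

text \<open>
  After translation by \<open>- h\<close> the edge ends in \<open>v0\<close>, where \<open>F\<close> is linear and vanishes at the end.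
\<close>

lemma F_on_rising_edge:
  assumes \<eta>: "\<eta> \<in> lifted_edges E" "\<eta> 0 = deck g v0" "\<eta> 1 = deck h v0" "i g < i h" and t: "t \<in> {0..1}"
  shows "F (\<eta> t) = \<rho> h ((1 - t) * i (- h + g))"
proof -
  define \<eta>' where "\<eta>' t = deck (- h) (\<eta> t)" for t
  have \<eta>': "\<eta>' \<in> lifted_edges E" unfolding \<eta>'_def using \<eta>(1) by (rule lifted_edges_deck)
  have ends: "pathstart \<eta>' = deck (- h + g) v0" "pathfinish \<eta>' = v0"
    using \<eta> by (auto simp: \<eta>'_def pathstart_def pathfinish_def)
  have "i (- h + g) < i (- h + h)" unfolding i_add_less by (rule \<eta>(4))
  then have less: "F (pathstart \<eta>') < F (pathfinish \<eta>')" unfolding ends F_vertex F_v0 by simp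
  have edge_rule: "(pathfinish \<eta> = v0 \<longrightarrow>
           (\<forall>t\<in>{0..1}. F (\<eta> t) = (1 - t) * F (pathstart \<eta>) + t * F (pathfinish \<eta>))) \<and>
        (\<forall>g. g \<noteq> 0 \<and> pathfinish \<eta> = deck g v0 \<longrightarrow>
           (\<forall>t\<in>{0..1}. F (\<eta> t) = \<rho> g (F (deck (- g) (\<eta> t)))))"
    if "\<eta> \<in> lifted_edges E" "F (pathstart \<eta>) < F (pathfinish \<eta>)" for \<eta>
    using height that unfolding height_function_def by blast
  have lin: "F (\<eta>' t) = (1 - t) * i (- h + g)"
    using edge_rule[OF \<eta>' less] t unfolding ends F_vertex F_v0 by simp
  show ?thesis
  proof (cases "h = 0")
    case True
    then show ?thesis using lin by (simp add: \<eta>'_def)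
  next
    case False
    have "F (pathstart \<eta>) < F (pathfinish \<eta>)" "pathfinish \<eta> = deck h v0"
      using \<eta> by (auto simp: pathstart_def pathfinish_def)
    then have "F (\<eta> t) = \<rho> h (F (deck (- h) (\<eta> t)))"
      using edge_rule[OF \<eta>(1)] False t by blast
    then show ?thesis using lin by (simp add: \<eta>'_def)
  qed
qed

lemma rising_edge:
  assumes "\<epsilon> \<in> edges"
  obtains \<eta> g h where "\<eta> \<in> lifted_edges E" "\<eta> = edge_at \<epsilon> \<or> \<eta> = reversepath (edge_at \<epsilon>)"
    "\<eta> 0 = deck g v0" "\<eta> 1 = deck h v0" "i g < i h"
proof -
  obtain g h where gh: "edge_at \<epsilon> 0 = deck g v0" "edge_at \<epsilon> 1 = deck h v0" "g \<noteq> h"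
    using edge_ends[OF assms] .
  then consider "i g < i h" | "i h < i g" using i_inj by (metis linorder_neqE)
  then show thesis
  proof cases
    case 1
    then show ?thesis using that gh edge_at_lifted[OF assms] by blast
  next
    case 2
    then show ?thesis using that[OF reverse_edge_at_lifted[OF assms] _ _ _ 2] gh
      by (auto simp: reversepath_def)
  qed
qed

lemma F_rising_monotone:
  assumes \<eta>: "\<eta> \<in> lifted_edges E" "\<eta> 0 = deck g v0" "\<eta> 1 = deck h v0" "i g < i h"
  shows "continuous_on {0..1} (\<lambda>t. F (\<eta> t))" "strict_mono_on {0..1} (\<lambda>t. F (\<eta> t))"
proof -
  note eq = F_on_rising_edge[OF \<eta>]
  have "continuous_on {0..1} (\<lambda>t. \<rho> h ((1 - t) * i (- h + g)))"
    by (rule continuous_on_compose2[OF rho_continuous[of UNIV]]) (auto intro!: continuous_intros)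
  then show "continuous_on {0..1} (\<lambda>t. F (\<eta> t))"
    by (rule continuous_on_eq) (use eq in simp)
  have "i (- h + g) < i (- h + h)" unfolding i_add_less by (rule \<eta>(4))
  then have neg: "i (- h + g) < 0" by simp
  show "strict_mono_on {0..1} (\<lambda>t. F (\<eta> t))"
  proof (rule strict_mono_onI)
    fix s t :: real assume st: "s \<in> {0..1}" "t \<in> {0..1}" "s < t"
    have "(1 - s) * i (- h + g) < (1 - t) * i (- h + g)"
      using st neg by (intro mult_strict_right_mono_neg) auto
    then show "F (\<eta> s) < F (\<eta> t)" unfolding eq[OF st(1)] eq[OF st(2)] by simp
  qed
qed

lemma F_edge_unit_monotone:
  assumes "\<epsilon> \<in> edges" shows "unit_monotone (\<lambda>t. F (edge_at \<epsilon> t))"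
proof -
  obtain \<eta> g h where \<eta>: "\<eta> \<in> lifted_edges E" "\<eta> = edge_at \<epsilon> \<or> \<eta> = reversepath (edge_at \<epsilon>)"
    "\<eta> 0 = deck g v0" "\<eta> 1 = deck h v0" "i g < i h" using rising_edge[OF assms] .
  have m: "unit_monotone (\<lambda>t. F (\<eta> t))"
    unfolding unit_monotone_def using F_rising_monotone[OF \<eta>(1,3-5)] by blast
  from \<eta>(2) show ?thesis
  proof
    assume "\<eta> = edge_at \<epsilon>" then show ?thesis using m by simp
  next
    assume "\<eta> = reversepath (edge_at \<epsilon>)"
    then show ?thesis using unit_monotone_reverse[OF m] by (simp add: reversepath_def)
  qed
qed

lemma F_edge_equivariant:
  assumes "\<epsilon> \<in> edges" "t \<in> {0..1}" shows "F (deck k (edge_at \<epsilon> t)) = \<rho> k (F (edge_at \<epsilon> t))"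
proof -
  obtain \<eta> g h where \<eta>: "\<eta> \<in> lifted_edges E" "\<eta> = edge_at \<epsilon> \<or> \<eta> = reversepath (edge_at \<epsilon>)"
    "\<eta> 0 = deck g v0" "\<eta> 1 = deck h v0" "i g < i h" using rising_edge[OF assms(1)] .
  have *: "F (deck k (\<eta> s)) = \<rho> k (F (\<eta> s))" if "s \<in> {0..1}" for s
  proof -
    have "F (deck k (\<eta> s)) = \<rho> (k + h) ((1 - s) * i (- (k + h) + (k + g)))"
      by (rule F_on_rising_edge[OF lifted_edges_deck[OF \<eta>(1)] _ _ _ that]) (simp_all add: \<eta> i_add_less)
    also have "- (k + h) + (k + g) = - h + g" by simp
    finally show ?thesis using F_on_rising_edge[OF \<eta>(1,3-5) that] by (simp add: rho_add)
  qed
  from \<eta>(2) show ?thesis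
  proof
    assume "\<eta> = edge_at \<epsilon>" then show ?thesis using * assms by simp
  next
    assume r: "\<eta> = reversepath (edge_at \<epsilon>)"
    have "1 - t \<in> {0..1}" using assms by simp
    then show ?thesis using *[of "1 - t"] by (simp add: r reversepath_def)
  qed
qed

lemma face_level_chord:
  assumes "\<phi> \<in> faces" "z \<in> std_triangle"
  shows "\<exists>a\<in>frontier std_triangle. \<exists>b\<in>frontier std_triangle.
    {w \<in> std_triangle. F (face_at \<phi> w) = F (face_at \<phi> z)} = closed_segment a b"
proof -
  have "\<forall>c\<in>(F \<circ> face_at \<phi>) ` std_triangle. \<exists>a\<in>frontier std_triangle. \<exists>b\<in>frontier std_triangle.
          {z \<in> std_triangle. F (face_at \<phi> z) = c} = closed_segment a b"
  proof -
    have "\<forall>\<tau>\<in>lifted_triangles D. \<forall>c\<in>(F \<circ> \<tau>) ` std_triangle.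
        \<exists>a\<in>frontier std_triangle. \<exists>b\<in>frontier std_triangle.
          {z \<in> std_triangle. F (\<tau> z) = c} = closed_segment a b"
      using height unfolding height_function_def by (elim conjE)
    then show ?thesis using face_at_lifted[OF assms(1)] by (rule bspec)
  qed
  moreover have "F (face_at \<phi> z) \<in> (F \<circ> face_at \<phi>) ` std_triangle" using assms(2) by auto
  ultimately show ?thesis by blast
qed

lemma F_side_unit_monotone:
  assumes "\<phi> \<in> faces" "a \<in> corners" "b \<in> corners" "a \<noteq> b"
  shows "unit_monotone (\<lambda>t. F (face_at \<phi> (linepath a b t)))"
proof -
  obtain \<epsilon> where \<epsilon>: "\<epsilon> \<in> edges" "(\<forall>t\<in>{0..1}. face_at \<phi> (linepath a b t) = edge_at \<epsilon> t) \<or>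
     (\<forall>t\<in>{0..1}. face_at \<phi> (linepath a b t) = edge_at \<epsilon> (1 - t))"
    using face_side[OF assms] .
  note m = F_edge_unit_monotone[OF \<epsilon>(1)]
  from \<epsilon>(2) show ?thesis
  proof
    assume "\<forall>t\<in>{0..1}. face_at \<phi> (linepath a b t) = edge_at \<epsilon> t"
    then show ?thesis by (intro unit_monotone_cong[OF m]) simp
  next
    assume "\<forall>t\<in>{0..1}. face_at \<phi> (linepath a b t) = edge_at \<epsilon> (1 - t)"
    then show ?thesis by (intro unit_monotone_cong[OF unit_monotone_reverse[OF m]]) simp
  qed
qed

text \<open>
  The function is continuous on the three sides, and all its level sets are chords with ends on
  them.
\<close>

lemma F_face_continuous:
  assumes "\<phi> \<in> faces" shows "continuous_on std_triangle (\<lambda>z. F (face_at \<phi> z))"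
proof (rule continuous_if_level_sets_are_chords)
  have side: "continuous_on (linepath a b ` {0..1}) (\<lambda>z. F (face_at \<phi> z))"
    if "a \<in> corners" "b \<in> corners" "a \<noteq> b" for a b
    using F_side_unit_monotone[OF assms that] unfolding unit_monotone_def
    by (intro continuous_on_compact_quotient) auto
  have cl: "closed (linepath a b ` {0..1})" for a b :: "real \<times> real"
    using closed_path_image[OF path_linepath] by (simp add: path_image_def)
  let ?U = "linepath (0,0) (1,0) ` {0..1} \<union> (linepath (0,0) (0,1) ` {0..1} \<union> linepath (1,0) (0,1) ` {0..1::real}) :: (real \<times> real) set"
  have "continuous_on ?U (\<lambda>z. F (face_at \<phi> z))"
    by (intro continuous_on_closed_Un closed_Un cl side) (auto simp: corners_def)
  moreover have "frontier std_triangle \<subseteq> ?U"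
  proof
    fix z assume "z \<in> frontier std_triangle"
    then obtain a b t where abt: "a \<in> corners" "b \<in> corners" "a \<noteq> b" "t \<in> {0..1}" "z = linepath a b t"
      by (rule frontier_side)
    have sw: "linepath a b t = linepath b a (1 - t)" "1 - t \<in> {0..1}"
      using abt by (auto simp: linepath_def add.commute)
    have "a = (0,0) \<and> b = (1,0) \<or> b = (0,0) \<and> a = (1,0) \<or> a = (0,0) \<and> b = (0,1) \<or>
       b = (0,0) \<and> a = (0,1) \<or> a = (1,0) \<and> b = (0,1) \<or> b = (1,0) \<and> a = (0,1)"
      using abt(1-3) by (auto simp: corners_def)
    then show "z \<in> ?U" unfolding abt(5) using sw abt(4) by (metis UnI1 UnI2 imageI)
  qed
  ultimately show "continuous_on (frontier std_triangle) (\<lambda>z. F (face_at \<phi> z))"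
    by (rule continuous_on_subset)
  show "compact (frontier std_triangle)" using std_triangle_compact by (rule compact_frontier)
qed (auto simp: frontier_subset_std std_triangle_convex face_level_chord[OF assms])

lemma F_continuous: "continuous_on A F"
proof -
  have "continuous_on UNIV F"
    unfolding continuous_on_eq_continuous_at[OF open_UNIV]
  proof
    fix x :: "real \<times> real"
    define I where "I = {\<phi> \<in> faces. face_at \<phi> ` std_triangle \<inter> ball x 1 \<noteq> {}}"
    have "finite I" unfolding I_def by (intro finite_faces_meeting bounded_ball)
    then have "continuous_on (\<Union>\<phi>\<in>I. face_at \<phi> ` std_triangle) F"
    proof (rule continuous_on_closed_Union)
      fix \<phi> assume "\<phi> \<in> I"
      then have \<phi>: "\<phi> \<in> faces" by (simp add: I_def)
      show "closed (face_at \<phi> ` std_triangle)"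
        by (intro compact_imp_closed compact_continuous_image continuous_face_at \<phi> std_triangle_compact)
      show "continuous_on (face_at \<phi> ` std_triangle) F"
        by (intro continuous_on_compact_quotient std_triangle_compact continuous_face_at F_face_continuous \<phi>)
    qed
    moreover have "ball x 1 \<subseteq> (\<Union>\<phi>\<in>I. face_at \<phi> ` std_triangle)"
    proof
      fix y assume y: "y \<in> ball x 1"
      obtain \<phi> where "\<phi> \<in> faces" "y \<in> face_at \<phi> ` std_triangle" by (rule faces_cover_plane)
      then show "y \<in> (\<Union>\<phi>\<in>I. face_at \<phi> ` std_triangle)" using y unfolding I_def by blast
    qed
    ultimately have "continuous_on (ball x 1) F" by (rule continuous_on_subset)
    then show "isCont F x" by (rule continuous_on_interior) simp
  qed
  then show ?thesis using continuous_on_subset by blast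
qed

text \<open>
  The rule for edges is equivariant because \<open>\<rho>\<close> is an action. A point of a triangle lies on a level
  chord with ends on the sides; the translated chord has both ends on one level, hence lies in this
  level, because level sets in a triangle are convex.
\<close>

lemma F_equivariant: "F (deck k x) = \<rho> k (F x)"
proof -
  obtain \<phi> z where \<phi>: "\<phi> \<in> faces" and z: "z \<in> std_triangle" "x = face_at \<phi> z"
    using faces_cover_plane[of x] by blast
  define \<phi>' where "\<phi>' = (fst \<phi>, k + snd \<phi>)"
  have \<phi>': "\<phi>' \<in> faces" using \<phi> by (simp add: \<phi>'_def)
  have d: "face_at \<phi>' w = deck k (face_at \<phi> w)" for w by (simp add: \<phi>'_def)
  obtain a b where a: "a \<in> frontier std_triangle" "b \<in> frontier std_triangle"
    "{w \<in> std_triangle. F (face_at \<phi> w) = F (face_at \<phi> z)} = closed_segment a b"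
    using face_level_chord[OF \<phi> z(1)] by blast
  have fr: "F (face_at \<phi>' w) = \<rho> k (F (face_at \<phi> w))" if "w \<in> frontier std_triangle" for w
    using frontier_on_edge[OF \<phi> that] F_edge_equivariant unfolding d by metis
  have ab: "F (face_at \<phi> a) = F (face_at \<phi> z)" "F (face_at \<phi> b) = F (face_at \<phi> z)" using a by auto
  have std: "a \<in> std_triangle" "b \<in> std_triangle" using a frontier_subset_std by auto
  obtain a' b' where a': "{w \<in> std_triangle. F (face_at \<phi>' w) = F (face_at \<phi>' a)} = closed_segment a' b'"
    using face_level_chord[OF \<phi>' std(1)] by blast
  have "F (face_at \<phi>' b) = F (face_at \<phi>' a)" using fr a ab by simp
  then have "a \<in> closed_segment a' b'" "b \<in> closed_segment a' b'"
    unfolding a'[symmetric] using std by auto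
  then have "closed_segment a b \<subseteq> closed_segment a' b'" by (simp add: subset_closed_segment)
  moreover have "z \<in> closed_segment a b" unfolding a(3)[symmetric] using z by auto
  ultimately have "F (face_at \<phi>' z) = F (face_at \<phi>' a)" using a' by blast
  also have "\<dots> = \<rho> k (F (face_at \<phi> z))" using fr[OF a(1)] ab by simp
  finally show ?thesis unfolding d z(2) .
qed

lemma face_level_segment:
  assumes "\<phi> \<in> faces" "z \<in> std_triangle" "F (face_at \<phi> z) \<notin> range i"
  obtains p p' where "p \<noteq> p'" "{w \<in> std_triangle. F (face_at \<phi> w) = F (face_at \<phi> z)} = closed_segment p p'"
    "closed_segment p p' \<inter> frontier std_triangle = {p, p'}"
proof -
  obtain a b where ab: "a \<in> frontier std_triangle" "b \<in> frontier std_triangle"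
    "{w \<in> std_triangle. F (face_at \<phi> w) = F (face_at \<phi> z)} = closed_segment a b"
    using face_level_chord[OF assms(1,2)] by blast
  have "F (face_at \<phi> c) \<noteq> F (face_at \<phi> z)" if c: "c \<in> corners" for c
    using face_corner_vertex[OF assms(1) c] assms(3) by (metis F_vertex rangeI)
  then show thesis
    using level_chord_of_triangle[of "\<lambda>w. F (face_at \<phi> w)", OF F_side_unit_monotone[OF assms(1)] ab] that
    by blast
qed

end

section \<open>Closed leaves and Archimedean orders\<close>

text \<open>
  The Jordan curve theorem, transported from the complex plane; \<open>U\<close> is the inside and \<open>V\<close> the
  outside.
\<close>

lemma jordan_curve_in_plane:
  fixes c :: "real \<Rightarrow> real \<times> real"
  assumes "simple_path c" "pathfinish c = pathstart c"
  obtains U V where "open U" "open V" "U \<noteq> {}" "bounded U" "U \<inter> V = {}"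
    "U \<union> V = - path_image c" "connected (U \<union> path_image c)"
proof -
  define j where "j x = Complex (fst x) (snd x)" for x :: "real \<times> real"
  define k where "k z = (Re z, Im z)" for z
  have kj: "k (j x) = x" "j (k z) = z" for x z by (simp_all add: j_def k_def)
  have lin: "linear j" "linear k" by (auto intro!: linearI simp: j_def k_def complex_eq_iff prod_eq_iff)
  have inj: "inj j" by (metis injI kj(1))
  have cont: "continuous_on UNIV j" using lin(1) by (simp add: linear_continuous_on linear_conv_bounded_linear)
  have "simple_path (j \<circ> c)" using assms(1) simple_path_linear_image_eq[OF lin(1) inj] by blast
  moreover have "pathfinish (j \<circ> c) = pathstart (j \<circ> c)"
    using assms(2) by (simp add: pathfinish_def pathstart_def)
  ultimately obtain A B where A: "A \<noteq> {}" "open A" "connected A" "open B" "bounded A" "A \<inter> B = {}"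
    "A \<union> B = - path_image (j \<circ> c)" "frontier A = path_image (j \<circ> c)"
    by (rule Jordan_curve) blast
  have img: "path_image (j \<circ> c) = j ` path_image c" by (rule path_image_compose)
  have vim: "j -` S = k ` S" for S
  proof
    show "j -` S \<subseteq> k ` S" using kj(1) by (metis image_eqI subsetI vimage_eq)
    show "k ` S \<subseteq> j -` S" using kj(2) by auto
  qed
  have J: "j -` path_image (j \<circ> c) = path_image c" unfolding img using inj by (simp add: inj_vimage_image_eq)
  show thesis
  proof (rule that[of "j -` A" "j -` B"])
    show "open (j -` A)" "open (j -` B)" using A cont by (auto intro: open_vimage)
    show "j -` A \<noteq> {}" using A(1) by (simp add: vim)
    show "bounded (j -` A)" unfolding vim using A(5) lin(2)
      by (simp add: bounded_linear_image linear_conv_bounded_linear)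
    show "j -` A \<inter> j -` B = {}" using A(6) by auto
    show "j -` A \<union> j -` B = - path_image c" unfolding J[symmetric] using A(7) by auto
    have "connected (closure A)" using A(3) by (rule connected_imp_connected_closure)
    then have "connected (A \<union> path_image (j \<circ> c))" using A(8) closure_Un_frontier[of A] by simp
    then have "connected (k ` (A \<union> path_image (j \<circ> c)))" using lin(2) by (intro connected_linear_image)
    then show "connected (j -` A \<union> path_image c)" unfolding J[symmetric] vim image_Un .
  qed
qed

context fLOiation_height
begin

text \<open>
  Along any lift, \<open>F\<close> takes values in the countable set of all \<open>\<rho> g c\<close>, so it is constant.
\<close>

lemma lift_into_level_set:
  assumes "path \<gamma>" "path_image \<gamma> \<subseteq> cover ` {x. F x = c}" "F x0 = c" "cover x0 = \<gamma> 0"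
  obtains \<eta> where "path \<eta>" "\<eta> 0 = x0" "\<And>t. t \<in> {0..1} \<Longrightarrow> cover (\<eta> t) = \<gamma> t"
    "\<And>t. t \<in> {0..1} \<Longrightarrow> F (\<eta> t) = c"
proof -
  have "\<gamma> ` {0..1} \<subseteq> torus" 
    using assms(2) cover_in_torus unfolding path_image_def by (metis (no_types, lifting) imageE subset_iff)
  then obtain h where h: "continuous_on {0..1} h" "\<And>t. t \<in> {0..1} \<Longrightarrow> cover (h t) = \<gamma> t"
    using cover_lift_exists[of "{0..1}" \<gamma>] assms(1) unfolding path_def by auto
  have "cover (h 0) = cover x0" using h(2)[of 0] assms(4) by simp
  then obtain g where g: "x0 = deck g (h 0)" unfolding cover_eq_iff by blast
  define \<eta> where "\<eta> t = deck g (h t)" for t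
  have \<eta>: "continuous_on {0..1} \<eta>" unfolding \<eta>_def by (intro continuous_intros h)
  have cov: "cover (\<eta> t) = \<gamma> t" if "t \<in> {0..1}" for t unfolding \<eta>_def using h(2)[OF that] by simp
  have "(\<lambda>t. F (\<eta> t)) ` {0..1} \<subseteq> range (\<lambda>g. \<rho> g c)"
  proof
    fix y assume "y \<in> (\<lambda>t. F (\<eta> t)) ` {0..1}"
    then obtain t where t: "t \<in> {0..1}" "y = F (\<eta> t)" by blast
    then have "\<gamma> t \<in> cover ` {x. F x = c}" using assms(2) unfolding path_image_def by blast
    then obtain x where x: "F x = c" "cover x = cover (\<eta> t)" using cov[OF t(1)] by auto
    then obtain g where "\<eta> t = deck g x" unfolding cover_eq_iff by blast
    then have "y = \<rho> g c" using t(2) x(1) F_equivariant by simp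
    then show "y \<in> range (\<lambda>g. \<rho> g c)" by blast
  qed
  moreover have "continuous_on {0..1} (\<lambda>t. F (\<eta> t))"
    by (rule continuous_on_compose2[OF F_continuous[of UNIV] \<eta>]) simp
  ultimately have "F (\<eta> t) = F (\<eta> 0)" if "t \<in> {0..1}" for t
    using that connected_countable_range_constant[of "{0..1}" "\<lambda>t. F (\<eta> t)" "range (\<lambda>g. \<rho> g c)" t 0] by auto
  moreover have "\<eta> 0 = x0" by (simp add: \<eta>_def g)
  ultimately show thesis using that[of \<eta>] \<eta> cov assms(3) by (simp add: path_def)
qed

text \<open>
  Let \<open>\<eta>\<close> be the edge, directed upwards, and \<open>d > 0\<close> the difference of its ends. The translates of
  \<open>\<eta>\<close> by the multiples of \<open>d\<close> form a chain along which \<open>F\<close> increases strictly. Starting inside at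
  height at least \<open>c\<close>, one cannot meet \<open>J\<close> on the way up; at height at most \<open>c\<close>, one cannot meet it on
  the way down. Either way infinitely many vertices would lie in the bounded set \<open>U\<close>.
\<close>

lemma no_edge_point_inside_level_curve:
  assumes U: "open U" "open V" "bounded U" "U \<inter> V = {}" "U \<union> V = - J" and J: "J \<subseteq> {x. F x = c}"
    and \<epsilon>: "\<epsilon> \<in> edges" "t \<in> {0..1}"
  shows "edge_at \<epsilon> t \<notin> U"
proof
  assume x: "edge_at \<epsilon> t \<in> U"
  have trapped: "T \<subseteq> U" if "connected T" "T \<inter> U \<noteq> {}" "T \<inter> J = {}" for T
    using connectedD[OF that(1) U(1,2)] that(2,3) U(4,5) by blast
  obtain \<eta> g h where \<eta>: "\<eta> \<in> lifted_edges E" "\<eta> = edge_at \<epsilon> \<or> \<eta> = reversepath (edge_at \<epsilon>)"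
    "\<eta> 0 = deck g v0" "\<eta> 1 = deck h v0" "i g < i h" using rising_edge[OF \<epsilon>(1)] .
  obtain s where s: "s \<in> {0..1}" "\<eta> s \<in> U"
  proof (cases "\<eta> = edge_at \<epsilon>")
    case False
    then have "\<eta> (1 - t) = edge_at \<epsilon> t" using \<eta>(2) by (auto simp: reversepath_def)
    then show thesis using that[of "1 - t"] x \<epsilon>(2) by auto
  qed (use that x \<epsilon>(2) in auto)
  have shifted: "continuous_on {0..1} (\<lambda>t. deck k (\<eta> t))" "strict_mono_on {0..1} (\<lambda>t. F (deck k (\<eta> t)))" for k
  proof -
    have "path (\<lambda>t. deck k (\<eta> t))" using lifted_edges_deck[OF \<eta>(1), of k] by (simp add: lifted_edges_def)
    then show "continuous_on {0..1} (\<lambda>t. deck k (\<eta> t))" by (simp add: path_def)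
    show "strict_mono_on {0..1} (\<lambda>t. F (deck k (\<eta> t)))"
      by (rule F_rising_monotone[OF lifted_edges_deck[OF \<eta>(1)], where g = "k + g" and h = "k + h"])
        (simp_all add: \<eta> i_add_less)
  qed
  have stays: "(\<lambda>t. deck k (\<eta> t)) ` I \<subseteq> U"
    if I: "connected I" "I \<subseteq> {0..1}" "r \<in> I" and r: "deck k (\<eta> r) \<in> U"
      and ne: "\<And>u. u \<in> I \<Longrightarrow> u \<noteq> r \<Longrightarrow> F (deck k (\<eta> u)) \<noteq> c" for k r I
  proof (rule trapped)
    show "connected ((\<lambda>t. deck k (\<eta> t)) ` I)"
      using I by (intro connected_continuous_image continuous_on_subset[OF shifted(1)])
    show "(\<lambda>t. deck k (\<eta> t)) ` I \<inter> U \<noteq> {}" using I(3) r by blast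
    have "deck k (\<eta> u) \<notin> J" if "u \<in> I" for u
      using ne[OF that] r J U(5) by (cases "u = r") auto
    then show "(\<lambda>t. deck k (\<eta> t)) ` I \<inter> J = {}" by blast
  qed
  have up: "deck k (\<eta> 1) \<in> U" if r: "r \<in> {0..1}" "deck k (\<eta> r) \<in> U" "c \<le> F (deck k (\<eta> r))" for k r
  proof -
    have "F (deck k (\<eta> u)) \<noteq> c" if "u \<in> {r..1}" "u \<noteq> r" for u
      using strict_mono_onD[OF shifted(2), of r u k] that r by auto
    then have "(\<lambda>t. deck k (\<eta> t)) ` {r..1} \<subseteq> U" using r by (intro stays[of _ r]) auto
    then show ?thesis using r(1) by auto
  qed
  have down: "deck k (\<eta> 0) \<in> U" if r: "r \<in> {0..1}" "deck k (\<eta> r) \<in> U" "F (deck k (\<eta> r)) \<le> c" for k r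
  proof -
    have "F (deck k (\<eta> u)) \<noteq> c" if "u \<in> {0..r}" "u \<noteq> r" for u
      using strict_mono_onD[OF shifted(2), of u r k] that r by auto
    then have "(\<lambda>t. deck k (\<eta> t)) ` {0..r} \<subseteq> U" using r by (intro stays[of _ r]) auto
    then show ?thesis using r(1) by auto
  qed
  \<comment> \<open>translation by \<open>d\<close> moves the start of the edge to its end\<close>
  define d where "d = - g + h"
  have "i (- g + g) < i (- g + h)" unfolding i_add_less by (rule \<eta>(5))
  then have d: "0 < i d" by (simp add: d_def)
  have mono: "i (scale k d) \<le> i (scale l d)" if "k \<le> l" for k l
    using scale_less[OF d, of k l] that by (cases "k = l") auto
  have shift_start: "deck (scale (k + 1) d) (\<eta> 0) = deck (scale k d) (\<eta> 1)" for k
    unfolding \<eta>(3,4) scale_add by (simp add: d_def add.assoc)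
  have fin: "finite {k. deck k ` {v0} \<inter> U \<noteq> {}}"
    by (intro finite_translates_meeting U) simp
  have inf: False if "\<And>n::nat. deck (f (int n)) v0 \<in> U" "inj f" for f
  proof -
    have "range (\<lambda>n. f (int n)) \<subseteq> {k. deck k ` {v0} \<inter> U \<noteq> {}}" using that(1) by auto
    then have "finite (range (\<lambda>n. f (int n)))" using fin finite_subset by blast
    moreover have "inj (\<lambda>n. f (int n))" by (rule injI) (use injD[OF that(2)] in fastforce)
    ultimately show False using finite_imageD[of "\<lambda>n. f (int n)" UNIV] by simp
  qed
  have inj_scale: "inj (\<lambda>k. scale k d)"
    by (rule injI) (metis d less_irrefl linorder_neqE scale_less)
  show False
  proof (cases "c \<le> F (\<eta> s)")
    case True
    have le1: "c \<le> F (\<eta> 1)"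
      using True strict_mono_on_leD[OF shifted(2)[of 0] s(1), of 1] s(1) by simp
    have "deck (scale (int n) d) (\<eta> 1) \<in> U" for n
    proof (induction n)
      case 0
      show ?case using up[of s 0] s True by simp
    next
      case (Suc n)
      have "F (deck (scale (int (Suc n)) d) (\<eta> 0)) = F (deck (scale (int n) d) (\<eta> 1))"
        using shift_start[of "int n"] by (simp add: add.commute)
      also have "\<dots> = i (scale (int n) d + h)" unfolding \<eta>(4) by simp
      also have "\<dots> \<ge> i (scale 0 d + h)"
        using mono[of 0 "int n"] i_add_le[of h "scale 0 d" "scale (int n) d"] by (simp add: add.commute)
      finally have "c \<le> F (deck (scale (int (Suc n)) d) (\<eta> 0))" using le1 unfolding \<eta>(4) by simp
      then show ?case
        using up[of 0 "scale (int (Suc n)) d"] Suc shift_start[of "int n"] by (simp add: add.commute)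
    qed
    then show False
      using inf[of "\<lambda>k. scale k d + h"] inj_scale unfolding \<eta>(4) by (simp add: inj_def)
  next
    case False
    have le0: "F (\<eta> 0) \<le> c"
      using False strict_mono_on_leD[OF shifted(2)[of 0], of 0 s] s(1) by simp
    have "deck (scale (- int n) d) (\<eta> 0) \<in> U" for n
    proof (induction n)
      case 0
      show ?case using down[of s 0] s False by simp
    next
      case (Suc n)
      have st: "deck (scale (- int (Suc n)) d) (\<eta> 1) = deck (scale (- int n) d) (\<eta> 0)"
        using shift_start[of "- int (Suc n)"] by simp
      have "F (deck (scale (- int (Suc n)) d) (\<eta> 1)) = i (scale (- int n) d + g)" unfolding st \<eta>(3) by simp
      also have "\<dots> \<le> i (scale 0 d + g)"
        using mono[of "- int n" 0] i_add_le[of g "scale (- int n) d" "scale 0 d"] by (simp add: add.commute)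
      finally have "F (deck (scale (- int (Suc n)) d) (\<eta> 1)) \<le> c" using le0 unfolding \<eta>(3) by simp
      then show ?case
        using down[of 1 "scale (- int (Suc n)) d"] Suc st by simp
    qed
    then show False
    proof (intro inf[of "\<lambda>k. scale (- k) d + g"])
      show "inj (\<lambda>k. scale (- k) d + g)"
        by (rule injI) (use injD[OF inj_scale] in fastforce)
    qed (simp add: \<eta>(3))
  qed
qed

text \<open>
  Since no \<open>g \<noteq> 0\<close> fixes \<open>c\<close>, the covering map is injective on the level set, and the closed leaf lifts to
  a Jordan curve. Every level segment from a point inside to an edge has to meet the curve, so the
  inside would belong to the same level, and even to the same component as the curve.
\<close>

lemma closed_leaf_imp_not_archimedean:
  assumes "L \<in> leaves F" "closed_leaf L"
  shows "\<not> archimedean_order R"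
proof
  assume arch: "archimedean_order R"
  obtain C c where C: "C \<in> components {x. F x = c}" "L = cover ` C"
    using assms(1) unfolding leaves_def by blast
  have CF: "C \<subseteq> {x. F x = c}" using in_components_subset[OF C(1)] .
  obtain \<gamma> where \<gamma>: "simple_path \<gamma>" "pathfinish \<gamma> = pathstart \<gamma>" "path_image \<gamma> = cover ` C"
    using assms(2) unfolding closed_leaf_def C(2) by blast
  have "\<gamma> 0 \<in> cover ` C" using \<gamma>(3) unfolding path_image_def by auto
  then obtain x0 where x0: "x0 \<in> C" "cover x0 = \<gamma> 0" by auto
  have inj: "x = y" if eqs: "F x = c" "F y = c" "cover x = cover y" for x y
  proof -
    obtain g where g: "y = deck g x" using eqs(3) unfolding cover_eq_iff by blast
    then have "\<rho> g c = c" using eqs F_equivariant by metis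
    then have "g = 0" using archimedean_no_fixed_point arch by blast
    then show ?thesis using g by simp
  qed
  have "path_image \<gamma> \<subseteq> cover ` {x. F x = c}" using \<gamma>(3) CF by blast
  then obtain \<eta> where \<eta>: "path \<eta>" "\<eta> 0 = x0" "\<And>t. t \<in> {0..1} \<Longrightarrow> cover (\<eta> t) = \<gamma> t"
    "\<And>t. t \<in> {0..1} \<Longrightarrow> F (\<eta> t) = c"
    using lift_into_level_set[OF simple_path_imp_path[OF \<gamma>(1)], of c x0] x0 CF by auto
  have J_sub: "path_image \<eta> \<subseteq> {x. F x = c}" using \<eta>(4) by (auto simp: path_image_def)
  have "simple_path \<eta>"
    using \<gamma>(1) \<eta>(1,3) unfolding simple_path_def loop_free_def by metis
  have "cover (\<eta> 1) = cover (\<eta> 0)" using \<eta>(3)[of 0] \<eta>(3)[of 1] \<gamma>(2) by (simp add: pathfinish_def pathstart_def)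
  then have loop: "pathfinish \<eta> = pathstart \<eta>"
    unfolding pathfinish_def pathstart_def using inj \<eta>(4)[of 0] \<eta>(4)[of 1] by simp
  have CJ: "C = path_image \<eta>"
  proof
    show "path_image \<eta> \<subseteq> C"
    proof (rule components_maximal[OF C(1) connected_path_image[OF \<eta>(1)] J_sub])
      have "x0 \<in> path_image \<eta>" using \<eta>(2) pathstart_in_path_image[of \<eta>] by (simp add: pathstart_def)
      then show "C \<inter> path_image \<eta> \<noteq> {}" using x0(1) by blast
    qed
    show "C \<subseteq> path_image \<eta>"
    proof
      fix x assume x: "x \<in> C"
      then have "cover x \<in> path_image \<gamma>" using \<gamma>(3) by blast
      then obtain t where t: "t \<in> {0..1}" "cover x = \<gamma> t" unfolding path_image_def by blast
      have "F x = c" using x CF by blast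
      then have "x = \<eta> t" using inj \<eta>(3)[OF t(1)] \<eta>(4)[OF t(1)] t(2) by simp
      then show "x \<in> path_image \<eta>" using t by (auto simp: path_image_def)
    qed
  qed
  obtain U V where U: "open U" "open V" "U \<noteq> {}" "bounded U" "U \<inter> V = {}"
    "U \<union> V = - path_image \<eta>" "connected (U \<union> path_image \<eta>)"
    using jordan_curve_in_plane[OF \<open>simple_path \<eta>\<close> loop] .
  have "F x = c" if x: "x \<in> U" for x
  proof (rule ccontr)
    assume ne: "F x \<noteq> c"
    obtain \<phi> z where \<phi>: "\<phi> \<in> faces" and z: "z \<in> std_triangle" "x = face_at \<phi> z"
      using faces_cover_plane[of x] by blast
    obtain a b where a: "a \<in> frontier std_triangle"
      "{w \<in> std_triangle. F (face_at \<phi> w) = F (face_at \<phi> z)} = closed_segment a b"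
      using face_level_chord[OF \<phi> z(1)] by blast
    have "z \<in> closed_segment a b" unfolding a(2)[symmetric] using z by simp
    then have sub: "closed_segment z a \<subseteq> {w \<in> std_triangle. F (face_at \<phi> w) = F (face_at \<phi> z)}"
      unfolding a(2) by (simp add: subset_closed_segment)
    define T where "T = face_at \<phi> ` closed_segment z a"
    have "connected T" unfolding T_def using sub
      by (intro connected_continuous_image continuous_on_subset[OF continuous_face_at[OF \<phi>]]) auto
    moreover have "x \<in> T" unfolding T_def z(2) by auto
    moreover have "T \<inter> path_image \<eta> = {}"
    proof (rule ccontr)
      assume "\<not> ?thesis"
      then obtain w where w: "w \<in> closed_segment z a" "face_at \<phi> w \<in> path_image \<eta>"
        unfolding T_def by blast
      then have "F (face_at \<phi> w) = F (face_at \<phi> z)" using sub by blast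
      then show False using w(2) J_sub ne z(2) by auto
    qed
    ultimately have "T \<subseteq> U" using connectedD[OF _ U(1,2), of T] U(5,6) x by blast
    moreover have "face_at \<phi> a \<in> T" by (simp add: T_def)
    ultimately have aU: "face_at \<phi> a \<in> U" by blast
    obtain \<epsilon> t where "\<epsilon> \<in> edges" "t \<in> {0..1}" "face_at \<phi> a = edge_at \<epsilon> t"
      using frontier_on_edge[OF \<phi> a(1)] .
    then show False
      using no_edge_point_inside_level_curve[OF U(1,2,4-6) J_sub] aU by metis
  qed
  then have "U \<union> path_image \<eta> \<subseteq> {x. F x = c}" using J_sub by blast
  then have "U \<union> path_image \<eta> \<subseteq> C"
    by (rule components_maximal[OF C(1) U(7)]) (use CJ x0(1) in blast)
  then show False using CJ U(3,6) by blast
qed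

end

section \<open>Closed leaves at a fixed height\<close>

lemma eq_midpoint [simp]:
  fixes p :: "'a::real_normed_vector"
  shows "p = midpoint p q \<longleftrightarrow> p = q" "q = midpoint p q \<longleftrightarrow> p = q"
  using midpoint_eq_endpoint[of p q] by metis+

locale regular_level = fLOiation_height +
  fixes \<l> :: real
  assumes l_not_vertex: "\<l> \<notin> range i"
    and locally_finite_orbit: "\<And>m M. finite (range (\<lambda>g. \<rho> g \<l>) \<inter> {m..M})"
begin

definition chord where
  "chord \<phi> p p' \<longleftrightarrow> p \<noteq> p' \<and> {w \<in> std_triangle. F (face_at \<phi> w) = \<l>} = closed_segment p p' \<and>
     closed_segment p p' \<inter> frontier std_triangle = {p, p'}"

abbreviation half where "half p p' \<equiv> closed_segment p (midpoint p p')"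

text \<open>
  Chords are cut at their midpoints because a whole chord may have its two ends identified in the
  torus. The two ends of a half chord, one on an edge and one inside a triangle, remain different.
\<close>

definition half_arcs :: "(complex \<times> complex) set set" where
  "half_arcs = {cover ` face_at \<phi> ` half p p' | \<phi> p p'. \<phi> \<in> faces \<and> chord \<phi> p p'}"

definition nodes :: "(complex \<times> complex) set" where
  "nodes = {cover (face_at \<phi> w) | \<phi> p p' w. \<phi> \<in> faces \<and> chord \<phi> p p' \<and> (w = p \<or> w = midpoint p p')}"

lemma chord_commute: "chord \<phi> p p' \<Longrightarrow> chord \<phi> p' p"
  unfolding chord_def by (auto simp: closed_segment_commute)

lemma chord_unique: "chord \<phi> p p' \<Longrightarrow> chord \<phi> q q' \<Longrightarrow> q = p \<and> q' = p' \<or> q = p' \<and> q' = p"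
  unfolding chord_def by (metis closed_segment_eq doubleton_eq_iff)

lemma half_subset: "half p p' \<subseteq> closed_segment p p'"
  by (simp add: subset_closed_segment midpoint_in_closed_segment)

lemma chord_Un_halves:
  fixes p :: "real \<times> real"
  shows "closed_segment p p' = half p p' \<union> half p' p"
  unfolding midpoint_sym[of p' p] closed_segment_commute[of p' "midpoint p p'"]
  using Un_closed_segment[of "midpoint p p'" p p'] by simp

lemma halves_meet:
  fixes p :: "real \<times> real"
  assumes "z \<in> half p p'" "z \<in> half p' p" shows "z = midpoint p p'"
proof (cases "p = p'")
  case False
  have "z \<in> closed_segment p (midpoint p p') \<inter> closed_segment (midpoint p p') p'"
    using assms by (simp add: midpoint_sym[of p' p] closed_segment_commute[of p'])
  also have "\<dots> = {midpoint p p'}"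
    by (rule Int_closed_segment) (simp add: midpoint_in_closed_segment)
  finally show ?thesis by simp
qed (use assms in simp)

lemma chord_point:
  assumes "chord \<phi> p p'" "z \<in> half p p'"
  shows "z \<in> std_triangle" "F (face_at \<phi> z) = \<l>" "z \<in> frontier std_triangle \<Longrightarrow> z = p"
    "z \<noteq> p \<Longrightarrow> z \<in> interior std_triangle"
proof -
  have z: "z \<in> closed_segment p p'" using assms(2) half_subset by blast
  then show s: "z \<in> std_triangle" "F (face_at \<phi> z) = \<l>" using assms(1) unfolding chord_def by auto
  show fr: "z = p" if "z \<in> frontier std_triangle"
  proof (rule ccontr)
    assume "z \<noteq> p"
    then have "z = p'" using that z assms(1) unfolding chord_def by blast
    then have "p' = midpoint p p'" using assms(2) halves_meet[of p' p p'] by simp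
    then show False using assms(1) midpoint_eq_endpoint(2)[of p p'] unfolding chord_def by metis
  qed
  show "z \<in> interior std_triangle" if "z \<noteq> p" using fr that s(1) std_triangle_split by blast
qed

lemma chord_end_frontier: "chord \<phi> p p' \<Longrightarrow> p \<in> frontier std_triangle"
  unfolding chord_def by blast

lemma chord_exists:
  assumes "\<phi> \<in> faces" "z \<in> std_triangle" "F (face_at \<phi> z) = \<l>"
  obtains p p' where "chord \<phi> p p'" "z \<in> half p p'"
proof -
  obtain p p' where p: "p \<noteq> p'" "{w \<in> std_triangle. F (face_at \<phi> w) = \<l>} = closed_segment p p'"
    "closed_segment p p' \<inter> frontier std_triangle = {p, p'}"
    by (rule face_level_segment[OF assms(1,2), unfolded assms(3), OF l_not_vertex])
  then have c: "chord \<phi> p p'" by (simp add: chord_def)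
  have "z \<in> closed_segment p p'" unfolding p(2)[symmetric] using assms by simp
  then have "z \<in> half p p' \<or> z \<in> half p' p" using chord_Un_halves[of p p'] by blast
  then show thesis using that c chord_commute[OF c] by blast
qed

lemma half_arcs_cover_level:
  assumes "F x = \<l>" shows "cover x \<in> \<Union>half_arcs"
proof -
  obtain \<phi> z where \<phi>: "\<phi> \<in> faces" "z \<in> std_triangle" "x = face_at \<phi> z"
    using faces_cover_plane[of x] by blast
  obtain p p' where "chord \<phi> p p'" "z \<in> half p p'"
    using chord_exists[OF \<phi>(1,2)] assms \<phi>(3) by blast
  then show ?thesis unfolding half_arcs_def using \<phi> by blast
qed

lemma half_arcs_subset_level: "\<Union>half_arcs \<subseteq> cover ` {x. F x = \<l>}"
  unfolding half_arcs_def using chord_point(2) by blast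

text \<open>
  A half chord meets the boundary of its triangle only in its first end, and different triangles have
  disjoint interiors. The second case is that of the two halves of one chord.
\<close>

lemma common_point_upstairs:
  assumes "\<phi> \<in> faces" "\<psi> \<in> faces" "chord \<phi> p p'" "chord \<psi> q q'" "z \<in> half p p'" "w \<in> half q q'"
    "face_at \<phi> z = face_at \<psi> w"
  obtains "z = p" "w = q"
  | "\<phi> = \<psi>" "z = midpoint p p'" "w = midpoint q q'" "q = p'" "q' = p"
  | "\<phi> = \<psi>" "z = w" "q = p" "q' = p'"
proof -
  have int_fr: False if "\<alpha> \<in> faces" "\<beta> \<in> faces" "x \<in> interior std_triangle" "y \<in> frontier std_triangle"
    "face_at \<alpha> x = face_at \<beta> y" for \<alpha> \<beta> x y
    using frontier_on_edge[OF that(2,4)] face_not_edge[OF that(1,3)] that(5) by metis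
  show thesis
  proof (cases "z = p")
    case True
    then have "w = q"
      using int_fr[OF assms(2,1) chord_point(4)[OF assms(4,6)] chord_end_frontier[OF assms(3)]] assms(7) by auto
    then show thesis using that True by blast
  next
    case False
    then have z: "z \<in> interior std_triangle" using chord_point(4)[OF assms(3,5)] by blast
    then have "w \<noteq> q" using int_fr[OF assms(1,2) z chord_end_frontier[OF assms(4)]] assms(7) by auto
    then have w: "w \<in> interior std_triangle" using chord_point(4)[OF assms(4,6)] by blast
    have eq: "\<phi> = \<psi>" "z = w" using face_at_interior_eq[OF assms(1,2) z w assms(7)] by auto
    then consider "q = p" "q' = p'" | "q = p'" "q' = p" using chord_unique assms(3,4) by metis
    then show thesis
    proof cases
      case 1
      then show ?thesis using that(3) eq by blast
    next
      case 2
      then have "z = midpoint p p'" using halves_meet assms(5,6) eq by blast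
      then show ?thesis using that(2) 2 eq by (simp add: midpoint_sym)
    qed
  qed
qed

text \<open>
  A deck transformation that matches the two points fixes \<open>\<l>\<close>, and so it maps chords to chords. This
  reduces common points in the torus to common points in the plane.
\<close>

lemma common_point:
  assumes "\<phi> \<in> faces" "\<psi> \<in> faces" "chord \<phi> p p'" "chord \<psi> q q'" "z \<in> half p p'" "w \<in> half q q'"
    "cover (face_at \<phi> z) = cover (face_at \<psi> w)"
  obtains g where "(fst \<psi>, g + snd \<psi>) \<in> faces" "chord (fst \<psi>, g + snd \<psi>) q q'"
    "face_at \<phi> z = face_at (fst \<psi>, g + snd \<psi>) w"
proof -
  obtain g where g: "face_at \<phi> z = deck g (face_at \<psi> w)" using assms(7) cover_eq_iff by metis
  have "\<rho> g \<l> = \<l>"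
    using F_equivariant[of g "face_at \<psi> w"] chord_point(2)[OF assms(3,5)] chord_point(2)[OF assms(4,6)]
    unfolding g[symmetric] by simp
  then have "F (face_at (fst \<psi>, g + snd \<psi>) x) = \<l> \<longleftrightarrow> F (face_at \<psi> x) = \<l>" for x
    unfolding deck_face_at[symmetric] F_equivariant by (metis rho_eq_iff)
  then have "chord (fst \<psi>, g + snd \<psi>) q q'" using assms(4) unfolding chord_def by simp
  then show thesis using that[of g] g assms(2) by simp
qed

lemma cover_face_shift: "cover ` face_at (fst \<phi>, g + snd \<phi>) ` S = cover ` face_at \<phi> ` S"
proof -
  have "cover (face_at (fst \<phi>, g + snd \<phi>) x) = cover (face_at \<phi> x)" for x
    by (metis cover_deck deck_face_at)
  then show ?thesis by (simp add: image_image)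
qed

lemma half_arc_is_arc:
  assumes "\<phi> \<in> faces" "chord \<phi> p p'"
  shows "arc (cover \<circ> face_at \<phi> \<circ> linepath p (midpoint p p'))" 
    "path_image (cover \<circ> face_at \<phi> \<circ> linepath p (midpoint p p')) = cover ` face_at \<phi> ` half p p'"
proof -
  let ?g = "cover \<circ> face_at \<phi> \<circ> linepath p (midpoint p p')"
  have img: "linepath p (midpoint p p') ` {0..1} = half p p'" by (rule linepath_image_01)
  show "path_image ?g = cover ` face_at \<phi> ` half p p'"
    by (simp only: path_image_def image_comp[symmetric] img)
  have "half p p' \<subseteq> std_triangle" using chord_point(1)[OF assms(2)] by blast
  then have "path ?g"
    unfolding path_def
    by (intro continuous_on_compose continuous_on_cover[of _ "\<lambda>x. x"] continuous_on_id continuous_on_linepath)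
      (simp add: img continuous_on_subset[OF continuous_face_at[OF assms(1)]])
  moreover have inj: "z = w" if z: "z \<in> half p p'" "w \<in> half p p'" "cover (face_at \<phi> z) = cover (face_at \<phi> w)" for z w
  proof -
    obtain g where g: "(fst \<phi>, g + snd \<phi>) \<in> faces" "chord (fst \<phi>, g + snd \<phi>) p p'"
      "face_at \<phi> z = face_at (fst \<phi>, g + snd \<phi>) w"
      by (rule common_point[OF assms(1,1,2,2) z])
    show ?thesis
      by (rule common_point_upstairs[OF assms(1) g(1) assms(2) g(2) z(1,2) g(3)]) blast+
  qed
  have "inj_on ?g {0..1}"
  proof (rule inj_onI)
    fix s t :: real assume st: "s \<in> {0..1}" "t \<in> {0..1}" "?g s = ?g t"
    have "linepath p (midpoint p p') s \<in> half p p'" "linepath p (midpoint p p') t \<in> half p p'"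
      using imageI[OF st(1), of "linepath p (midpoint p p')"] imageI[OF st(2), of "linepath p (midpoint p p')"]
      unfolding img by blast+
    then have "linepath p (midpoint p p') s = linepath p (midpoint p p') t"
      using st(3) by (intro inj) simp_all
    moreover have "p \<noteq> midpoint p p'"
      using assms(2) midpoint_eq_endpoint(1)[of p p'] unfolding chord_def by metis
    ultimately show "s = t" using inj_on_linepath[of p "midpoint p p'"] st by (auto dest: inj_onD)
  qed
  ultimately show "arc ?g" by (simp add: arc_def)
qed

lemma half_arc_nodes:
  assumes "\<phi> \<in> faces" "chord \<phi> p p'"
  shows "cover ` face_at \<phi> ` half p p' \<inter> nodes = {cover (face_at \<phi> p), cover (face_at \<phi> (midpoint p p'))}"
proof
  show "{cover (face_at \<phi> p), cover (face_at \<phi> (midpoint p p'))} \<subseteq> cover ` face_at \<phi> ` half p p' \<inter> nodes"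
    unfolding nodes_def using assms by auto
  show "cover ` face_at \<phi> ` half p p' \<inter> nodes \<subseteq> {cover (face_at \<phi> p), cover (face_at \<phi> (midpoint p p'))}"
  proof
    fix x assume "x \<in> cover ` face_at \<phi> ` half p p' \<inter> nodes"
    then obtain z \<psi> q q' w where z: "z \<in> half p p'" "x = cover (face_at \<phi> z)"
      and \<psi>: "\<psi> \<in> faces" "chord \<psi> q q'" and w: "w = q \<or> w = midpoint q q'" "x = cover (face_at \<psi> w)"
      unfolding nodes_def by blast
    have wh: "w \<in> half q q'" using w(1) by auto
    have "cover (face_at \<phi> z) = cover (face_at \<psi> w)" using z w by simp
    then obtain g where g: "(fst \<psi>, g + snd \<psi>) \<in> faces" "chord (fst \<psi>, g + snd \<psi>) q q'"
      "face_at \<phi> z = face_at (fst \<psi>, g + snd \<psi>) w"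
      by (rule common_point[OF assms(1) \<psi>(1) assms(2) \<psi>(2) z(1) wh])
    have "z = p \<or> z = midpoint p p'"
      by (rule common_point_upstairs[OF assms(1) g(1) assms(2) g(2) z(1) wh g(3)]) (use w(1) in auto)
    then show "x \<in> {cover (face_at \<phi> p), cover (face_at \<phi> (midpoint p p'))}" using z(2) by auto
  qed
qed

lemma distinct_half_arcs_meet_in_nodes:
  assumes "a \<in> half_arcs" "b \<in> half_arcs" "a \<noteq> b" shows "a \<inter> b \<subseteq> nodes"
proof
  fix x assume x: "x \<in> a \<inter> b"
  obtain \<phi> p p' where \<phi>: "\<phi> \<in> faces" "chord \<phi> p p'" "a = cover ` face_at \<phi> ` half p p'"
    using assms(1) unfolding half_arcs_def by blast
  obtain \<psi> q q' where \<psi>: "\<psi> \<in> faces" "chord \<psi> q q'" "b = cover ` face_at \<psi> ` half q q'"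
    using assms(2) unfolding half_arcs_def by blast
  obtain z w where z: "z \<in> half p p'" "x = cover (face_at \<phi> z)" and w: "w \<in> half q q'" "x = cover (face_at \<psi> w)"
    using x \<phi>(3) \<psi>(3) by blast
  have "cover (face_at \<phi> z) = cover (face_at \<psi> w)" using z w by simp
  then obtain g where g: "(fst \<psi>, g + snd \<psi>) \<in> faces" "chord (fst \<psi>, g + snd \<psi>) q q'"
    "face_at \<phi> z = face_at (fst \<psi>, g + snd \<psi>) w"
    by (rule common_point[OF \<phi>(1) \<psi>(1) \<phi>(2) \<psi>(2) z(1) w(1)])
  have ends: "cover (face_at \<phi> p) \<in> nodes" "cover (face_at \<phi> (midpoint p p')) \<in> nodes"
    unfolding nodes_def using \<phi> by blast+
  show "x \<in> nodes"
  proof (rule common_point_upstairs[OF \<phi>(1) g(1) \<phi>(2) g(2) z(1) w(1) g(3)])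
    assume "\<phi> = (fst \<psi>, g + snd \<psi>)" "q = p" "q' = p'"
    then have "a = b" unfolding \<phi>(3) \<psi>(3) using cover_face_shift by metis
    then show ?thesis using assms(3) by blast
  qed (use ends z(2) in simp_all)
qed

lemma half_arcs_distinct:
  assumes "\<phi> \<in> faces" "\<psi> \<in> faces" "chord \<phi> p p'" "chord \<psi> q q'"
    and eq: "cover ` face_at \<phi> ` half p p' = cover ` face_at \<psi> ` half q q'"
  obtains g where "\<phi> = (fst \<psi>, g + snd \<psi>)" "q = p" "q' = p'"
proof -
  \<comment> \<open>the midpoint of a half chord is neither of its ends, hence a point of no other half arc\<close>
  define z where "z = midpoint p (midpoint p p')"
  have ne: "p \<noteq> p'" using assms(3) by (simp add: chord_def)
  have z: "z \<in> half p p'" "z \<noteq> p" "z \<noteq> midpoint p p'"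
    using ne by (auto simp: z_def midpoint_in_closed_segment)
  then have "cover (face_at \<phi> z) \<in> cover ` face_at \<psi> ` half q q'" unfolding eq[symmetric] by blast
  then obtain w where w: "w \<in> half q q'" "cover (face_at \<phi> z) = cover (face_at \<psi> w)" by blast
  obtain g where g: "(fst \<psi>, g + snd \<psi>) \<in> faces" "chord (fst \<psi>, g + snd \<psi>) q q'"
    "face_at \<phi> z = face_at (fst \<psi>, g + snd \<psi>) w"
    using common_point[OF assms(1-4) z(1) w] .
  show thesis
    by (rule common_point_upstairs[OF assms(1) g(1) assms(3) g(2) z(1) w(1) g(3)]) (use that z in auto)
qed

lemma two_half_arcs_at_chord_midpoint:
  assumes "\<phi> \<in> faces" "chord \<phi> p p'"
  shows "card {a \<in> half_arcs. cover (face_at \<phi> (midpoint p p')) \<in> a} = 2"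
proof -
  define m where "m = midpoint p p'"
  have c': "chord \<phi> p' p" using assms(2) by (rule chord_commute)
  have ne: "p \<noteq> p'" using assms(2) by (simp add: chord_def)
  let ?a = "cover ` face_at \<phi> ` half p p'" and ?b = "cover ` face_at \<phi> ` half p' p"
  have "?a \<noteq> ?b" using half_arcs_distinct[OF assms(1,1,2) c'] ne by metis
  moreover have "{a \<in> half_arcs. cover (face_at \<phi> m) \<in> a} = {?a, ?b}"
  proof
    have "cover (face_at \<phi> m) \<in> ?a" "cover (face_at \<phi> m) \<in> ?b"
      by (auto simp: m_def midpoint_sym[of p' p])
    then show "{?a, ?b} \<subseteq> {a \<in> half_arcs. cover (face_at \<phi> m) \<in> a}"
      unfolding half_arcs_def using assms c' by blast
    show "{a \<in> half_arcs. cover (face_at \<phi> m) \<in> a} \<subseteq> {?a, ?b}"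
    proof
      fix a assume "a \<in> {a \<in> half_arcs. cover (face_at \<phi> m) \<in> a}"
      then obtain \<psi> q q' w where \<psi>: "\<psi> \<in> faces" "chord \<psi> q q'" "a = cover ` face_at \<psi> ` half q q'"
        and w: "w \<in> half q q'" "cover (face_at \<phi> m) = cover (face_at \<psi> w)"
        unfolding half_arcs_def by blast
      have mh: "m \<in> half p p'" by (simp add: m_def)
      obtain g where g: "(fst \<psi>, g + snd \<psi>) \<in> faces" "chord (fst \<psi>, g + snd \<psi>) q q'"
        "face_at \<phi> m = face_at (fst \<psi>, g + snd \<psi>) w"
        using common_point[OF assms(1) \<psi>(1) assms(2) \<psi>(2) mh w] .
      have "\<phi> = (fst \<psi>, g + snd \<psi>) \<and> (q = p \<and> q' = p' \<or> q = p' \<and> q' = p)"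
        by (rule common_point_upstairs[OF assms(1) g(1) assms(2) g(2) mh w(1) g(3)]) (use ne in \<open>auto simp: m_def\<close>)
      then show "a \<in> {?a, ?b}" unfolding \<psi>(3) using cover_face_shift[of \<psi> g] by auto
    qed
  qed
  ultimately show ?thesis unfolding m_def by simp
qed

text \<open>
  The point lies on an edge, and the two half arcs come from the two triangles at this edge. They stay
  different in the torus: a deck transformation that takes one to the other would fix their common
  end, hence be trivial.
\<close>

lemma two_half_arcs_at_chord_end:
  assumes "\<phi> \<in> faces" "chord \<phi> p p'"
  shows "card {a \<in> half_arcs. cover (face_at \<phi> p) \<in> a} = 2"
proof -
  define x where "x = face_at \<phi> p"
  have p: "p \<in> frontier std_triangle" using assms(2) by (rule chord_end_frontier)
  have Fx: "F x = \<l>" unfolding x_def using chord_point(2)[OF assms(2), of p] by simp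
  obtain \<epsilon> t where \<epsilon>: "\<epsilon> \<in> edges" "t \<in> {0<..<1}" "x = edge_at \<epsilon> t"
  proof (rule frontier_point_cases[OF assms(1) p])
    assume "p \<in> corners"
    then obtain g where "x = deck g v0" using face_corner_vertex[OF assms(1)] unfolding x_def by blast
    then show thesis using Fx l_not_vertex by auto
  next
    fix a b \<epsilon> t assume 1: "\<epsilon> \<in> edges" "t \<in> {0<..<1}" "p = linepath a b t"
      "\<And>t. t \<in> {0..1} \<Longrightarrow> face_at \<phi> (linepath a b t) = edge_at \<epsilon> t"
    have "t \<in> {0..1}" using 1(2) by auto
    then show thesis using that 1 unfolding x_def by blast
  qed
  obtain \<phi>1 \<phi>2 where f: "\<phi>1 \<in> faces" "\<phi>2 \<in> faces" "\<phi>1 \<noteq> \<phi>2"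
    "x \<in> face_at \<phi>1 ` std_triangle" "x \<in> face_at \<phi>2 ` std_triangle"
    using at_least_two_faces[OF \<epsilon>(1,2)] unfolding \<epsilon>(3) by metis
  have chord_at: "\<exists>z z'. chord \<psi> z z' \<and> face_at \<psi> z = x" if \<psi>: "\<psi> \<in> faces" "x \<in> face_at \<psi> ` std_triangle" for \<psi>
  proof -
    obtain z where z: "z \<in> std_triangle" "x = face_at \<psi> z" using \<psi>(2) by blast
    have "t \<in> {0..1}" using \<epsilon>(2) by auto
    then have "z \<in> frontier std_triangle"
      using z \<epsilon> face_not_edge[OF \<psi>(1) _ \<epsilon>(1)] std_triangle_split by (metis Un_iff)
    moreover obtain q q' where "chord \<psi> q q'" "z \<in> half q q'"
      using chord_exists[OF \<psi>(1) z(1)] Fx z(2) by blast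
    ultimately show ?thesis using chord_point(3) z(2) by blast
  qed
  obtain z1 z1' where 1: "chord \<phi>1 z1 z1'" "face_at \<phi>1 z1 = x" using chord_at[OF f(1,4)] by blast
  obtain z2 z2' where 2: "chord \<phi>2 z2 z2'" "face_at \<phi>2 z2 = x" using chord_at[OF f(2,5)] by blast
  let ?a = "cover ` face_at \<phi>1 ` half z1 z1'" and ?b = "cover ` face_at \<phi>2 ` half z2 z2'"
  have "?a \<noteq> ?b"
  proof
    assume "?a = ?b"
    then obtain g where g: "\<phi>1 = (fst \<phi>2, g + snd \<phi>2)" "z2 = z1"
      using half_arcs_distinct[OF f(1,2) 1(1) 2(1)] by metis
    then have "deck g (face_at \<phi>2 z2) = deck 0 (face_at \<phi>2 z2)"
      using 1(2) 2(2) by (metis deck_face_at deck_simps(1))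
    then have "g = 0" unfolding deck_inj_left .
    then show False using g f(3) by simp
  qed
  moreover have "{a \<in> half_arcs. cover x \<in> a} = {?a, ?b}"
  proof
    have "cover (face_at \<phi>1 z1) \<in> ?a" "cover (face_at \<phi>2 z2) \<in> ?b" by (intro imageI; simp)+
    then have "cover x \<in> ?a" "cover x \<in> ?b" unfolding 1(2) 2(2) .
    then show "{?a, ?b} \<subseteq> {a \<in> half_arcs. cover x \<in> a}"
      unfolding half_arcs_def using f 1 2 by blast
    show "{a \<in> half_arcs. cover x \<in> a} \<subseteq> {?a, ?b}"
    proof
      fix a assume "a \<in> {a \<in> half_arcs. cover x \<in> a}"
      then obtain \<psi> q q' w where \<psi>: "\<psi> \<in> faces" "chord \<psi> q q'" "a = cover ` face_at \<psi> ` half q q'"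
        and w: "w \<in> half q q'" "cover x = cover (face_at \<psi> w)"
        unfolding half_arcs_def by blast
      have zh: "z1 \<in> half z1 z1'" by simp
      have "cover (face_at \<phi>1 z1) = cover (face_at \<psi> w)" using w(2) 1(2) by simp
      then obtain g where g: "(fst \<psi>, g + snd \<psi>) \<in> faces" "chord (fst \<psi>, g + snd \<psi>) q q'"
        "face_at \<phi>1 z1 = face_at (fst \<psi>, g + snd \<psi>) w"
        by (rule common_point[OF f(1) \<psi>(1) 1(1) \<psi>(2) zh w(1)])
      define \<psi>' where "\<psi>' = (fst \<psi>, g + snd \<psi>)"
      note g = g[folded \<psi>'_def]
      have a: "a = cover ` face_at \<psi>' ` half q q'" unfolding \<psi>(3) \<psi>'_def cover_face_shift ..
      have "w = q"
      proof (rule common_point_upstairs[OF f(1) g(1) 1(1) g(2) zh w(1) g(3)])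
        assume "z1 = midpoint z1 z1'"
        then show ?thesis using 1(1) midpoint_eq_endpoint(1)[of z1 z1'] unfolding chord_def by metis
      qed auto
      then have xq: "face_at \<psi>' q = x" using g(3) 1(2) by simp
      have same: "a = cover ` face_at \<alpha> ` half z z'"
        if "\<psi>' = \<alpha>" "chord \<alpha> z z'" "face_at \<alpha> z = x" "\<alpha> \<in> faces" for \<alpha> z z'
      proof -
        have "q \<in> half q q'" "z \<in> half z z'" by auto
        then have "q \<in> std_triangle" "z \<in> std_triangle"
          using chord_point(1)[OF g(2)] chord_point(1)[OF that(2)] by blast+
        then have "q = z"
          using inj_onD[OF inj_face_at[OF that(4)], of q z] xq that(1,3) by simp
        have "z \<noteq> z'" using that(2) unfolding chord_def by blast
        then have "q' = z'" using chord_unique[OF that(2) g(2)[unfolded that(1)]] \<open>q = z\<close> by metis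
        then show ?thesis using a that(1) \<open>q = z\<close> by simp
      qed
      have "q \<in> std_triangle" using chord_point(1)[OF g(2), of q] by simp
      then have "x \<in> face_at \<psi>' ` std_triangle" using xq by blast
      then have "\<psi>' = \<phi>1 \<or> \<psi>' = \<phi>2"
        using at_most_two_faces[OF \<epsilon>(1,2) f(1,2) g(1) f(3), folded \<epsilon>(3)] f(4,5) by blast
      then show "a \<in> {?a, ?b}"
        using same[OF _ 1 f(1)] same[OF _ 2 f(2)] by (elim disjE) simp_all
    qed
  qed
  ultimately show ?thesis unfolding x_def by simp
qed

text \<open>
  Every half arc is the image of a half chord in one of the finitely many \<open>triangle_lift \<sigma>\<close>, at a height
  in the orbit of \<open>\<l>\<close>. On such a triangle, which is compact, only finitely many heights in the orbit
  occur, and each of them determines at most one chord.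
\<close>

lemma finite_half_arcs: "finite half_arcs"
proof -
  define lev where "lev \<sigma> y = {w \<in> std_triangle. F (triangle_lift \<sigma> w) = y}" for \<sigma> y
  define Y where "Y \<sigma> = range (\<lambda>g. \<rho> g \<l>) \<inter> (\<lambda>w. F (triangle_lift \<sigma> w)) ` std_triangle" for \<sigma>
  define Z where "Z \<sigma> y = {(p, p'). closed_segment p p' = lev \<sigma> y}" for \<sigma> y
  have finY: "finite (Y \<sigma>)" if "\<sigma> \<in> D" for \<sigma>
  proof -
    have "continuous_on std_triangle (\<lambda>w. F (triangle_lift \<sigma> w))"
      by (rule continuous_on_compose2[OF F_continuous[of UNIV] triangle_lift(1)[OF that]]) simp
    then have "bounded ((\<lambda>w. F (triangle_lift \<sigma> w)) ` std_triangle)"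
      by (intro compact_imp_bounded compact_continuous_image std_triangle_compact)
    then obtain B where "\<And>y. y \<in> (\<lambda>w. F (triangle_lift \<sigma> w)) ` std_triangle \<Longrightarrow> \<bar>y\<bar> \<le> B"
      unfolding bounded_real by blast
    then have "Y \<sigma> \<subseteq> range (\<lambda>g. \<rho> g \<l>) \<inter> {-B..B}" unfolding Y_def by fastforce
    then show ?thesis using locally_finite_orbit finite_subset by blast
  qed
  have finZ: "finite (Z \<sigma> y)" for \<sigma> y
  proof (cases "Z \<sigma> y = {}")
    case False
    then obtain p p' where "closed_segment p p' = lev \<sigma> y" unfolding Z_def by blast
    then have "Z \<sigma> y \<subseteq> {(p, p'), (p', p)}"
      unfolding Z_def by (auto simp flip: \<open>closed_segment p p' = lev \<sigma> y\<close> simp: doubleton_eq_iff)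
    then show ?thesis using finite_subset by blast
  qed simp
  have "half_arcs \<subseteq> (\<Union>\<sigma>\<in>D. \<Union>y\<in>Y \<sigma>. (\<lambda>(p, p'). cover ` triangle_lift \<sigma> ` half p p') ` Z \<sigma> y)"
  proof
    fix a assume "a \<in> half_arcs"
    then obtain \<phi> p p' where \<phi>: "\<phi> \<in> faces" "chord \<phi> p p'" "a = cover ` face_at \<phi> ` half p p'"
      unfolding half_arcs_def by blast
    obtain \<sigma> g where sg: "\<phi> = (\<sigma>, g)" by (cases \<phi>)
    then have \<sigma>: "\<sigma> \<in> D" using \<phi>(1) by (simp add: faces_def)
    define y where "y = \<rho> (- g) \<l>"
    have level: "F (face_at \<phi> w) = \<l> \<longleftrightarrow> F (triangle_lift \<sigma> w) = y" for w
    proof -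
      have "F (face_at \<phi> w) = \<rho> g (F (triangle_lift \<sigma> w))" by (simp add: face_at_def sg F_equivariant)
      then show ?thesis unfolding y_def by (metis rho_minus)
    qed
    then have "(p, p') \<in> Z \<sigma> y" using \<phi>(2) by (simp add: Z_def lev_def chord_def)
    moreover have "y \<in> Y \<sigma>"
    proof -
      have p: "p \<in> std_triangle" "F (face_at \<phi> p) = \<l>" using chord_point(1,2)[OF \<phi>(2), of p] by auto
      then have "y = F (triangle_lift \<sigma> p)" using level by simp
      moreover have "y \<in> range (\<lambda>g. \<rho> g \<l>)" unfolding y_def by (rule rangeI)
      ultimately show ?thesis unfolding Y_def using p(1) by blast
    qed
    moreover have "a = cover ` triangle_lift \<sigma> ` half p p'"
      unfolding \<phi>(3) image_image by (simp add: face_at_def sg)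
    ultimately have "a \<in> (\<lambda>(p, p'). cover ` triangle_lift \<sigma> ` half p p') ` Z \<sigma> y"
      by (intro image_eqI[of _ _ "(p, p')"]) simp_all
    then show "a \<in> (\<Union>\<sigma>\<in>D. \<Union>y\<in>Y \<sigma>. (\<lambda>(p, p'). cover ` triangle_lift \<sigma> ` half p p') ` Z \<sigma> y)"
      using \<sigma> \<open>y \<in> Y \<sigma>\<close> by blast
  qed
  moreover have "finite (\<Union>\<sigma>\<in>D. \<Union>y\<in>Y \<sigma>. (\<lambda>(p, p'). cover ` triangle_lift \<sigma> ` half p p') ` Z \<sigma> y)"
    using finite_cells(2) finY finZ by simp
  ultimately show ?thesis by (rule finite_subset)
qed

text \<open>
  The cycle of half arcs is at the same time separated from the other half arcs, which are compact. So
  the component of the level set through a lift of one of its points projects into the cycle, and it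
  contains a lift of the whole cycle.
\<close>

lemma closed_leaf_at_level:
  assumes "F y = \<l>"
  shows "\<exists>L\<in>leaves F. closed_leaf L"
proof -
  have ne: "half_arcs \<noteq> {}" using half_arcs_cover_level[OF assms] by blast
  obtain B \<gamma> where B: "B \<subseteq> half_arcs" and \<gamma>: "simple_path \<gamma>" "pathfinish \<gamma> = pathstart \<gamma>" "path_image \<gamma> = \<Union>B"
    and sep: "\<And>a. a \<in> half_arcs - B \<Longrightarrow> a \<inter> \<Union>B = {}"
  proof (rule two_regular_arcs_contain_cycle[OF finite_half_arcs ne, of nodes])
    show "\<exists>g. arc g \<and> path_image g = a \<and> a \<inter> nodes = {pathstart g, pathfinish g}" if a: "a \<in> half_arcs" for a
    proof -
      obtain \<phi> p p' where \<phi>: "\<phi> \<in> faces" "chord \<phi> p p'" "a = cover ` face_at \<phi> ` half p p'"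
        using a unfolding half_arcs_def by blast
      show ?thesis
        using half_arc_is_arc[OF \<phi>(1,2)] half_arc_nodes[OF \<phi>(1,2)] unfolding \<phi>(3)
        by (intro exI[of _ "cover \<circ> face_at \<phi> \<circ> linepath p (midpoint p p')"])
          (simp add: pathstart_def pathfinish_def linepath_def)
    qed
    show "card {a \<in> half_arcs. q \<in> a} = 2" if "q \<in> nodes" for q
      using that two_half_arcs_at_chord_end two_half_arcs_at_chord_midpoint unfolding nodes_def by blast
  qed (use distinct_half_arcs_meet_in_nodes in blast)+
  have "path_image \<gamma> \<subseteq> cover ` {x. F x = \<l>}" using \<gamma>(3) B half_arcs_subset_level by blast
  moreover have "\<gamma> 0 \<in> path_image \<gamma>" by (simp add: path_image_def)
  ultimately have "\<gamma> 0 \<in> cover ` {x. F x = \<l>}" by (rule subsetD)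
  then obtain x0 where x0: "F x0 = \<l>" "cover x0 = \<gamma> 0" by auto
  define C where "C = connected_component_set {x. F x = \<l>} x0"
  have C: "C \<in> components {x. F x = \<l>}" unfolding C_def using x0 by (intro componentsI) simp
  have x0C: "x0 \<in> C" unfolding C_def using x0 by simp
  have CF: "C \<subseteq> {x. F x = \<l>}" using in_components_subset[OF C] .
  have "cover ` C = path_image \<gamma>"
  proof
    show "path_image \<gamma> \<subseteq> cover ` C"
    proof -
      obtain \<eta> where \<eta>: "path \<eta>" "\<eta> 0 = x0" "\<And>t. t \<in> {0..1} \<Longrightarrow> cover (\<eta> t) = \<gamma> t"
        "\<And>t. t \<in> {0..1} \<Longrightarrow> F (\<eta> t) = \<l>"
        by (rule lift_into_level_set[OF simple_path_imp_path[OF \<gamma>(1)] \<open>path_image \<gamma> \<subseteq> _\<close> x0]) blast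
      have "path_image \<eta> \<subseteq> C"
      proof (rule components_maximal[OF C connected_path_image[OF \<eta>(1)]])
        show "path_image \<eta> \<subseteq> {x. F x = \<l>}" using \<eta>(4) unfolding path_image_def by blast
        have "x0 \<in> path_image \<eta>" using \<eta>(2) pathstart_in_path_image[of \<eta>] by (simp add: pathstart_def)
        then show "C \<inter> path_image \<eta> \<noteq> {}" using x0C by blast
      qed
      then show ?thesis
        using \<eta>(3) unfolding path_image_def by (metis image_mono image_subset_iff image_eqI)
    qed
    have fin: "finite (half_arcs - B)" using finite_half_arcs by simp
    have "closed (\<Union>(half_arcs - B))"
    proof (rule closed_Union[OF fin], rule ballI)
      fix a assume "a \<in> half_arcs - B"
      then obtain \<phi> p p' where \<phi>: "\<phi> \<in> faces" "chord \<phi> p p'" "a = cover ` face_at \<phi> ` half p p'"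
        unfolding half_arcs_def by blast
      show "closed a"
        using closed_path_image[OF arc_imp_path[OF half_arc_is_arc(1)[OF \<phi>(1,2)]]]
        unfolding half_arc_is_arc(2)[OF \<phi>(1,2)] \<phi>(3) .
    qed
    moreover have "closed (\<Union>B)" using closed_path_image[OF simple_path_imp_path[OF \<gamma>(1)]] \<gamma>(3) by simp
    moreover have "connected (cover ` C)"
      using in_components_connected[OF C]
      by (intro connected_continuous_image continuous_on_cover[of _ "\<lambda>x. x"] continuous_on_id)
    moreover have "cover ` C \<subseteq> \<Union>B \<union> \<Union>(half_arcs - B)" using half_arcs_cover_level CF B by blast
    moreover have "\<Union>B \<inter> \<Union>(half_arcs - B) \<inter> cover ` C = {}" using sep by blast
    moreover have "\<Union>B \<inter> cover ` C \<noteq> {}"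
    proof -
      have "cover x0 \<in> cover ` C" using x0C by (rule imageI)
      then show ?thesis using \<open>\<gamma> 0 \<in> path_image \<gamma>\<close> unfolding x0(2) \<gamma>(3) by blast
    qed
    ultimately have "\<Union>(half_arcs - B) \<inter> cover ` C = {}" using connected_closedD by blast
    then show "cover ` C \<subseteq> path_image \<gamma>" unfolding \<gamma>(3) using \<open>cover ` C \<subseteq> _\<close> by blast
  qed
  then have "closed_leaf (cover ` C)" unfolding closed_leaf_def using \<gamma> by metis
  moreover have "cover ` C \<in> leaves F" unfolding leaves_def using C by blast
  ultimately show ?thesis by blast
qed

end

context fLOiation_height
begin

text \<open>
  The level is attained, since it lies between the heights of two vertices and the plane is connected.
\<close>

lemma not_archimedean_imp_closed_leaf:
  assumes "\<not> archimedean_order R" shows "\<exists>L\<in>leaves F. closed_leaf L"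
proof -
  obtain a b \<l> where l: "0 < i a" "\<rho> a \<l> = \<l>" "\<l> \<notin> range i" "\<l> < i b" "\<And>k. i (scale k a) < \<l>"
    "\<And>c. (\<And>n::nat. i (scale (int n) a) \<le> c) \<Longrightarrow> \<l> \<le> c"
    by (rule nonarchimedean_fixed_point[OF assms]) blast
  interpret regular_level R s i \<rho> v E D v0 F \<l>
    by unfold_locales (use l(3) fixed_point_orbit_locally_finite[OF l(1,2,4-6)] in auto)
  have "connected (range F)"
    by (intro connected_continuous_image F_continuous connected_UNIV)
  moreover have "0 \<in> range F" "i b \<in> range F" using F_v0 F_vertex[of b] by (metis rangeI)+
  moreover have "0 < \<l>" using l(5)[of 0] by simp
  ultimately have "\<l> \<in> range F" using l(4) connectedD_interval[of "range F" 0 "i b" \<l>] by auto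
  then obtain y where "F y = \<l>" by (metis imageE)
  then show ?thesis by (rule closed_leaf_at_level)
qed

end

theorem proposition2p1:
  fixes v :: "complex \<times> complex"
    and E :: "(real \<Rightarrow> complex \<times> complex) set"
    and D :: "(real \<times> real \<Rightarrow> complex \<times> complex) set"
    and R :: "(int \<times> int) rel"
    and \<F> :: "(complex \<times> complex) set set"
  assumes "torus_triangulation {v} E D"
    and "essential E"
    and "left_order R"
    and "fLOiation v E D R \<F>"
  shows "(\<exists>L\<in>\<F>. closed_leaf L) \<longleftrightarrow> \<not> archimedean_order R"
proof -
  obtain s i \<rho> v0 F where data: "enumeration s" "order_embedding R s i" "dynamical_realization i \<rho>"
    "cover v0 = v" "height_function E D v0 \<rho> F" "\<F> = leaves F"
    using assms(4) unfolding fLOiation_def by blast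
  interpret fLOiation_height R s i \<rho> v E D v0 F
    by unfold_locales (use assms data in auto)
  show ?thesis
    unfolding data(6) using closed_leaf_imp_not_archimedean not_archimedean_imp_closed_leaf by blast
qed

end
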